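(* Let $\mathfrak g=\mathfrak{sl}(2,\mathbb C)$, $\Gamma=\mathrm{SL}(2,\mathbb Z)$, and let $\rho$ be the adjoint action of $\Gamma$ on $\mathfrak g$, i.e. $\rho(\gamma)A=\gamma A\gamma^{-1}$. Then there is an isomorphism of Lie algebras $$\mathfrak M^!_0(\mathfrak g,\Gamma,\rho)\cong \mathbb C\langle h,e,f\rangle\otimes_{\mathbb C}\mathbb C[j],$$ where the right-hand side is the free $\mathbb C[j]$-module on $h,e,f$ with the $\mathbb C[j]$-bilinear Lie bracket determined by $$[h,e]=2e,\qquad [h,f]=-2f,\qquad [e,f]=j(j-1728)\,h.$$
   Context: $\mathbb H^2$ is the upper half-plane with the action $\gamma\tau=\frac{a\tau+b}{c\tau+d}$ of $\mathrm{SL}(2,\mathbb Z)$. $\mathfrak M^!_0(\mathfrak g,\Gamma,\rho)$ is the Lie algebra, under the pointwise bracket, of holomorphic maps $f:\mathbb H^2\to\mathfrak g$ with $f(\gamma\tau)=\rho(\gamma)f(\tau)$ for all $\gamma\in\Gamma$, having at most exponential growth at every cusp: for each $s\in\mathbb Q\cup\{\infty\}$ and $g\in\mathrm{SL}(2,\mathbb Z)$ with $gs=\infty$, putting $\tau_s=g\tau$, there are constants $C,M$ with $\|f(\tau)\|<Ce^{M|\tau_s|}$ whenever $\operatorname{Im}\tau_s$ is large enough. $j=E_4^3/\Delta=q^{-1}+744+196884q+\dots$ ($q=e^{2\pi i\tau}$, $\Delta=(E_4^3-E_6^2)/1728$) is Klein's $j$-invariant, which generates the ring $\mathbb C[j]$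 of weight zero weakly holomorphic modular functions for $\mathrm{SL}(2,\mathbb Z)$. *)

theory Defs
  imports "HOL-Analysis.Analysis" "HOL-Algebra.Module"
    "HOL-Computational_Algebra.Polynomial"
begin

section \<open>Complex Lie algebras\<close>

definition complex_ring :: "complex ring" where
  "complex_ring = \<lparr>carrier = UNIV, monoid.mult = (*), one = 1, zero = 0, add = (+)\<rparr>"

text \<open>A Lie algebra is a \<^locale>\<open>Module.module\<close> whose \<open>mult\<close> field is the Lie bracket. The record field
  \<open>one\<close> carries no meaning, and the module laws mention neither \<open>mult\<close> nor \<open>one\<close>
  of the module.\<close>

locale complex_lie_algebra = Module.module complex_ring L
  for L :: "(complex, 'b) module" (structure) +
  assumes bracket_closed: "\<lbrakk>x \<in> carrier L; y \<in> carrier L\<rbrakk> \<Longrightarrow> x \<otimes> y \<in> carrier L"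
    and bracket_add_left: "\<lbrakk>x \<in> carrier L; y \<in> carrier L; z \<in> carrier L\<rbrakk>
      \<Longrightarrow> (x \<oplus> y) \<otimes> z = x \<otimes> z \<oplus> y \<otimes> z"
    and bracket_add_right: "\<lbrakk>x \<in> carrier L; y \<in> carrier L; z \<in> carrier L\<rbrakk>
      \<Longrightarrow> x \<otimes> (y \<oplus> z) = x \<otimes> y \<oplus> x \<otimes> z"
    and bracket_smult_left: "\<lbrakk>x \<in> carrier L; y \<in> carrier L\<rbrakk> \<Longrightarrow> (c \<odot> x) \<otimes> y = c \<odot> (x \<otimes> y)"
    and bracket_smult_right: "\<lbrakk>x \<in> carrier L; y \<in> carrier L\<rbrakk> \<Longrightarrow> x \<otimes> (c \<odot> y) = c \<odot> (x \<otimes> y)"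
    and bracket_self: "x \<in> carrier L \<Longrightarrow> x \<otimes> x = \<zero>"
    and jacobi: "\<lbrakk>x \<in> carrier L; y \<in> carrier L; z \<in> carrier L\<rbrakk>
      \<Longrightarrow> x \<otimes> (y \<otimes> z) \<oplus> y \<otimes> (z \<otimes> x) \<oplus> z \<otimes> (x \<otimes> y) = \<zero>"

definition lie_iso :: "(complex, 'b) module \<Rightarrow> (complex, 'c) module \<Rightarrow> ('b \<Rightarrow> 'c) set" where
  "lie_iso L M = {\<phi>. bij_betw \<phi> (carrier L) (carrier M) \<and>
     (\<forall>x\<in>carrier L. \<forall>y\<in>carrier L. \<phi> (x \<oplus>\<^bsub>L\<^esub> y) = \<phi> x \<oplus>\<^bsub>M\<^esub> \<phi> y) \<and>
     (\<forall>c. \<forall>x\<in>carrier L. \<phi> (c \<odot>\<^bsub>L\<^esub> x) = c \<odot>\<^bsub>M\<^esub> \<phi> x) \<and>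
     (\<forall>x\<in>carrier L. \<forall>y\<in>carrier L. \<phi> (x \<otimes>\<^bsub>L\<^esub> y) = \<phi> x \<otimes>\<^bsub>M\<^esub> \<phi> y)}"

definition lie_isomorphic :: "(complex, 'b) module \<Rightarrow> (complex, 'c) module \<Rightarrow> bool"
    (infix \<open>\<cong>\<^sub>L\<close> 50) where
  "L \<cong>\<^sub>L M \<longleftrightarrow> complex_lie_algebra L \<and> complex_lie_algebra M \<and> lie_iso L M \<noteq> {}"


section \<open>The modular group, the upper half-plane and the cusps\<close>

definition SL2Z :: "(int^2^2) set" where
  "SL2Z = {\<gamma>. det \<gamma> = 1}"

definition upper_half_plane :: "complex set" (\<open>\<H>\<close>) where
  "\<H> = {\<tau>. Im \<tau> > 0}"

definition moebius :: "int^2^2 \<Rightarrow> complex \<Rightarrow> complex" where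
  "moebius \<gamma> \<tau> =
     (of_int (\<gamma>$1$1) * \<tau> + of_int (\<gamma>$1$2)) / (of_int (\<gamma>$2$1) * \<tau> + of_int (\<gamma>$2$2))"

text \<open>The cusps \<open>\<rat> \<union> {\<infinity>}\<close>; the value \<open>None\<close> encodes \<open>\<infinity>\<close>.\<close>

type_synonym cusp = "rat option"

definition moebius_cusp :: "int^2^2 \<Rightarrow> cusp \<Rightarrow> cusp" where
  "moebius_cusp \<gamma> s = (case s of
     None \<Rightarrow> if \<gamma>$2$1 = 0 then None else Some (of_int (\<gamma>$1$1) / of_int (\<gamma>$2$1))
   | Some r \<Rightarrow> if of_int (\<gamma>$2$1) * r + of_int (\<gamma>$2$2) = 0 then None
       else Some ((of_int (\<gamma>$1$1) * r + of_int (\<gamma>$1$2)) / (of_int (\<gamma>$2$1) * r + of_int (\<gamma>$2$2))))"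


section \<open>The Lie algebra of weight zero equivariant maps\<close>

definition exp_growth_at_cusps :: "(complex \<Rightarrow> 'a::real_normed_vector) \<Rightarrow> bool" where
  "exp_growth_at_cusps f \<longleftrightarrow>
     (\<forall>s::cusp. \<forall>g\<in>SL2Z. moebius_cusp g s = None \<longrightarrow>
        (\<exists>C M B :: real. \<forall>\<tau>\<in>\<H>. Im (moebius g \<tau>) > B \<longrightarrow>
            norm (f \<tau>) < C * exp (M * cmod (moebius g \<tau>))))"

text \<open>Maps on \<open>\<H>\<close> are represented by functions on \<open>\<complex>\<close> that are \<^const>\<open>extensional\<close>, so that
  equality of representatives is equality on \<open>\<H>\<close>. The set \<open>\<gg>\<close> is meant to be a Lie algebra of
  complex matrices under the commutator, on which \<open>\<rho>\<close> acts.\<close>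

definition equivariant_lie_algebra ::
  "(complex^'n^'n) set \<Rightarrow> (int^2^2) set \<Rightarrow> (int^2^2 \<Rightarrow> complex^'n^'n \<Rightarrow> complex^'n^'n)
     \<Rightarrow> (complex, complex \<Rightarrow> complex^'n^'n) module" (\<open>\<MM>\<^sub>0\<close>) where
  "\<MM>\<^sub>0 \<gg> \<Gamma> \<rho> = \<lparr>
     carrier = {f \<in> \<H> \<rightarrow>\<^sub>E \<gg>.
       (\<forall>i k. (\<lambda>\<tau>. f \<tau> $ i $ k) holomorphic_on \<H>) \<and>
       (\<forall>\<gamma>\<in>\<Gamma>. \<forall>\<tau>\<in>\<H>. f (moebius \<gamma> \<tau>) = \<rho> \<gamma> (f \<tau>)) \<and>
       exp_growth_at_cusps f},
     monoid.mult = (\<lambda>f g. \<lambda>\<tau>\<in>\<H>. f \<tau> ** g \<tau> - g \<tau> ** f \<tau>),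
     one = (\<lambda>\<tau>\<in>\<H>. 0),
     zero = (\<lambda>\<tau>\<in>\<H>. 0),
     add = (\<lambda>f g. \<lambda>\<tau>\<in>\<H>. f \<tau> + g \<tau>),
     smult = (\<lambda>c f. \<lambda>\<tau>\<in>\<H>. map_matrix ((*) c) (f \<tau>))\<rparr>"

definition sl2 :: "(complex^2^2) set" where
  "sl2 = {A. trace A = 0}"

definition adjoint_action :: "int^2^2 \<Rightarrow> complex^2^2 \<Rightarrow> complex^2^2" where
  "adjoint_action \<gamma> A = map_matrix of_int \<gamma> ** A ** matrix_inv (map_matrix of_int \<gamma>)"


section \<open>Klein's j-invariant\<close>

text \<open>The Eisenstein series of even weight \<open>k \<ge> 4\<close>, normalised to have constant term 1 in its
  \<open>q\<close>-expansion: \<open>E\<^sub>k(\<tau>) = 1/2 \<Sum> (c\<tau> + d)\<^sup>-\<^sup>k\<close>, summed (absolutely) over coprime pairs of integers.\<close>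

definition eisenstein_E :: "nat \<Rightarrow> complex \<Rightarrow> complex" where
  "eisenstein_E k \<tau> =
     (\<Sum>\<^sub>\<infinity>(c, d)\<in>{(c :: int, d :: int). coprime c d}. 1 / (of_int c * \<tau> + of_int d) ^ k) / 2"

definition modular_Delta :: "complex \<Rightarrow> complex" where
  "modular_Delta \<tau> = (eisenstein_E 4 \<tau> ^ 3 - eisenstein_E 6 \<tau> ^ 2) / 1728"

definition klein_j :: "complex \<Rightarrow> complex" where
  "klein_j \<tau> = eisenstein_E 4 \<tau> ^ 3 / modular_Delta \<tau>"

definition polys_in_j :: "(complex \<Rightarrow> complex) set" (\<open>\<complex>[j]\<close>) where
  "\<complex>[j] = range (\<lambda>p :: complex poly. \<lambda>\<tau>\<in>\<H>. poly p (klein_j \<tau>))"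


section \<open>The free \<open>\<complex>[j]\<close>-module on \<open>h, e, f\<close>\<close>

datatype hef = Bas_h | Bas_e | Bas_f

lemma UNIV_hef: "UNIV = {Bas_h, Bas_e, Bas_f}"
  by (auto intro: hef.exhaust)

instance hef :: finite
  by standard (simp add: UNIV_hef)

definition basis_vec :: "hef \<Rightarrow> hef \<Rightarrow> complex" where
  "basis_vec a = (\<lambda>k. if k = a then 1 else 0)"

text \<open>Brackets of basis elements; \<open>basis_bracket \<tau> a b k\<close> is the value at \<open>\<tau>\<close> of the coefficient
  of \<open>[a, b]\<close> at \<open>k\<close>.\<close>

fun basis_bracket :: "complex \<Rightarrow> hef \<Rightarrow> hef \<Rightarrow> hef \<Rightarrow> complex" where
  "basis_bracket \<tau> Bas_h Bas_e = (\<lambda>k. 2 * basis_vec Bas_e k)"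
| "basis_bracket \<tau> Bas_h Bas_f = (\<lambda>k. - 2 * basis_vec Bas_f k)"
| "basis_bracket \<tau> Bas_e Bas_f = (\<lambda>k. klein_j \<tau> * (klein_j \<tau> - 1728) * basis_vec Bas_h k)"
| "basis_bracket \<tau> Bas_e Bas_h = (\<lambda>k. - 2 * basis_vec Bas_e k)"
| "basis_bracket \<tau> Bas_f Bas_h = (\<lambda>k. 2 * basis_vec Bas_f k)"
| "basis_bracket \<tau> Bas_f Bas_e = (\<lambda>k. - (klein_j \<tau> * (klein_j \<tau> - 1728)) * basis_vec Bas_h k)"
| "basis_bracket \<tau> _ _ = (\<lambda>k. 0)"

text \<open>An element \<open>x h \<cdot> h + x e \<cdot> e + x f \<cdot> f\<close> is given by its coefficient family in \<open>\<complex>[j]\<close>, and the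
  bracket is the \<open>\<complex>[j]\<close>-bilinear extension of \<^const>\<open>basis_bracket\<close>.\<close>

definition hef_lie_algebra :: "(complex, hef \<Rightarrow> complex \<Rightarrow> complex) module" where
  "hef_lie_algebra = \<lparr>
     carrier = {x. \<forall>a. x a \<in> \<complex>[j]},
     monoid.mult = (\<lambda>x y k. \<lambda>\<tau>\<in>\<H>. \<Sum>a\<in>UNIV. \<Sum>b\<in>UNIV. x a \<tau> * y b \<tau> * basis_bracket \<tau> a b k),
     one = (\<lambda>k. \<lambda>\<tau>\<in>\<H>. 0),
     zero = (\<lambda>k. \<lambda>\<tau>\<in>\<H>. 0),
     add = (\<lambda>x y k. \<lambda>\<tau>\<in>\<H>. x k \<tau> + y k \<tau>),
     smult = (\<lambda>c x k. \<lambda>\<tau>\<in>\<H>. c * x k \<tau>)\<rparr>"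

end

theory Submission
  imports Defs "HOL-Complex_Analysis.Conformal_Mappings"
begin

text \<open>Write \<open>J = c\<tau> + d\<close>. The columns of a suitable holomorphic frame \<open>P(\<tau>)\<close> of \<open>\<complex>\<^sup>2\<close> satisfy
  \<open>\<gamma> P(\<tau>) = P(\<gamma>\<tau>) diag(J, J\<^sup>-\<^sup>1)\<close>. So \<open>P A P\<^sup>-\<^sup>1\<close> is equivariant iff the entries of \<open>A\<close> are modular: the
  diagonal of weight 0, the off-diagonal ones of weights 2 and -2. These form free \<open>\<complex>[j]\<close>-modules
  generated by \<open>1\<close>, \<open>E\<^sub>4\<^sup>2 E\<^sub>6 / \<Delta>\<close> and \<open>E\<^sub>4 E\<^sub>6 / \<Delta>\<close>, and the product of the last two is \<open>j (j - 1728)\<close>.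

  The frame is built from \<open>\<Delta>'/\<Delta>\<close>, so \<open>\<Delta>\<close> must have no zeros. Instead of the valence formula, an argument
  of Siegel is used: a form of weight \<open>k\<close> of order \<open>n\<close> at the cusp vanishes if \<open>n\<close> is large compared to
  \<open>k\<close>, by the maximum principle at the maximum of \<open>|f| (Im \<tau>)\<^bsup>k/2\<^esup>\<close>. In weight 28 it yields
  \<open>12 \<Delta> \<Delta>'' - 13 \<Delta>'\<^sup>2 = 4\<pi>\<^sup>2 E\<^sub>4 \<Delta>\<^sup>2\<close>, which is incompatible with a zero of \<open>\<Delta>\<close>.\<close>

text \<open>The maximum principle in the disc of \<open>nome\<close> replaces the contour integral
  behind the valence formula, at the price of a weaker bound: a form of weight k vanishes if its
  order exceeds about k/10, instead of k/12. The uses made of it, in weights 0, 12 and 28 with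
  orders 1, 2 and 3, lie within this bound. The only Fourier coefficients that enter are the
  constant terms 1 of E_4 and E_6. One numerical fact, E_4(i) \<noteq> 0, shows that \<Delta> is not
  identically zero; with the vanishing theorem it forces the zero of \<Delta> at the cusp to be
  simple. The differential equation has a structural origin: k f f'' - (k + 1) f'^2 is modular of
  weight 2k + 4 for every f of weight k, and the multiple of E_4 \<Delta>^2 is chosen to cancel the
  coefficient of q^2. The frame contains \<tau> itself and is not periodic. Growth is therefore
  measured in |\<tau>|, and expansions in q are taken only of modular combinations of the
  coordinates in the frame.\<close>

lemma open_upper_half_plane: "open \<H>"
  unfolding upper_half_plane_def by (rule open_halfspace_Im_gt)

lemma upper_half_plane_iff: "\<tau> \<in> \<H> \<longleftrightarrow> Im \<tau> > 0"
  by (simp add: upper_half_plane_def)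

lemma convex_upper_half_plane: "convex \<H>"
  unfolding upper_half_plane_def by (rule convex_halfspace_Im_gt)

lemma minus_inverse_upper_half_plane: "\<tau> \<in> \<H> \<Longrightarrow> - 1 / \<tau> \<in> \<H>"
  by (auto simp: upper_half_plane_def Im_divide divide_simps sum_power2_gt_zero_iff)

lemma Im_minus_inverse: "Im (- 1 / \<tau>) = Im \<tau> / (cmod \<tau>)\<^sup>2"
  by (simp add: Im_divide cmod_power2)

text \<open>The set where \<open>f\<close> is nonzero is open and contains \<open>a\<close>, so
  \<open>g\<close> vanishes on a nonempty open subset of the connected \<H>, hence everywhere. This
  permits cancelling a factor that has zeros.\<close>

lemma eq_on_upper_half_plane:
  assumes "f holomorphic_on \<H>" "g holomorphic_on \<H>" "a \<in> \<H>" "f a \<noteq> 0"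
    and eq: "\<And>\<tau>. \<tau> \<in> \<H> \<Longrightarrow> f \<tau> * g \<tau> = 0" and "\<tau> \<in> \<H>"
  shows "g \<tau> = 0"
proof -
  have "continuous_on \<H> f"
    using assms(1) by (rule holomorphic_on_imp_continuous_on)
  then have "open (f -` (- {0}) \<inter> \<H>)"
    using continuous_on_open_vimage[OF open_upper_half_plane, of f] by blast
  moreover have "a \<in> f -` (- {0}) \<inter> \<H>" using assms by auto
  ultimately show ?thesis
    using analytic_continuation_open[of "f -` (- {0}) \<inter> \<H>" \<H> g "\<lambda>_. 0" \<tau>] assms eq
      open_upper_half_plane convex_connected[OF convex_upper_half_plane]
    by (metis IntE IntI Int_lower2 holomorphic_on_const mult_eq_0_iff vimage_eq Compl_iff empty_iff singletonI)
qed


section \<open>Expansions in the nome\<close>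

definition nome :: "complex \<Rightarrow> complex" where
  "nome \<tau> = exp (2 * of_real pi * \<i> * \<tau>)"

lemma norm_nome: "cmod (nome \<tau>) = exp (- 2 * pi * Im \<tau>)"
  by (simp add: nome_def)

lemma nome_nonzero [simp]: "nome \<tau> \<noteq> 0"
  by (simp add: nome_def)

lemma nome_in_ball: "\<tau> \<in> \<H> \<Longrightarrow> nome \<tau> \<in> ball 0 1"
  by (simp add: norm_nome upper_half_plane_iff)

lemma nome_holomorphic [holomorphic_intros]: "nome holomorphic_on A"
  unfolding nome_def by (intro holomorphic_intros)

lemma nome_add_of_int: "nome (\<tau> + of_int n) = nome \<tau>"
proof -
  have "nome (\<tau> + of_int n) = nome \<tau> * exp (2 * of_int n * of_real pi * \<i>)"
    by (simp add: nome_def exp_add [symmetric] algebra_simps)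
  also have "exp (2 * of_int n * complex_of_real pi * \<i>) = 1"
    using exp_integer_2pi[of "of_int n"] by simp
  finally show ?thesis by simp
qed

lemma nome_eq_cases:
  assumes "nome \<tau> = nome \<tau>'"
  obtains n :: int where "\<tau> = \<tau>' + of_int n"
proof -
  obtain n :: int where "2 * of_real pi * \<i> * \<tau> = 2 * of_real pi * \<i> * \<tau>' + of_int (2 * n) * of_real pi * \<i>"
    using assms unfolding nome_def exp_eq by auto
  then have "2 * of_real pi * \<i> * \<tau> = 2 * of_real pi * \<i> * (\<tau>' + of_int n)"
    by (simp add: algebra_simps)
  then show ?thesis using that by simp
qed

lemma nome_surj:
  assumes "q \<in> ball 0 1" "q \<noteq> 0"
  obtains \<tau> where "\<tau> \<in> \<H>" "nome \<tau> = q"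
proof
  have "ln (cmod q) < 0" using assms by simp
  then show "Ln q / (2 * of_real pi * \<i>) \<in> \<H>"
    using assms by (simp add: upper_half_plane_iff Im_divide power2_eq_square field_simps mult_less_0_iff)
  show "nome (Ln q / (2 * of_real pi * \<i>)) = q"
    using assms by (simp add: nome_def)
qed

lemma periodic_of_int:
  assumes per: "\<And>\<tau>. \<tau> \<in> \<H> \<Longrightarrow> f (\<tau> + 1) = f \<tau>" and "\<tau> \<in> \<H>"
  shows "f (\<tau> + of_int n) = f \<tau>"
proof -
  have *: "f (\<tau> + of_nat n) = f \<tau>" if "\<tau> \<in> \<H>" for n \<tau>
  proof (induction n)
    case (Suc n)
    have "f (\<tau> + of_nat n + 1) = f (\<tau> + of_nat n)"
      by (rule per) (use that in \<open>simp add: upper_half_plane_iff\<close>)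
    then show ?case using Suc by (simp add: algebra_simps)
  qed auto
  show ?thesis
  proof (cases "n \<ge> 0")
    case True
    then show ?thesis using *[of \<tau> "nat n"] assms by simp
  next
    case False
    then show ?thesis using *[of "\<tau> + of_int n" "nat (- n)"] assms(2)
      by (simp add: upper_half_plane_iff)
  qed
qed

text \<open>\<open>g\<close> is defined by choosing a preimage under \<open>nome\<close>; preimages
  differ by integers, so periodicity makes the choice irrelevant. Holomorphy is local and comes from
  a branch of the logarithm.\<close>

lemma q_expansion_punctured:
  assumes hol: "f holomorphic_on \<H>"
    and per: "\<And>\<tau>. \<tau> \<in> \<H> \<Longrightarrow> f (\<tau> + 1) = f \<tau>"
  obtains g where "g holomorphic_on ball 0 1 - {0}" "\<And>\<tau>. \<tau> \<in> \<H> \<Longrightarrow> f \<tau> = g (nome \<tau>)"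
proof -
  define g where "g q = f (SOME \<tau>. \<tau> \<in> \<H> \<and> nome \<tau> = q)" for q
  have fg: "f \<tau> = g (nome \<tau>)" if "\<tau> \<in> \<H>" for \<tau>
  proof -
    define \<sigma> where "\<sigma> = (SOME \<sigma>. \<sigma> \<in> \<H> \<and> nome \<sigma> = nome \<tau>)"
    have "\<sigma> \<in> \<H> \<and> nome \<sigma> = nome \<tau>"
      unfolding \<sigma>_def by (rule someI[of _ \<tau>]) (use that in simp)
    moreover then obtain n where "\<sigma> = \<tau> + of_int n" using nome_eq_cases by metis
    ultimately have "f \<sigma> = f \<tau>" using periodic_of_int[of f, OF per] that by simp
    then show ?thesis by (simp add: g_def \<sigma>_def)
  qed
  have local: "g holomorphic_on {q \<in> ball 0 1. 0 < Re (q / a)}" if a: "a \<noteq> 0" for a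
  proof -
    \<comment> \<open>Dividing by \<open>a\<close> moves the half-disc around \<open>a\<close> into
      the right half-plane, away from the branch cut of \<open>Ln\<close>; adding
      \<open>Ln a\<close> undoes the division after exponentiation.\<close>
    define l where "l q = (Ln (q / a) + Ln a) / (2 * of_real pi * \<i>)" for q
    have nome_l: "nome (l q) = q" if "q \<noteq> 0" for q
      using that a by (simp add: l_def nome_def exp_add)
    have l: "l q \<in> \<H>" if "q \<in> ball 0 1" "q \<noteq> 0" for q
    proof -
      have "exp (- 2 * pi * Im (l q)) < 1"
        using that norm_nome[of "l q"] nome_l[of q] by simp
      then show ?thesis by (simp add: upper_half_plane_iff zero_less_mult_iff)
    qed
    have "(f \<circ> l) holomorphic_on {q \<in> ball 0 1. 0 < Re (q / a)}"
    proof (rule holomorphic_on_compose_gen[where t = \<H>])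
      show "l holomorphic_on {q \<in> ball 0 1. 0 < Re (q / a)}"
        unfolding l_def
        by (intro holomorphic_intros) (use a in \<open>auto simp: complex_nonpos_Reals_iff\<close>)
      show "l ` {q \<in> ball 0 1. 0 < Re (q / a)} \<subseteq> \<H>"
        using l by force
    qed (rule hol)
    moreover have "(f \<circ> l) q = g q" if "q \<in> {q \<in> ball 0 1. 0 < Re (q / a)}" for q
    proof -
      have "q \<noteq> 0" using that by auto
      then show ?thesis using fg[of "l q"] nome_l l that by auto
    qed
    ultimately show ?thesis by (metis (no_types, lifting) holomorphic_cong)
  qed
  have "g field_differentiable at q" if q: "q \<in> ball 0 1 - {0}" for q
  proof (rule holomorphic_on_imp_differentiable_at[OF local[of q]])
    have "open ({z. 0 < Re (z / q)} \<inter> ball 0 1)"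
      by (intro open_Int open_Collect_less continuous_intros open_ball) (use q in auto)
    also have "{z. 0 < Re (z / q)} \<inter> ball 0 1 = {z \<in> ball 0 1. 0 < Re (z / q)}" by auto
    finally show "open {z \<in> ball 0 1. 0 < Re (z / q)}" .
  qed (use q in auto)
  then have "g holomorphic_on ball 0 1 - {0}"
    by (simp add: holomorphic_on_def field_differentiable_at_within)
  with fg that show ?thesis by blast
qed

text \<open>Boundedness for large \<open>Im \<tau>\<close> is boundedness of the expansion near q =
  0, where the singularity is then removable.\<close>

lemma q_expansion_bounded:
  assumes hol: "f holomorphic_on \<H>"
    and per: "\<And>\<tau>. \<tau> \<in> \<H> \<Longrightarrow> f (\<tau> + 1) = f \<tau>"
    and bound: "\<And>\<tau>. \<tau> \<in> \<H> \<Longrightarrow> Im \<tau> > B \<Longrightarrow> cmod (f \<tau>) \<le> C"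
  obtains g where "g holomorphic_on ball 0 1" "\<And>\<tau>. \<tau> \<in> \<H> \<Longrightarrow> f \<tau> = g (nome \<tau>)"
proof -
  obtain g where g: "g holomorphic_on ball 0 1 - {0}" "\<And>\<tau>. \<tau> \<in> \<H> \<Longrightarrow> f \<tau> = g (nome \<tau>)"
    using q_expansion_punctured[of f] hol per by blast
  have "\<forall>\<^sub>F z in at 0. cmod (g z) \<le> C"
    unfolding eventually_at
  \<comment> \<open>\<open>exp (- 2 * pi * B)\<close> is the modulus of \<open>nome\<close> at
    height \<open>B\<close>; the minimum with 1 keeps \<open>z\<close> in the image of \<H>.\<close>
  proof (intro exI[of _ "min 1 (exp (- 2 * pi * B))"] conjI ballI impI)
    fix z :: complex assume z: "z \<noteq> 0 \<and> dist z 0 < min 1 (exp (- 2 * pi * B))"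
    then obtain \<tau> where \<tau>: "\<tau> \<in> \<H>" "nome \<tau> = z" using nome_surj[of z] by auto
    then have "Im \<tau> > B" using z norm_nome[of \<tau>] by auto
    then show "cmod (g z) \<le> C" using bound g \<tau> by metis
  qed auto
  then obtain h where "h holomorphic_on ball 0 1" "\<forall>z\<in>ball 0 1 - {0}. h z = g z"
    using holomorphic_on_extend_bounded[OF g(1)] by auto
  then show ?thesis using that[of h] g nome_in_ball by force
qed

lemma tendsto_at_cusp:
  assumes g: "g holomorphic_on ball 0 1" and "e > 0"
  obtains B where "\<And>\<tau>. \<tau> \<in> \<H> \<Longrightarrow> Im \<tau> > B \<Longrightarrow> cmod (g (nome \<tau>) - g 0) < e"
proof -
  have "continuous (at 0) g"
    using holomorphic_on_imp_continuous_on[OF g] by (simp add: continuous_on_interior)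
  then obtain d where d: "d > 0" "\<And>z. dist z 0 < d \<Longrightarrow> dist (g z) (g 0) < e"
    using \<open>e > 0\<close> unfolding continuous_at_eps_delta by blast
  show ?thesis
  proof (rule that[of "- ln d / (2 * pi)"])
    fix \<tau> assume "Im \<tau> > - ln d / (2 * pi)"
    then have "- 2 * pi * Im \<tau> < ln d" by (simp add: field_simps)
    then have "cmod (nome \<tau>) < d"
      using d by (metis norm_nome exp_less_cancel_iff exp_ln)
    then show "cmod (g (nome \<tau>) - g 0) < e" using d(2)[of "nome \<tau>"] by (simp add: dist_norm)
  qed
qed

section \<open>Vanishing of modular forms of high order at the cusp\<close>

text \<open>A translation achieves |Re| \<le> 1/2. If the height is then below 4/5, the squared
  modulus is at most 1/4 + 16/25 = 89/100, and the inversion raises the height by a factor of at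
  least 100/89, so finitely many steps suffice. The height sqrt 3 / 2 of the usual fundamental
  domain would give no uniform factor.\<close>

lemma exists_reduced_point:
  fixes \<phi> :: "complex \<Rightarrow> 'a"
  assumes T: "\<And>\<tau>. \<tau> \<in> \<H> \<Longrightarrow> \<phi> (\<tau> + 1) = \<phi> \<tau>"
    and S: "\<And>\<tau>. \<tau> \<in> \<H> \<Longrightarrow> \<phi> (- 1 / \<tau>) = \<phi> \<tau>"
    and "\<tau> \<in> \<H>"
  obtains \<sigma> where "\<bar>Re \<sigma>\<bar> \<le> 1/2" "4/5 \<le> Im \<sigma>" "\<phi> \<sigma> = \<phi> \<tau>"
proof -
  \<comment> \<open>Here \<open>n\<close> bounds the number of inversions that are needed.\<close>
  have "\<exists>\<sigma>. \<bar>Re \<sigma>\<bar> \<le> 1/2 \<and> 4/5 \<le> Im \<sigma> \<and> \<phi> \<sigma> = \<phi> \<tau>"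
    if "\<tau> \<in> \<H>" "(89/100) ^ n * (4/5) \<le> Im \<tau>" for n \<tau>
    using that
  proof (induction n arbitrary: \<tau>)
    case 0
    define \<sigma> where "\<sigma> = \<tau> + of_int (- round (Re \<tau>))"
    have "\<phi> \<sigma> = \<phi> \<tau>" unfolding \<sigma>_def by (intro periodic_of_int T 0)
    moreover have "\<bar>Re \<sigma>\<bar> \<le> 1/2"
      using of_int_round_abs_le[of "Re \<tau>"] by (simp add: \<sigma>_def abs_minus_commute)
    ultimately show ?case using 0 by (intro exI[of _ \<sigma>]) (auto simp: \<sigma>_def)
  next
    case (Suc n)
    define \<sigma> where "\<sigma> = \<tau> + of_int (- round (Re \<tau>))"
    have \<sigma>: "\<phi> \<sigma> = \<phi> \<tau>" unfolding \<sigma>_def by (intro periodic_of_int T Suc)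
    have re: "\<bar>Re \<sigma>\<bar> \<le> 1/2"
      using of_int_round_abs_le[of "Re \<tau>"] by (simp add: \<sigma>_def abs_minus_commute)
    have im: "Im \<sigma> = Im \<tau>" by (simp add: \<sigma>_def)
    then have "\<sigma> \<in> \<H>" using Suc by (simp add: upper_half_plane_iff)
    show ?case
    proof (cases "4/5 \<le> Im \<tau>")
      case True
      then show ?thesis using re im \<sigma> by auto
    next
      case False
      have "(Re \<sigma>)\<^sup>2 \<le> (1/2)\<^sup>2" using re by (metis abs_le_square_iff abs_of_pos half_gt_zero_iff zero_less_one)
      moreover have "(Im \<sigma>)\<^sup>2 \<le> (4/5)\<^sup>2"
        using False im \<open>\<sigma> \<in> \<H>\<close> by (intro power_mono) (auto simp: upper_half_plane_iff)
      ultimately have "(cmod \<sigma>)\<^sup>2 \<le> 89/100" unfolding cmod_power2 by (simp add: power_divide)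
      moreover have "(cmod \<sigma>)\<^sup>2 > 0" using \<open>\<sigma> \<in> \<H>\<close> by (auto simp: upper_half_plane_iff)
      moreover have "Im \<tau> > 0" using Suc by (simp add: upper_half_plane_iff)
      ultimately have "Im \<tau> / (89/100) \<le> Im (- 1 / \<sigma>)"
        unfolding Im_minus_inverse im by (intro divide_left_mono) auto
      then have "(89/100) ^ n * (4/5) \<le> Im (- 1 / \<sigma>)"
        using Suc.prems by simp
      then have "\<exists>\<sigma>'. \<bar>Re \<sigma>'\<bar> \<le> 1/2 \<and> 4/5 \<le> Im \<sigma>' \<and> \<phi> \<sigma>' = \<phi> (- 1 / \<sigma>)"
        by (intro Suc.IH minus_inverse_upper_half_plane \<open>\<sigma> \<in> \<H>\<close>)
      then show ?thesis using S[OF \<open>\<sigma> \<in> \<H>\<close>] \<sigma> by simp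
    qed
  qed
  moreover have "\<exists>n. (89/100) ^ n * (4/5) \<le> Im \<tau>"
  proof -
    obtain n where "(89/100) ^ n < Im \<tau>"
      using real_arch_pow_inv[of "Im \<tau>" "89/100"] assms(3) by (auto simp: upper_half_plane_iff)
    moreover have "(89/100) ^ n * (4/5) \<le> (89/100 :: real) ^ n" by simp
    ultimately show ?thesis by (intro exI[of _ n]) linarith
  qed
  ultimately show ?thesis using that assms by blast
qed

text \<open>If f is not zero, the invariant function \<phi> = |f| (Im \<tau>)^m decays at the cusp
  and attains a positive maximum at a height y0 \<ge> 4/5. Since |g| = \<phi> exp(h) with h(y) = 2
  \<pi> n y - m ln y, the maximum principle on the disc |q| \<le> exp(-2 \<pi> y1) gives h(y0) \<le>
  h(y1) for all y1 < y0. But the bound on \<open>m\<close> says that h' is positive at 4/5, hence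
  also at y0. The weight is \<open>2 * m\<close>.\<close>

theorem modular_form_eq_0_if_high_order_at_cusp:
  assumes hol: "f holomorphic_on \<H>"
    and T: "\<And>\<tau>. \<tau> \<in> \<H> \<Longrightarrow> f (\<tau> + 1) = f \<tau>"
    and S: "\<And>\<tau>. \<tau> \<in> \<H> \<Longrightarrow> f (- 1 / \<tau>) = \<tau> ^ (2 * m) * f \<tau>"
    and g: "g holomorphic_on ball 0 1"
    and fg: "\<And>\<tau>. \<tau> \<in> \<H> \<Longrightarrow> f \<tau> = nome \<tau> ^ n * g (nome \<tau>)"
    and "n \<ge> 1" and mn: "real m < 2 * pi * n * (4/5)"
    and "\<tau> \<in> \<H>"
  shows "f \<tau> = 0"
proof (rule ccontr)
  assume "f \<tau> \<noteq> 0"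
  define \<phi> where "\<phi> \<tau> = cmod (f \<tau>) * Im \<tau> ^ m" for \<tau>
  have \<phi>T: "\<phi> (\<tau> + 1) = \<phi> \<tau>" if "\<tau> \<in> \<H>" for \<tau>
    using T that by (simp add: \<phi>_def)
  have \<phi>S: "\<phi> (- 1 / \<tau>) = \<phi> \<tau>" if "\<tau> \<in> \<H>" for \<tau>
  proof -
    have "\<tau> \<noteq> 0" using that by (auto simp: upper_half_plane_iff)
    then show ?thesis
      unfolding \<phi>_def Im_minus_inverse S[OF that]
      by (simp add: norm_mult norm_power power_divide power_mult [symmetric] mult_ac)
  qed
  have "\<phi> \<tau> > 0" using \<open>f \<tau> \<noteq> 0\<close> \<open>\<tau> \<in> \<H>\<close> by (simp add: \<phi>_def upper_half_plane_iff)
  obtain \<tau>1 where \<tau>1: "\<bar>Re \<tau>1\<bar> \<le> 1/2" "4/5 \<le> Im \<tau>1" "\<phi> \<tau>1 = \<phi> \<tau>"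
    using exists_reduced_point[of \<phi>, OF \<phi>T \<phi>S \<open>\<tau> \<in> \<H>\<close>] by blast
  \<comment> \<open>The factor \<open>exp (- Im \<sigma>)\<close> due to the zero at the cusp beats
    \<open>Im \<sigma> ^ m\<close>, so the maximum can be sought in a compact box.\<close>
  obtain Y where Y: "\<And>\<sigma>. Im \<sigma> > Y \<Longrightarrow> \<phi> \<sigma> < \<phi> \<tau>1"
  proof -
    obtain B where B: "\<And>\<tau>. \<tau> \<in> \<H> \<Longrightarrow> Im \<tau> > B \<Longrightarrow> cmod (g (nome \<tau>) - g 0) < 1"
      using tendsto_at_cusp[OF g, of 1] by auto
    define K where "K = cmod (g 0) + 1"
    have K: "K > 0" by (simp add: K_def add_nonneg_pos)
    have "((\<lambda>y. K * (y ^ m / exp y)) \<longlongrightarrow> K * 0) at_top"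
      by (intro tendsto_mult tendsto_const tendsto_power_div_exp_0)
    then have "\<forall>\<^sub>F y in at_top. K * (y ^ m / exp y) < \<phi> \<tau>1"
      using order_tendstoD(2)[of _ 0 at_top "\<phi> \<tau>1"] \<open>\<phi> \<tau> > 0\<close> \<tau>1 by simp
    then obtain Y0 where Y0: "\<And>y. y \<ge> Y0 \<Longrightarrow> K * (y ^ m / exp y) < \<phi> \<tau>1"
      by (auto simp: eventually_at_top_linorder)
    show ?thesis
    proof (rule that[of "Max {0, B, Y0}"])
      fix \<sigma> assume "Im \<sigma> > Max {0, B, Y0}"
      then have \<sigma>: "Im \<sigma> > 0" "Im \<sigma> > B" "Im \<sigma> > Y0" by auto
      then have "\<sigma> \<in> \<H>" by (simp add: upper_half_plane_iff)
      then have "cmod (g (nome \<sigma>)) \<le> K"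
        using B[of \<sigma>] \<sigma> norm_triangle_ineq2[of "g (nome \<sigma>)" "g 0"] by (simp add: K_def)
      moreover have "cmod (nome \<sigma>) ^ n \<le> exp (- Im \<sigma>)"
      proof -
        have "1 * 1 \<le> (2 * pi) * real n"
          using \<open>n \<ge> 1\<close> pi_gt3 by (intro mult_mono) auto
        then have "1 * Im \<sigma> \<le> 2 * pi * real n * Im \<sigma>"
          using \<sigma> by (intro mult_right_mono) auto
        then show ?thesis by (simp add: norm_nome exp_of_nat_mult [symmetric] mult_ac)
      qed
      ultimately have "cmod (f \<sigma>) \<le> exp (- Im \<sigma>) * K"
        unfolding fg[OF \<open>\<sigma> \<in> \<H>\<close>] norm_mult norm_power by (intro mult_mono) auto
      then have "\<phi> \<sigma> \<le> exp (- Im \<sigma>) * K * Im \<sigma> ^ m"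
        unfolding \<phi>_def using \<sigma> by (intro mult_right_mono) auto
      also have "\<dots> = K * (Im \<sigma> ^ m / exp (Im \<sigma>))" by (simp add: exp_minus field_simps)
      also have "\<dots> < \<phi> \<tau>1" using Y0 \<sigma> by simp
      finally show "\<phi> \<sigma> < \<phi> \<tau>1" .
    qed
  qed
  define K where "K = cbox (Complex (-1/2) (4/5)) (Complex (1/2) Y)"
  have KH: "K \<subseteq> \<H>" by (auto simp: K_def upper_half_plane_iff in_cbox_complex_iff)
  have "Im \<tau>1 \<le> Y" using Y[of \<tau>1] by force
  then have "\<tau>1 \<in> K" using \<tau>1 by (auto simp: K_def in_cbox_complex_iff)
  moreover have "continuous_on K \<phi>"
    unfolding \<phi>_def using holomorphic_on_imp_continuous_on[OF hol] KH
    by (intro continuous_intros) (rule continuous_on_subset)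
  moreover have "compact K" by (simp add: K_def)
  ultimately obtain \<tau>0 where \<tau>0: "\<tau>0 \<in> K" "\<And>\<sigma>. \<sigma> \<in> K \<Longrightarrow> \<phi> \<sigma> \<le> \<phi> \<tau>0"
    using continuous_attains_sup[of K \<phi>] by blast
  \<comment> \<open>Reduced points above height \<open>Y\<close> are dominated by
    \<open>\<tau>1\<close>, which lies in the box, so the maximum over the box is global.\<close>
  have max: "\<phi> \<sigma> \<le> \<phi> \<tau>0" if \<sigma>: "\<sigma> \<in> \<H>" for \<sigma>
  proof -
    obtain \<sigma>' where \<sigma>': "\<bar>Re \<sigma>'\<bar> \<le> 1/2" "4/5 \<le> Im \<sigma>'" "\<phi> \<sigma>' = \<phi> \<sigma>"
      using exists_reduced_point[of \<phi>, OF \<phi>T \<phi>S \<sigma>] by blast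
    show ?thesis
    proof (cases "Im \<sigma>' > Y")
      case True
      then show ?thesis using Y \<sigma>' \<tau>0(2)[OF \<open>\<tau>1 \<in> K\<close>] by force
    next
      case False
      then have "\<sigma>' \<in> K" using \<sigma>' by (auto simp: K_def in_cbox_complex_iff)
      then show ?thesis using \<tau>0 \<sigma>' by metis
    qed
  qed
  define y0 where "y0 = Im \<tau>0"
  have y0: "y0 \<ge> 4/5" using \<tau>0 by (auto simp: K_def in_cbox_complex_iff y0_def)
  have \<tau>0H: "\<tau>0 \<in> \<H>" using KH \<tau>0 by auto
  have pos: "\<phi> \<tau>0 > 0" using max[OF \<open>\<tau> \<in> \<H>\<close>] \<open>\<phi> \<tau> > 0\<close> by simp
  \<comment> \<open>\<open>exp (h y)\<close> is the quotient |g| / \<phi> at height y, that is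
    |q|^(-n) / y^m.\<close>
  define h where "h y = 2 * pi * n * y - m * ln y" for y
  have norm_g: "cmod (g (nome \<sigma>)) = \<phi> \<sigma> * exp (h (Im \<sigma>))" if "\<sigma> \<in> \<H>" for \<sigma>
  proof -
    have y: "Im \<sigma> > 0" using that by (simp add: upper_half_plane_iff)
    have "exp (h (Im \<sigma>)) = exp (2 * pi * n * Im \<sigma>) / Im \<sigma> ^ m"
      using y by (simp add: h_def exp_diff exp_of_nat_mult)
    moreover have "cmod (nome \<sigma>) ^ n = exp (- (2 * pi * n * Im \<sigma>))"
      by (simp add: norm_nome exp_of_nat_mult [symmetric] mult_ac)
    ultimately have one: "Im \<sigma> ^ m * exp (h (Im \<sigma>)) * cmod (nome \<sigma>) ^ n = 1"
      using y by (simp add: exp_minus)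
    have "\<phi> \<sigma> * exp (h (Im \<sigma>)) = cmod (g (nome \<sigma>)) * (Im \<sigma> ^ m * exp (h (Im \<sigma>)) * cmod (nome \<sigma>) ^ n)"
      unfolding \<phi>_def fg[OF that] norm_mult norm_power by (simp only: mult_ac)
    then show ?thesis by (simp add: one)
  qed
  have key: "h y0 \<le> h y1" if y1: "0 < y1" "y1 < y0" for y1
  proof -
    \<comment> \<open>The circle of radius \<open>r\<close> is the image of the line at height
      \<open>y1\<close>; as this lies below \<open>\<tau>0\<close>, the disc contains
      \<open>nome \<tau>0\<close>.\<close>
    define r where "r = exp (- 2 * pi * y1)"
    have r: "0 < r" "r < 1" using y1 by (auto simp: r_def)
    have "cmod (g (nome \<tau>0)) \<le> \<phi> \<tau>0 * exp (h y1)"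
    proof (rule maximum_modulus_frontier[of g "cball 0 r"])
      show "g holomorphic_on interior (cball 0 r)"
        using g by (rule holomorphic_on_subset) (use r in auto)
      show "continuous_on (closure (cball 0 r)) g"
        using holomorphic_on_imp_continuous_on[OF g]
        by (rule continuous_on_subset) (use r in auto)
      show "nome \<tau>0 \<in> cball 0 r" using y1 by (simp add: norm_nome r_def y0_def)
      fix z assume "z \<in> frontier (cball (0::complex) r)"
      then have z: "cmod z = r" by simp
      then obtain \<sigma> where \<sigma>: "\<sigma> \<in> \<H>" "nome \<sigma> = z" using nome_surj[of z] r by (metis mem_ball_0 norm_zero less_irrefl)
      then have "Im \<sigma> = y1" using z norm_nome[of \<sigma>] by (simp add: r_def)
      then show "cmod (g z) \<le> \<phi> \<tau>0 * exp (h y1)"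
        using norm_g[OF \<sigma>(1)] max[OF \<sigma>(1)] \<sigma>(2) by (simp add: mult_right_mono)
    qed auto
    then show ?thesis using norm_g[OF \<tau>0H] pos by (simp add: y0_def)
  qed
  have "(h has_real_derivative (2 * pi * n - m / y0)) (at y0)"
    unfolding h_def using y0 by (auto intro!: derivative_eq_intros)
  moreover have "2 * pi * n - m / y0 > 0"
  proof -
    have "real m < 2 * pi * n * y0"
      using mn mult_left_mono[OF y0, of "2 * pi * n"] by linarith
    then show ?thesis using y0 by (simp add: field_simps)
  qed
  ultimately obtain d where d: "d > 0" "\<And>e. 0 < e \<Longrightarrow> e < d \<Longrightarrow> h (y0 - e) < h y0"
    using DERIV_pos_inc_left[of h] by blast
  define e where "e = min (d/2) (y0/2)"
  have "0 < e" "e < d" "e < y0" using d y0 by (auto simp: e_def)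
  then show False using d(2)[of e] key[of "y0 - e"] by simp
qed

section \<open>Eisenstein series\<close>

definition coprime_pairs :: "(int \<times> int) set" where
  "coprime_pairs = {(c, d). coprime c d}"

definition eisenstein_term :: "nat \<Rightarrow> complex \<Rightarrow> int \<times> int \<Rightarrow> complex" where
  "eisenstein_term k \<tau> = (\<lambda>(c, d). 1 / (of_int c * \<tau> + of_int d) ^ k)"

lemma eisenstein_E_eq: "eisenstein_E k \<tau> = infsum (eisenstein_term k \<tau>) coprime_pairs / 2"
  by (simp add: eisenstein_E_def eisenstein_term_def coprime_pairs_def)

lemma coprime_pair_nonzero: "(c, d) \<in> coprime_pairs \<Longrightarrow> c \<noteq> 0 \<or> d \<noteq> 0"
  by (auto simp: coprime_pairs_def)

lemma coprime_pairs_0: "(0, d) \<in> coprime_pairs \<longleftrightarrow> d = 1 \<or> d = - 1"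
  by (auto simp: coprime_pairs_def)

lemma cocycle_nonzero:
  assumes "\<tau> \<in> \<H>" "c \<noteq> 0 \<or> d \<noteq> (0::int)"
  shows "of_int c * \<tau> + of_int d \<noteq> 0"
proof
  assume "of_int c * \<tau> + of_int d = 0"
  then have "Im (of_int c * \<tau> + of_int d) = 0" "Re (of_int c * \<tau> + of_int d) = 0" by simp_all
  then show False using assms by (auto simp: upper_half_plane_iff)
qed

text \<open>A majorant of product form, so that summability over pairs of integers reduces to one
  variable. The \<open>1 +\<close> keeps it finite and positive on the axes.\<close>

definition pair_weight :: "int \<times> int \<Rightarrow> real" where
  "pair_weight = (\<lambda>(c, d). 1 / (1 + (real_of_int c)\<^sup>2) * (1 / (1 + (real_of_int d)\<^sup>2)))"

lemma pair_weight_pos: "pair_weight p > 0"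
  by (cases p) (simp add: pair_weight_def add_pos_nonneg)

lemma summable_inverse_one_plus_square: "(\<lambda>c::int. 1 / (1 + (real_of_int c)\<^sup>2)) summable_on UNIV"
proof -
  have nat: "(\<lambda>n::nat. 1 / (1 + (real n)\<^sup>2)) summable_on UNIV"
  proof (rule summable_nonneg_imp_summable_on)
    have "summable (\<lambda>n::nat. 2 * (1 / real (Suc n) ^ 2))"
      using inverse_squares_sums by (intro summable_mult) (auto simp: sums_iff)
    then show "summable (\<lambda>n::nat. 1 / (1 + (real n)\<^sup>2))"
    proof (rule summable_comparison_test'[where N = 0])
      fix n :: nat
      have "0 \<le> (real n - 1)\<^sup>2" by simp
      then have "(real (Suc n))\<^sup>2 \<le> 2 * (1 + (real n)\<^sup>2)" by (simp add: power2_eq_square algebra_simps)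
      then show "norm (1 / (1 + (real n)\<^sup>2)) \<le> 2 * (1 / real (Suc n) ^ 2)"
        by (simp add: divide_simps add_pos_nonneg)
    qed
  qed auto
  have "(\<lambda>c::int. 1 / (1 + (real_of_int c)\<^sup>2)) summable_on int ` UNIV"
    using nat by (subst summable_on_reindex) (auto simp: o_def inj_on_def)
  moreover have "(\<lambda>c::int. 1 / (1 + (real_of_int c)\<^sup>2)) summable_on (\<lambda>n. - int n) ` UNIV"
    using nat by (subst summable_on_reindex) (auto simp: o_def inj_on_def)
  ultimately have "(\<lambda>c::int. 1 / (1 + (real_of_int c)\<^sup>2)) summable_on (int ` UNIV \<union> (\<lambda>n. - int n) ` UNIV)"
    by (rule summable_on_union)
  also have "int ` UNIV \<union> (\<lambda>n. - int n) ` UNIV = UNIV"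
    by (auto simp: image_iff) (metis int_cases2)
  finally show ?thesis .
qed

lemma summable_product:
  fixes f :: "'a \<Rightarrow> real" and g :: "'b \<Rightarrow> real"
  assumes "f summable_on A" "g summable_on B" "\<And>x. x \<in> A \<Longrightarrow> f x \<ge> 0" "\<And>y. y \<in> B \<Longrightarrow> g y \<ge> 0"
  shows "((\<lambda>(x, y). f x * g y) has_sum infsum f A * infsum g B) (A \<times> B)"
proof -
  have "(\<lambda>(x, y). f x * g y) summable_on A \<times> B"
  proof (rule summable_on_SigmaI)
    fix x assume "x \<in> A"
    show "((\<lambda>y. case (x, y) of (x, y) \<Rightarrow> f x * g y) has_sum f x * infsum g B) B"
      using assms(2) by (auto intro!: has_sum_cmult_right)
  next
    show "(\<lambda>x. f x * infsum g B) summable_on A"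
      by (intro summable_on_cmult_left assms)
  qed (use assms in auto)
  moreover have "infsum (\<lambda>(x, y). f x * g y) (A \<times> B) = infsum f A * infsum g B"
    using infsum_Sigma'_banach[OF calculation]
    by (simp add: infsum_cmult_left' infsum_cmult_right')
  ultimately show ?thesis by (metis has_sum_infsum)
qed

lemma pair_weight_summable: "pair_weight summable_on A"
proof -
  have "pair_weight summable_on UNIV \<times> UNIV"
    unfolding pair_weight_def
    by (rule has_sum_imp_summable, rule summable_product) (auto intro: summable_inverse_one_plus_square)
  then show ?thesis using summable_on_subset_banach by (metis UNIV_Times_UNIV top_greatest)
qed

lemma cmod_cocycle_sq: "(cmod (of_int c * \<tau> + of_int d))\<^sup>2 = (c * Re \<tau> + d)\<^sup>2 + c\<^sup>2 * (Im \<tau>)\<^sup>2"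
  by (simp add: cmod_power2 power_mult_distrib)

text \<open>N = |c \<tau> + d|^2 controls c^2 through the imaginary part, and then d^2 through the
  real part, so that s = c^2 + d^2 \<le> K N. Since k = 2m with m \<ge> 2, the term is N^(-m), and
  (1 + c^2) (1 + d^2) \<le> 3 s^2 \<le> 3 s^m. The constant depends only on the region, as the
  Weierstrass test requires.\<close>

lemma eisenstein_term_bound:
  assumes \<tau>: "\<eta> \<le> Im \<tau>" "\<eta> > 0" "\<bar>Re \<tau>\<bar> \<le> R" and k: "k \<ge> 4" "even k" and p: "p \<in> coprime_pairs"
  shows "cmod (eisenstein_term k \<tau> p) \<le> 3 * (2 + 2 * (1 + R\<^sup>2) / \<eta>\<^sup>2) ^ (k div 2) * pair_weight p"
proof (cases p)
  case (Pair c d)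
  define m where "m = k div 2"
  have m: "k = 2 * m" "m \<ge> 2" using k by (auto simp: m_def)
  define N where "N = (cmod (of_int c * \<tau> + of_int d))\<^sup>2"
  define K where "K = 2 + 2 * (1 + R\<^sup>2) / \<eta>\<^sup>2"
  define s where "s = (real_of_int c)\<^sup>2 + (real_of_int d)\<^sup>2"
  have "c \<noteq> 0 \<or> d \<noteq> 0" using p coprime_pair_nonzero Pair by auto
  then have "c\<^sup>2 + d\<^sup>2 \<ge> 1"
    by (smt (verit) sum_power2_gt_zero_iff)
  then have s: "s \<ge> 1" unfolding s_def by (metis of_int_add of_int_le_iff of_int_power of_int_1)
  have N: "N = (c * Re \<tau> + d)\<^sup>2 + c\<^sup>2 * (Im \<tau>)\<^sup>2" by (simp add: N_def cmod_cocycle_sq)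
  have "\<eta>\<^sup>2 \<le> (Im \<tau>)\<^sup>2" using \<tau> by (intro power_mono) auto
  then have "c\<^sup>2 * \<eta>\<^sup>2 \<le> N" unfolding N by (smt (verit) mult_left_mono zero_le_power2 of_int_power)
  then have c2: "c\<^sup>2 \<le> N / \<eta>\<^sup>2" using \<tau> by (simp add: field_simps)
  have "real_of_int d ^ 2 \<le> 2 * (c * Re \<tau> + d)\<^sup>2 + 2 * c\<^sup>2 * (Re \<tau>)\<^sup>2"
  proof -
    \<comment> \<open>With x = c Re \<tau>, the difference 2 (x + d)^2 + 2 x^2 - d^2 is exactly this
      square.\<close>
    have "0 \<le> (2 * (c * Re \<tau>) + d)\<^sup>2" by simp
    then show ?thesis by (simp add: power2_eq_square algebra_simps)
  qed
  also have "\<dots> \<le> 2 * N + 2 * (N / \<eta>\<^sup>2) * R\<^sup>2"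
  proof -
    have "(Re \<tau>)\<^sup>2 \<le> R\<^sup>2" using \<tau>(3) by (metis abs_ge_zero power2_abs power_mono)
    then have "2 * c\<^sup>2 * (Re \<tau>)\<^sup>2 \<le> 2 * (N / \<eta>\<^sup>2) * R\<^sup>2"
      using c2 by (intro mult_mono) (auto simp: N_def)
    moreover have "(c * Re \<tau> + d)\<^sup>2 \<le> N" unfolding N by simp
    ultimately show ?thesis by linarith
  qed
  finally have "s \<le> N / \<eta>\<^sup>2 + (2 * N + 2 * (N / \<eta>\<^sup>2) * R\<^sup>2)" using c2
    unfolding s_def by simp
  also have "\<dots> \<le> K * N"
    using \<tau> by (simp add: K_def N_def field_simps)
  finally have "s \<le> K * N" .
  moreover have "K > 0" unfolding K_def by (intro add_pos_nonneg divide_nonneg_nonneg) auto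
  ultimately have sm: "s ^ m \<le> K ^ m * N ^ m" using s by (metis power_mono power_mult_distrib order_trans zero_le_one)
  \<comment> \<open>The left side is (1 + c^2) (1 + d^2); each of its three summands is at most s^2,
    because s \<ge> 1.\<close>
  have "1 + s + c\<^sup>2 * d\<^sup>2 \<le> 3 * s\<^sup>2"
  proof -
    have "0 \<le> (real_of_int (c\<^sup>2))\<^sup>2 + (real_of_int (d\<^sup>2))\<^sup>2 + c\<^sup>2 * d\<^sup>2" by simp
    then have "c\<^sup>2 * d\<^sup>2 \<le> s\<^sup>2" by (simp add: s_def power2_eq_square algebra_simps)
    moreover have "s \<le> s\<^sup>2" "1 \<le> s\<^sup>2" using s by (auto simp: power2_eq_square mult_ge1_I)
    ultimately show ?thesis by linarith
  qed
  also have "3 * s\<^sup>2 \<le> 3 * s ^ m" using s m by (simp add: power_increasing)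
  finally have "(1 + c\<^sup>2) * (1 + real_of_int d ^ 2) \<le> 3 * s ^ m" by (simp add: s_def algebra_simps)
  then have "1 / pair_weight p \<le> 3 * s ^ m" by (simp add: Pair pair_weight_def)
  also have "\<dots> \<le> 3 * (K ^ m * N ^ m)" using sm by simp
  finally have *: "1 / pair_weight p \<le> 3 * (K ^ m * N ^ m)" .
  have "N > 0" using \<open>s \<le> K * N\<close> s \<open>K > 0\<close> by (smt (verit) mult_nonneg_nonpos)
  have "cmod (eisenstein_term k \<tau> p) = 1 / N ^ m"
    by (simp add: Pair eisenstein_term_def norm_divide norm_power N_def m(1) power_mult)
  also have "\<dots> \<le> 3 * K ^ m * pair_weight p"
    using * \<open>N > 0\<close> pair_weight_pos[of p] by (simp add: field_simps)
  finally show ?thesis by (simp add: K_def m_def)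
qed

lemma eisenstein_term_summable:
  assumes "\<tau> \<in> \<H>" "k \<ge> 4" "even k" "A \<subseteq> coprime_pairs"
  shows "(\<lambda>p. cmod (eisenstein_term k \<tau> p)) summable_on A"
proof (rule Infinite_Sum.abs_summable_on_comparison_test')
  show "(\<lambda>p. 3 * (2 + 2 * (1 + (Re \<tau>)\<^sup>2) / (Im \<tau>)\<^sup>2) ^ (k div 2) * pair_weight p) summable_on A"
    by (intro summable_on_cmult_right pair_weight_summable)
  fix p assume "p \<in> A"
  then show "norm (eisenstein_term k \<tau> p) \<le> 3 * (2 + 2 * (1 + (Re \<tau>)\<^sup>2) / (Im \<tau>)\<^sup>2) ^ (k div 2) * pair_weight p"
    using eisenstein_term_bound[of "Im \<tau>" \<tau> "\<bar>Re \<tau>\<bar>" k p] assms by (auto simp: upper_half_plane_iff)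
qed

text \<open>The finite partial sums are holomorphic and converge uniformly on a closed disc around
  every point, by the Weierstrass test.\<close>

lemma eisenstein_E_holomorphic:
  assumes k: "k \<ge> 4" "even k"
  shows "eisenstein_E k holomorphic_on \<H>"
proof -
  have "eisenstein_E k field_differentiable at \<tau>" if \<tau>: "\<tau> \<in> \<H>" for \<tau>
  proof -
    \<comment> \<open>With half the height as radius, heights on the disc stay at least
      \<open>r\<close>, as the uniform bound on the terms demands.\<close>
    define r where "r = Im \<tau> / 2"
    have r: "r > 0" using \<tau> by (simp add: r_def upper_half_plane_iff)
    have cball: "r \<le> Im z" "\<bar>Re z\<bar> \<le> \<bar>Re \<tau>\<bar> + r" if "z \<in> cball \<tau> r" for z
      using that abs_Im_le_cmod[of "\<tau> - z"] abs_Re_le_cmod[of "\<tau> - z"]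
      by (auto simp: dist_norm r_def)
    then have cballH: "cball \<tau> r \<subseteq> \<H>" using r by (force simp: upper_half_plane_iff)
    define M where "M p = 3 * (2 + 2 * (1 + (\<bar>Re \<tau>\<bar> + r)\<^sup>2) / r\<^sup>2) ^ (k div 2) * pair_weight p" for p
    have ulim: "uniform_limit (cball \<tau> r) (\<lambda>X z. \<Sum>p\<in>X. eisenstein_term k z p)
            (\<lambda>z. infsum (eisenstein_term k z) coprime_pairs) (finite_subsets_at_top coprime_pairs)"
    proof (rule Weierstrass_m_test_general)
      show "cmod (eisenstein_term k z p) \<le> M p" if "p \<in> coprime_pairs" "z \<in> cball \<tau> r" for p z
        unfolding M_def by (intro eisenstein_term_bound cball r k that)
      show "M summable_on coprime_pairs"
        unfolding M_def by (intro summable_on_cmult_right pair_weight_summable)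
    qed
    have hol: "(\<lambda>z. \<Sum>p\<in>X. eisenstein_term k z p) holomorphic_on \<H>" if "X \<subseteq> coprime_pairs" for X
    proof (intro holomorphic_intros)
      fix p assume "p \<in> X"
      then have "of_int (fst p) * z + of_int (snd p) \<noteq> 0" if "z \<in> \<H>" for z
        using coprime_pair_nonzero[of "fst p" "snd p"] that \<open>X \<subseteq> coprime_pairs\<close>
        by (intro cocycle_nonzero) auto
      then show "(\<lambda>z. eisenstein_term k z p) holomorphic_on \<H>"
        unfolding eisenstein_term_def case_prod_beta by (intro holomorphic_intros) auto
    qed
    have ev: "\<forall>\<^sub>F X in finite_subsets_at_top coprime_pairs.
        continuous_on (cball \<tau> r) (\<lambda>z. \<Sum>p\<in>X. eisenstein_term k z p) \<and>
        (\<lambda>z. \<Sum>p\<in>X. eisenstein_term k z p) holomorphic_on ball \<tau> r"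
      by (intro eventually_finite_subsets_at_top_weakI conjI holomorphic_on_imp_continuous_on
          holomorphic_on_subset[OF hol] cballH order_trans[OF ball_subset_cball cballH])
    have "(\<lambda>z. infsum (eisenstein_term k z) coprime_pairs) holomorphic_on ball \<tau> r"
      using holomorphic_uniform_limit[OF ev ulim finite_subsets_at_top_neq_bot] by blast
    then have "eisenstein_E k holomorphic_on ball \<tau> r"
      unfolding eisenstein_E_eq by (intro holomorphic_intros) auto
    then show ?thesis using r by (intro holomorphic_on_imp_differentiable_at[of _ "ball \<tau> r"]) auto
  qed
  then show ?thesis by (simp add: holomorphic_on_def field_differentiable_at_within)
qed

section \<open>The action of SL(2, Z) and modularity of the Eisenstein series\<close>

definition int_matrix :: "int \<Rightarrow> int \<Rightarrow> int \<Rightarrow> int \<Rightarrow> int^2^2" where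
  "int_matrix a b c d = vector [vector [a, b], vector [c, d]]"

lemma int_matrix_nth [simp]:
  "int_matrix a b c d $ 1 $ 1 = a" "int_matrix a b c d $ 1 $ 2 = b"
  "int_matrix a b c d $ 2 $ 1 = c" "int_matrix a b c d $ 2 $ 2 = d"
  by (simp_all add: int_matrix_def)

lemma SL2Z_iff: "\<gamma> \<in> SL2Z \<longleftrightarrow> \<gamma>$1$1 * \<gamma>$2$2 - \<gamma>$1$2 * \<gamma>$2$1 = 1"
  by (simp add: SL2Z_def det_2)

definition cocycle :: "int^2^2 \<Rightarrow> complex \<Rightarrow> complex" where
  "cocycle \<gamma> \<tau> = of_int (\<gamma>$2$1) * \<tau> + of_int (\<gamma>$2$2)"

lemma moebius_eq: "moebius \<gamma> \<tau> = (of_int (\<gamma>$1$1) * \<tau> + of_int (\<gamma>$1$2)) / cocycle \<gamma> \<tau>"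
  by (simp add: moebius_def cocycle_def)

lemma cocycle_SL2Z_nonzero:
  assumes "\<gamma> \<in> SL2Z" "\<tau> \<in> \<H>"
  shows "cocycle \<gamma> \<tau> \<noteq> 0"
  unfolding cocycle_def by (rule cocycle_nonzero) (use assms in \<open>auto simp: SL2Z_iff\<close>)

lemma Im_moebius:
  assumes "\<gamma> \<in> SL2Z"
  shows "Im (moebius \<gamma> \<tau>) = Im \<tau> / (cmod (cocycle \<gamma> \<tau>))\<^sup>2"
proof -
  have "\<gamma>$1$1 * \<gamma>$2$2 = 1 + \<gamma>$1$2 * \<gamma>$2$1"
    using assms by (simp add: SL2Z_iff)
  then have "real_of_int (\<gamma>$1$1 * \<gamma>$2$2) = real_of_int (1 + \<gamma>$1$2 * \<gamma>$2$1)" by (simp only:)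
  then have det: "real_of_int (\<gamma>$1$1) * \<gamma>$2$2 = 1 + real_of_int (\<gamma>$1$2) * \<gamma>$2$1"
    by (simp only: of_int_mult of_int_add of_int_1)
  have "Im \<tau> * \<gamma>$1$1 * (\<gamma>$2$1 * Re \<tau> + \<gamma>$2$2) - (\<gamma>$1$1 * Re \<tau> + \<gamma>$1$2) * (\<gamma>$2$1 * Im \<tau>)
      = Im \<tau> * (real_of_int (\<gamma>$1$1) * \<gamma>$2$2) - \<gamma>$1$2 * \<gamma>$2$1 * Im \<tau>"
    by (simp add: algebra_simps)
  also have "\<dots> = Im \<tau>" unfolding det by (simp add: algebra_simps)
  finally show ?thesis
    by (simp add: moebius_eq cocycle_def Im_divide cmod_power2 mult_ac)
qed

lemma moebius_upper_half_plane:
  assumes "\<gamma> \<in> SL2Z" "\<tau> \<in> \<H>"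
  shows "moebius \<gamma> \<tau> \<in> \<H>"
  using assms cocycle_SL2Z_nonzero[OF assms] by (simp add: upper_half_plane_iff Im_moebius)

text \<open>The inverse matrix is integral and recovers \<open>m\<close> and \<open>n\<close> as
  integer combinations of the new pair, so a common divisor of the new pair divides both.\<close>

lemma coprime_SL2Z:
  assumes "a * d - b * c = (1::int)" "coprime m n"
  shows "coprime (m * a + n * c) (m * b + n * d)"
proof (rule coprimeI)
  fix k assume k: "k dvd m * a + n * c" "k dvd m * b + n * d"
  have "k dvd d * (m * a + n * c) - c * (m * b + n * d)" using k by simp
  also have "d * (m * a + n * c) - c * (m * b + n * d) = m * (a * d - b * c)" by (simp add: algebra_simps)
  finally have "k dvd m" using assms by simp
  have "k dvd a * (m * b + n * d) - b * (m * a + n * c)" using k by simp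
  also have "a * (m * b + n * d) - b * (m * a + n * c) = n * (a * d - b * c)" by (simp add: algebra_simps)
  finally have "k dvd n" using assms by simp
  with \<open>k dvd m\<close> show "is_unit k" using assms(2) by (meson coprime_common_divisor)
qed

lemma bij_betw_coprime_pairs:
  assumes det: "a * d - b * c = (1::int)"
  shows "bij_betw (\<lambda>(m, n). (m * a + n * c, m * b + n * d)) coprime_pairs coprime_pairs"
proof (rule bij_betw_byWitness[where f' = "\<lambda>(m, n). (m * d + n * (- c), m * (- b) + n * a)"])
  have inv: "(m * a + n * c) * d + (m * b + n * d) * (- c) = m"
    "(m * a + n * c) * (- b) + (m * b + n * d) * a = n"
    "(m * d + n * (- c)) * a + (m * (- b) + n * a) * c = m"
    "(m * d + n * (- c)) * b + (m * (- b) + n * a) * d = n" for m n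
  proof -
    have "(m * a + n * c) * d + (m * b + n * d) * (- c) = m * (a * d - b * c)"
      "(m * a + n * c) * (- b) + (m * b + n * d) * a = n * (a * d - b * c)"
      "(m * d + n * (- c)) * a + (m * (- b) + n * a) * c = m * (a * d - b * c)"
      "(m * d + n * (- c)) * b + (m * (- b) + n * a) * d = n * (a * d - b * c)"
      by (simp_all add: algebra_simps)
    then show "(m * a + n * c) * d + (m * b + n * d) * (- c) = m"
      "(m * a + n * c) * (- b) + (m * b + n * d) * a = n"
      "(m * d + n * (- c)) * a + (m * (- b) + n * a) * c = m"
      "(m * d + n * (- c)) * b + (m * (- b) + n * a) * d = n"
      unfolding det by simp_all
  qed
  show "\<forall>p\<in>coprime_pairs. (\<lambda>(m, n). (m * d + n * (- c), m * (- b) + n * a))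
      ((\<lambda>(m, n). (m * a + n * c, m * b + n * d)) p) = p"
    by (simp only: split_paired_All prod.case inv Ball_def) simp
  show "\<forall>p\<in>coprime_pairs. (\<lambda>(m, n). (m * a + n * c, m * b + n * d))
      ((\<lambda>(m, n). (m * d + n * (- c), m * (- b) + n * a)) p) = p"
    by (simp only: split_paired_All prod.case inv Ball_def) simp
  show "(\<lambda>(m, n). (m * a + n * c, m * b + n * d)) ` coprime_pairs \<subseteq> coprime_pairs"
    using coprime_SL2Z[OF det] by (auto simp: coprime_pairs_def)
  have "d * a - (- b) * (- c) = 1" using det by (simp add: algebra_simps)
  then show "(\<lambda>(m, n). (m * d + n * (- c), m * (- b) + n * a)) ` coprime_pairs \<subseteq> coprime_pairs"
    using coprime_SL2Z[of d a "- b" "- c"] by (auto simp: coprime_pairs_def)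
qed

text \<open>Right multiplication of row vectors (m, n) by \<gamma> permutes the coprime pairs, and
  each term changes by the factor J^k. Reindexing and factoring out a constant are valid for every
  \<open>infsum\<close>, which is why the statement covers all \<open>k\<close>.\<close>

theorem eisenstein_E_modular:
  assumes \<gamma>: "\<gamma> \<in> SL2Z" and \<tau>: "\<tau> \<in> \<H>"
  shows "eisenstein_E k (moebius \<gamma> \<tau>) = cocycle \<gamma> \<tau> ^ k * eisenstein_E k \<tau>"
proof -
  define a b c d where "a = \<gamma>$1$1" and "b = \<gamma>$1$2" and "c = \<gamma>$2$1" and "d = \<gamma>$2$2"
  have det: "a * d - b * c = 1" using \<gamma> by (simp add: SL2Z_iff a_def b_def c_def d_def)
  have J: "cocycle \<gamma> \<tau> \<noteq> 0" by (rule cocycle_SL2Z_nonzero[OF assms])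
  have "eisenstein_term k (moebius \<gamma> \<tau>) (m, n) =
      cocycle \<gamma> \<tau> ^ k * eisenstein_term k \<tau> (m * a + n * c, m * b + n * d)" for m n
  proof -
    have "of_int m * moebius \<gamma> \<tau> + of_int n =
        (of_int m * (of_int a * \<tau> + of_int b) + of_int n * cocycle \<gamma> \<tau>) / cocycle \<gamma> \<tau>"
      using J by (simp add: moebius_eq divide_simps a_def b_def)
    also have "of_int m * (of_int a * \<tau> + of_int b) + of_int n * cocycle \<gamma> \<tau> =
        of_int (m * a + n * c) * \<tau> + of_int (m * b + n * d)"
      by (simp add: cocycle_def c_def d_def algebra_simps)
    finally have "of_int m * moebius \<gamma> \<tau> + of_int n =
        (of_int (m * a + n * c) * \<tau> + of_int (m * b + n * d)) / cocycle \<gamma> \<tau>" .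
    then show ?thesis by (simp add: eisenstein_term_def power_divide)
  qed
  then have "infsum (eisenstein_term k (moebius \<gamma> \<tau>)) coprime_pairs =
      infsum (\<lambda>p. cocycle \<gamma> \<tau> ^ k * eisenstein_term k \<tau> ((\<lambda>(m, n). (m * a + n * c, m * b + n * d)) p)) coprime_pairs"
    by (intro infsum_cong) auto
  also have "\<dots> = cocycle \<gamma> \<tau> ^ k *
      infsum (\<lambda>p. eisenstein_term k \<tau> ((\<lambda>(m, n). (m * a + n * c, m * b + n * d)) p)) coprime_pairs"
    by (rule infsum_cmult_right')
  also have "infsum (\<lambda>p. eisenstein_term k \<tau> ((\<lambda>(m, n). (m * a + n * c, m * b + n * d)) p)) coprime_pairs
      = infsum (eisenstein_term k \<tau>) coprime_pairs"
    by (rule infsum_reindex_bij_betw[OF bij_betw_coprime_pairs[OF det]])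
  finally show ?thesis by (simp add: eisenstein_E_eq)
qed

section \<open>The generators T and S, elliptic points, and behaviour at the cusp\<close>

definition T_matrix :: "int^2^2" where "T_matrix = int_matrix 1 1 0 1"

definition S_matrix :: "int^2^2" where "S_matrix = int_matrix 0 (- 1) 1 0"

lemma TS_matrix [simp]:
  "T_matrix \<in> SL2Z" "S_matrix \<in> SL2Z"
  "moebius T_matrix \<tau> = \<tau> + 1" "moebius S_matrix \<tau> = - 1 / \<tau>"
  "cocycle T_matrix \<tau> = 1" "cocycle S_matrix \<tau> = \<tau>"
  by (simp_all add: SL2Z_iff T_matrix_def S_matrix_def moebius_def cocycle_def)

lemma eisenstein_E_TS:
  assumes "\<tau> \<in> \<H>"
  shows "eisenstein_E k (\<tau> + 1) = eisenstein_E k \<tau>"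
    and "eisenstein_E k (- 1 / \<tau>) = \<tau> ^ k * eisenstein_E k \<tau>"
  using eisenstein_E_modular[of T_matrix \<tau> k] eisenstein_E_modular[of S_matrix \<tau> k] assms by simp_all

text \<open>The point i is fixed by S, where the automorphy factor is i^6 = -1.\<close>

lemma eisenstein_E6_i: "eisenstein_E 6 \<i> = 0"
proof -
  have "eisenstein_E 6 (- 1 / \<i>) = \<i> ^ 6 * eisenstein_E 6 \<i>"
    by (rule eisenstein_E_TS) (simp add: upper_half_plane_iff)
  moreover have "- 1 / \<i> = \<i>" by (simp add: field_simps)
  moreover have "\<i> ^ 6 = -1" by (simp add: eval_nat_numeral)
  ultimately show ?thesis by simp
qed

definition rho :: complex where "rho = Complex (- 1 / 2) (sqrt 3 / 2)"

lemma rho_upper_half_plane: "rho \<in> \<H>"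
  by (simp add: rho_def upper_half_plane_iff)

text \<open>\<open>rho\<close> is a primitive cube root of unity, so -1/rho = rho + 1; comparing S
  and T there gives E_4(rho) = rho^4 E_4(rho) with rho^4 = rho \<noteq> 1.\<close>

lemma eisenstein_E4_rho: "eisenstein_E 4 rho = 0"
proof -
  have sq: "rho ^ 2 = - 1 - rho"
    by (simp add: rho_def complex_eq_iff power2_eq_square)
  have "rho \<noteq> 0" using rho_upper_half_plane by (auto simp: upper_half_plane_iff)
  then have "- 1 / rho = rho + 1"
    using sq by (simp add: field_simps power2_eq_square)
  then have "eisenstein_E 4 rho = rho ^ 4 * eisenstein_E 4 rho"
    using eisenstein_E_TS[OF rho_upper_half_plane, of 4] by simp
  moreover have "rho ^ 4 = rho"
  proof -
    have "rho ^ 4 = (rho ^ 2) ^ 2" by simp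
    also have "\<dots> = (- 1 - rho) ^ 2" by (simp only: sq)
    also have "\<dots> = 1 + 2 * rho + rho ^ 2" by (simp add: power2_eq_square algebra_simps)
    also have "\<dots> = rho" by (simp add: sq)
    finally show ?thesis .
  qed
  moreover have "rho \<noteq> 1" by (simp add: rho_def complex_eq_iff)
  ultimately show ?thesis by simp
qed

text \<open>The pairs (0, 1) and (0, -1) contribute the constant 1. All others have c \<noteq> 0,
  and their terms are at most 4 / (Im \<tau>)^2 times \<open>pair_weight\<close>. This crude decay
  suffices to identify the constant term of the q-expansion.\<close>

lemma eisenstein_E_near_cusp:
  assumes k: "k \<ge> 4" "even k"
  obtains K where "\<And>\<tau>. Im \<tau> \<ge> 1 \<Longrightarrow> cmod (eisenstein_E k \<tau> - 1) \<le> K / (Im \<tau>)\<^sup>2"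
proof (rule that[of "2 * infsum pair_weight (coprime_pairs - {(0, 1), (0, - 1)})"])
  define A :: "(int \<times> int) set" where "A = {(0, 1), (0, - 1)}"
  define B where "B = coprime_pairs - A"
  fix \<tau> :: complex assume y: "Im \<tau> \<ge> 1"
  \<comment> \<open>The estimate needs a bounded real part, which periodicity provides without
    changing the height.\<close>
  define \<sigma> where "\<sigma> = \<tau> + of_int (- round (Re \<tau>))"
  have re: "\<bar>Re \<sigma>\<bar> \<le> 1/2"
    using of_int_round_abs_le[of "Re \<tau>"] by (simp add: \<sigma>_def abs_minus_commute)
  have im: "Im \<sigma> = Im \<tau>" by (simp add: \<sigma>_def)
  have \<sigma>H: "\<sigma> \<in> \<H>" "\<tau> \<in> \<H>" using y im by (auto simp: upper_half_plane_iff)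
  have E\<sigma>: "eisenstein_E k \<sigma> = eisenstein_E k \<tau>"
    unfolding \<sigma>_def by (intro periodic_of_int eisenstein_E_TS \<sigma>H)
  have AB: "coprime_pairs = A \<union> B" "A \<inter> B = {}" by (auto simp: A_def B_def coprime_pairs_def)
  have norm_summable: "(\<lambda>p. cmod (eisenstein_term k \<sigma> p)) summable_on B"
    by (rule eisenstein_term_summable[OF \<sigma>H(1) k]) (auto simp: B_def)
  then have "eisenstein_term k \<sigma> summable_on B" by (rule abs_summable_summable)
  then have "infsum (eisenstein_term k \<sigma>) coprime_pairs = infsum (eisenstein_term k \<sigma>) A + infsum (eisenstein_term k \<sigma>) B"
    unfolding AB(1) by (intro infsum_Un_disjoint AB) (auto simp: A_def)
  moreover have "infsum (eisenstein_term k \<sigma>) A = 2"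
    using k by (simp add: A_def eisenstein_term_def)
  ultimately have "eisenstein_E k \<sigma> - 1 = infsum (eisenstein_term k \<sigma>) B / 2"
    by (simp add: eisenstein_E_eq add_divide_distrib)
  then have E: "eisenstein_E k \<tau> - 1 = infsum (eisenstein_term k \<sigma>) B / 2"
    by (simp add: E\<sigma>)
  have "cmod (eisenstein_term k \<sigma> p) \<le> 4 / (Im \<tau>)\<^sup>2 * pair_weight p" if "p \<in> B" for p
  proof (cases p)
    case (Pair c d)
    define N where "N = (cmod (of_int c * \<sigma> + of_int d))\<^sup>2"
    define m where "m = k div 2"
    have m: "k = 2 * m" "m \<ge> 2" using k by (auto simp: m_def)
    define C D Y where "C = (real_of_int c)\<^sup>2" and "D = (real_of_int d)\<^sup>2" and "Y = (Im \<tau>)\<^sup>2"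
    have "c \<noteq> 0" using that coprime_pairs_0 by (auto simp: B_def A_def Pair)
    then have "c\<^sup>2 \<ge> 1" by (smt (verit) zero_less_power2)
    then have C: "C \<ge> 1" unfolding C_def by (metis of_int_le_iff of_int_power of_int_1)
    have Y: "Y \<ge> 1" using y by (simp add: Y_def)
    have D: "D \<ge> 0" by (simp add: D_def)
    have N: "N = (c * Re \<sigma> + d)\<^sup>2 + C * Y" by (simp add: N_def cmod_cocycle_sq C_def Y_def im)
    have "(Re \<sigma>)\<^sup>2 \<le> (1/2)\<^sup>2" using re by (metis abs_ge_zero power2_abs power_mono)
    then have "C * (Re \<sigma>)\<^sup>2 \<le> C * (1/4)" using C by (intro mult_left_mono) (auto simp: power2_eq_square)
    moreover have "0 \<le> (2 * (c * Re \<sigma>) + d)\<^sup>2" by simp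
    then have "D \<le> 2 * (c * Re \<sigma> + d)\<^sup>2 + 2 * (C * (Re \<sigma>)\<^sup>2)"
      by (simp add: C_def D_def power2_eq_square algebra_simps)
    moreover have "C * 1 \<le> C * Y" using C Y by (intro mult_left_mono) auto
    \<comment> \<open>With x = Re \<sigma>, the previous facts give (c x + d)^2 \<ge> D/2 - C/4
      \<ge> D/2 - C Y/4, and C Y is added to it in N.\<close>
    ultimately have N_lower: "D / 2 + 3 / 4 * (C * Y) \<le> N" unfolding N by linarith
    moreover have "C * Y \<ge> 1" using C Y by (simp add: mult_ge1_I)
    moreover have "C * Y \<le> N" unfolding N by simp
    ultimately have "N \<ge> 1" by linarith
    have "(1 + C) * (1 + D) \<le> (2 * C) * (1 + D)" using C D by (intro mult_right_mono) auto
    then have "Y * ((1 + C) * (1 + D)) \<le> Y * ((2 * C) * (1 + D))" using Y by (intro mult_left_mono) auto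
    also have "\<dots> = 2 * (C * Y) + 2 * (C * Y * D)" by (simp add: algebra_simps)
    also have "\<dots> \<le> 4 * (D / 2 + 3 / 4 * (C * Y))\<^sup>2"
    proof -
      have "1 * (C * Y) \<le> (C * Y) * (C * Y)" using \<open>C * Y \<ge> 1\<close> by (intro mult_right_mono) auto
      moreover have "0 \<le> (C * Y) * D" using C Y D by simp
      moreover have "0 \<le> D * D" using D by simp
      moreover have "0 \<le> (C * Y) * (C * Y)" by simp
      moreover have "4 * (D / 2 + 3 / 4 * (C * Y))\<^sup>2 = D * D + 3 * ((C * Y) * D) + 9 / 4 * ((C * Y) * (C * Y))"
        by (simp add: power2_eq_square field_simps)
      ultimately show ?thesis by linarith
    qed
    also have "\<dots> \<le> 4 * N\<^sup>2" using N_lower C D Y by (intro mult_left_mono power_mono) auto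
    also have "\<dots> \<le> 4 * N ^ m" using \<open>N \<ge> 1\<close> m by (intro mult_left_mono power_increasing) auto
    finally have "Y * (1 / pair_weight p) \<le> 4 * N ^ m" by (simp add: Pair pair_weight_def C_def D_def)
    moreover have "cmod (eisenstein_term k \<sigma> p) = 1 / N ^ m"
      by (simp add: Pair eisenstein_term_def norm_divide norm_power N_def m(1) power_mult)
    moreover have "1 / N ^ m \<le> 4 / Y * pair_weight p"
      using calculation(1) \<open>N \<ge> 1\<close> pair_weight_pos[of p] Y by (simp add: field_simps)
    ultimately show ?thesis by (simp add: Y_def)
  qed
  then have "cmod (infsum (eisenstein_term k \<sigma>) B) \<le> infsum (\<lambda>p. 4 / (Im \<tau>)\<^sup>2 * pair_weight p) B"
    using \<open>eisenstein_term k \<sigma> summable_on B\<close>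
    by (intro norm_infsum_le[OF has_sum_infsum has_sum_infsum] summable_on_cmult_right pair_weight_summable) auto
  also have "\<dots> = 4 / (Im \<tau>)\<^sup>2 * infsum pair_weight B" by (rule infsum_cmult_right')
  finally show "cmod (eisenstein_E k \<tau> - 1) \<le> (2 * infsum pair_weight (coprime_pairs - {(0, 1), (0, - 1)})) / (Im \<tau>)\<^sup>2"
    unfolding E by (simp add: norm_divide B_def A_def)
qed

text \<open>From the second term on, 1/(n + 2)^2 \<le> 1/((n + 3/2) (n + 5/2)), and the latter
  telescopes to 2/3. A bound below 2 is what the estimate of E_4 at i requires.\<close>

lemma suminf_inverse_squares_le: "(\<Sum>n. 1 / (real (Suc n))\<^sup>2) \<le> 5/3"
proof -
  have s: "summable (\<lambda>n. 1 / (real (Suc n))\<^sup>2)" using inverse_squares_sums by (auto simp: sums_iff)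
  have tel: "(\<lambda>n. 1 / (real n + 3/2) - 1 / (real (Suc n) + 3/2)) sums (1 / (real 0 + 3/2) - 0)"
    by (rule telescope_sums') real_asymp
  have le: "1 / (real (Suc (Suc n)))\<^sup>2 \<le> 1 / (real n + 3/2) - 1 / (real (Suc n) + 3/2)" for n
  proof -
    have "1 / (real n + 3/2) - 1 / (real (Suc n) + 3/2) = 1 / ((real n + 3/2) * (real (Suc n) + 3/2))"
      by (simp add: divide_simps)
    moreover have "(real n + 3/2) * (real (Suc n) + 3/2) \<le> (real (Suc (Suc n)))\<^sup>2"
      by (simp add: power2_eq_square algebra_simps)
    ultimately show ?thesis by (simp add: frac_le)
  qed
  have "(\<Sum>n. 1 / (real (Suc n))\<^sup>2) = (\<Sum>n. 1 / (real (Suc (Suc n)))\<^sup>2) + 1"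
    using suminf_split_head[OF s] by simp
  also have "(\<Sum>n. 1 / (real (Suc (Suc n)))\<^sup>2) \<le> (\<Sum>n. 1 / (real n + 3/2) - 1 / (real (Suc n) + 3/2))"
  proof (rule suminf_le[OF le])
    show "summable (\<lambda>n. 1 / (real (Suc (Suc n)))\<^sup>2)"
      using s by (subst (asm) summable_Suc_iff [symmetric])
  qed (use tel in \<open>simp add: sums_iff\<close>)
  also have "\<dots> = 2/3" using tel by (simp add: sums_iff)
  finally show ?thesis by simp
qed

lemma has_sum_inverse_squares_int:
  "((\<lambda>c::int. 1 / (real_of_int c)\<^sup>2) has_sum 2 * (\<Sum>n. 1 / (real (Suc n))\<^sup>2)) (- {0})"
proof -
  have nat: "((\<lambda>n. 1 / (real (Suc n))\<^sup>2) has_sum (\<Sum>n. 1 / (real (Suc n))\<^sup>2)) UNIV"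
    using inverse_squares_sums by (intro norm_summable_imp_has_sum) (auto simp: sums_iff summable_sums)
  have 1: "((\<lambda>c::int. 1 / (real_of_int c)\<^sup>2) has_sum (\<Sum>n. 1 / (real (Suc n))\<^sup>2)) ((\<lambda>n. int (Suc n)) ` UNIV)"
    using nat by (subst has_sum_reindex) (auto simp: o_def inj_on_def)
  have 2: "((\<lambda>c::int. 1 / (real_of_int c)\<^sup>2) has_sum (\<Sum>n. 1 / (real (Suc n))\<^sup>2)) ((\<lambda>n. - int (Suc n)) ` UNIV)"
    using nat by (subst has_sum_reindex) (auto simp: o_def inj_on_def power2_eq_square algebra_simps)
  have disj: "(\<lambda>n. int (Suc n)) ` UNIV \<inter> (\<lambda>n. - int (Suc n)) ` UNIV = {}" by auto
  have un: "(\<lambda>n. int (Suc n)) ` UNIV \<union> (\<lambda>n. - int (Suc n)) ` UNIV = - {0}"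
  proof -
    have "x \<in> (\<lambda>n. int (Suc n)) ` UNIV \<union> (\<lambda>n. - int (Suc n)) ` UNIV" if "x \<noteq> 0" for x
    proof (cases "x > 0")
      case True
      then have "x = int (Suc (nat (x - 1)))" by simp
      then show ?thesis by blast
    next
      case False
      then have "x = - int (Suc (nat (- x - 1)))" using that by simp
      then show ?thesis by blast
    qed
    then show ?thesis by auto
  qed
  show ?thesis using has_sum_Un_disjoint[OF 1 2 disj] by (simp only: un mult_2)
qed

text \<open>The four pairs \<open>(\<plusminus>1, 0)\<close>, \<open>(0, \<plusminus>1)\<close> contribute 4 to the sum; the others contribute at most
  \<open>\<Sum> 1 / (c\<^sup>2 + d\<^sup>2)\<^sup>2 \<le> 1/4 (\<Sum> 1 / c\<^sup>2) (\<Sum> 1 / d\<^sup>2) < 4\<close>.\<close>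

lemma eisenstein_E4_i: "eisenstein_E 4 \<i> \<noteq> 0"
proof
  assume 0: "eisenstein_E 4 \<i> = 0"
  define A :: "(int \<times> int) set" where "A = {(0, 1), (0, - 1), (1, 0), (- 1, 0)}"
  define B where "B = coprime_pairs - A"
  define s where "s = (\<Sum>n. 1 / (real (Suc n))\<^sup>2)"
  define Q :: "(int \<times> int) \<Rightarrow> real" where "Q = (\<lambda>(c, d). 1 / (real_of_int c)\<^sup>2 * (1 / (real_of_int d)\<^sup>2))"
  have iH: "\<i> \<in> \<H>" by (simp add: upper_half_plane_iff)
  have AB: "coprime_pairs = A \<union> B" "A \<inter> B = {}" by (auto simp: A_def B_def coprime_pairs_def)
  have "(\<lambda>p. cmod (eisenstein_term 4 \<i> p)) summable_on B"
    by (rule eisenstein_term_summable[OF iH]) (auto simp: B_def)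
  then have summ: "eisenstein_term 4 \<i> summable_on B" by (rule abs_summable_summable)
  then have "infsum (eisenstein_term 4 \<i>) coprime_pairs = infsum (eisenstein_term 4 \<i>) A + infsum (eisenstein_term 4 \<i>) B"
    unfolding AB(1) by (intro infsum_Un_disjoint AB) (auto simp: A_def)
  moreover have "infsum (eisenstein_term 4 \<i>) A = 4"
    by (simp add: A_def eisenstein_term_def)
  ultimately have B: "infsum (eisenstein_term 4 \<i>) B = - 4"
    using 0 by (simp add: eisenstein_E_eq eq_neg_iff_add_eq_0 add.commute)
  define f :: "int \<Rightarrow> real" where "f c = 1 / (real_of_int c)\<^sup>2" for c
  have f: "(f has_sum 2 * s) (- {0})"
    unfolding f_def [abs_def] s_def by (rule has_sum_inverse_squares_int)
  have "((\<lambda>(x, y). f x * f y) has_sum infsum f (- {0}) * infsum f (- {0})) ((- {0}) \<times> (- {0}))"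
    by (rule summable_product[OF has_sum_imp_summable[OF f] has_sum_imp_summable[OF f]]) (auto simp: f_def)
  then have Q: "(Q has_sum (2 * s) * (2 * s)) ((- {0}) \<times> (- {0}))"
    unfolding infsumI[OF f] by (simp only: Q_def f_def [abs_def])
  have BQ: "B \<subseteq> (- {0}) \<times> (- {0})"
  proof
    fix p assume p: "p \<in> B"
    obtain c d where cd: "p = (c, d)" by (cases p)
    have "c \<noteq> 0"
      using p coprime_pairs_0[of d] by (auto simp: B_def A_def cd)
    moreover have "d \<noteq> 0"
    proof
      assume "d = 0"
      then have "\<bar>c\<bar> = 1" using p by (simp add: B_def coprime_pairs_def cd)
      then show False using p \<open>d = 0\<close> by (auto simp: B_def A_def cd)
    qed
    ultimately show "p \<in> (- {0}) \<times> (- {0})" by (simp add: cd)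
  qed
  have QB: "Q summable_on B"
    by (rule summable_on_subset_banach[OF has_sum_imp_summable[OF Q] BQ])
  have "cmod (infsum (eisenstein_term 4 \<i>) B) \<le> infsum (\<lambda>p. 1/4 * Q p) B"
  proof (rule norm_infsum_le[OF has_sum_infsum has_sum_infsum])
    fix p assume p: "p \<in> B"
    obtain c d where cd: "p = (c, d)" by (cases p)
    define C D where "C = (real_of_int c)\<^sup>2" and "D = (real_of_int d)\<^sup>2"
    have CD: "C > 0" "D > 0" using p BQ by (auto simp: cd C_def D_def)
    have "cmod (eisenstein_term 4 \<i> p) = 1 / ((cmod (of_int c * \<i> + of_int d))\<^sup>2)\<^sup>2"
      by (simp add: eisenstein_term_def cd norm_divide norm_power)
    also have "(cmod (of_int c * \<i> + of_int d))\<^sup>2 = C + D"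
      by (simp add: cmod_power2 C_def D_def)
    also have "1 / (C + D)\<^sup>2 \<le> 1 / (4 * (C * D))"
    proof (intro divide_left_mono)
      have "0 \<le> (C - D)\<^sup>2" by simp
      then show "4 * (C * D) \<le> (C + D)\<^sup>2" by (simp add: power2_eq_square algebra_simps)
    qed (use CD in auto)
    finally show "cmod (eisenstein_term 4 \<i> p) \<le> 1/4 * Q p" by (simp add: Q_def cd C_def D_def)
  qed (rule summ summable_on_cmult_right[OF QB])+
  also have "\<dots> = 1/4 * infsum Q B" by (rule infsum_cmult_right')
  finally have "cmod (infsum (eisenstein_term 4 \<i>) B) \<le> 1/4 * infsum Q B" .
  moreover have "infsum Q B \<le> infsum Q ((- {0}) \<times> (- {0}))"
    by (rule infsum_mono2[OF QB has_sum_imp_summable[OF Q] BQ]) (simp add: Q_def case_prod_beta)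
  moreover have "infsum Q ((- {0}) \<times> (- {0})) = (2 * s) * (2 * s)" using Q by (rule infsumI)
  moreover have "0 \<le> s" unfolding s_def using inverse_squares_sums by (intro suminf_nonneg) (auto simp: sums_iff)
  then have "(2 * s) * (2 * s) \<le> (10/3) * (10/3)"
    using suminf_inverse_squares_le unfolding s_def by (intro mult_mono) auto
  ultimately show False unfolding B by simp
qed

section \<open>The discriminant form\<close>

lemma modular_Delta_holomorphic: "modular_Delta holomorphic_on \<H>"
  unfolding modular_Delta_def by (intro holomorphic_intros eisenstein_E_holomorphic) auto

lemma modular_Delta_modular:
  assumes "\<gamma> \<in> SL2Z" "\<tau> \<in> \<H>"
  shows "modular_Delta (moebius \<gamma> \<tau>) = cocycle \<gamma> \<tau> ^ 12 * modular_Delta \<tau>"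
  by (simp add: modular_Delta_def eisenstein_E_modular[OF assms] power_mult_distrib
      power_mult [symmetric] right_diff_distrib)

text \<open>The decay of E_k - 1 has two effects: E_k is bounded near the cusp, hence has an
  expansion in q, and its limit there is 1.\<close>

lemma eisenstein_E_q_expansion:
  assumes k: "k \<ge> 4" "even k"
  obtains g where "g holomorphic_on ball 0 1" "\<And>\<tau>. \<tau> \<in> \<H> \<Longrightarrow> eisenstein_E k \<tau> = g (nome \<tau>)" "g 0 = 1"
proof -
  obtain K where K: "\<And>\<tau>. Im \<tau> \<ge> 1 \<Longrightarrow> cmod (eisenstein_E k \<tau> - 1) \<le> K / (Im \<tau>)\<^sup>2"
    using eisenstein_E_near_cusp[OF k] by blast
  have K0: "K \<ge> 0" using order_trans[OF norm_ge_zero K[of \<i>]] by simp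
  have bound: "cmod (eisenstein_E k \<tau>) \<le> K + 1" if "Im \<tau> > 1" for \<tau>
  proof -
    have "K / (Im \<tau>)\<^sup>2 \<le> K / 1"
      using that K0 by (intro divide_left_mono) auto
    then show ?thesis
      using K[of \<tau>] that norm_triangle_ineq2[of "eisenstein_E k \<tau>" 1] by auto
  qed
  obtain g where g: "g holomorphic_on ball 0 1" "\<And>\<tau>. \<tau> \<in> \<H> \<Longrightarrow> eisenstein_E k \<tau> = g (nome \<tau>)"
    using q_expansion_bounded[of "eisenstein_E k" 1 "K + 1", OF eisenstein_E_holomorphic[OF k] eisenstein_E_TS(1) bound]
    by blast
  have "cmod (g 0 - 1) < e" if e: "e > 0" for e
  proof -
    obtain B where B: "\<And>\<tau>. \<tau> \<in> \<H> \<Longrightarrow> Im \<tau> > B \<Longrightarrow> cmod (g (nome \<tau>) - g 0) < e / 2"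
      using tendsto_at_cusp[OF g(1), of "e / 2"] e by auto
    \<comment> \<open>High enough on the imaginary axis for both errors to be below e/2; the last
      summand serves K/y^2 \<le> K/y < e/2.\<close>
    define y where "y = 1 + \<bar>B\<bar> + 2 * K / e"
    have "2 * K / e \<ge> 0" using K0 e by simp
    then have y: "y \<ge> 1" "y > B" "y > 2 * K / e" unfolding y_def by linarith+
    define \<tau> where "\<tau> = Complex 0 y"
    have \<tau>: "\<tau> \<in> \<H>" "Im \<tau> = y" using y by (auto simp: \<tau>_def upper_half_plane_iff)
    have "K / y\<^sup>2 \<le> K / y" using y K0 by (intro divide_left_mono) (auto simp: power2_eq_square)
    also have "\<dots> < e / 2" using y e by (simp add: field_simps)
    finally have "K / y\<^sup>2 < e / 2" .
    moreover have "cmod (g (nome \<tau>) - 1) \<le> K / y\<^sup>2"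
      using K[of \<tau>] \<tau> y g(2)[OF \<tau>(1)] by simp
    ultimately have "cmod (g (nome \<tau>) - 1) < e / 2" by linarith
    moreover have "cmod (g (nome \<tau>) - g 0) < e / 2" using B \<tau> y by simp
    ultimately show ?thesis
      using norm_triangle_ineq[of "g 0 - g (nome \<tau>)" "g (nome \<tau>) - 1"] by (simp add: norm_minus_commute)
  qed
  then have "g 0 = 1" by (metis less_irrefl right_minus_eq zero_less_norm_iff)
  with g that show ?thesis by blast
qed

text \<open>As E_6(i) = 0, the value is E_4(i)^3 / 1728. This is where the numerical estimate of E_4
  at i enters.\<close>

lemma modular_Delta_i: "modular_Delta \<i> \<noteq> 0"
  by (simp add: modular_Delta_def eisenstein_E6_i eisenstein_E4_i)

text \<open>The constant terms of E_4^3 and E_6^2 cancel, so \<Delta> vanishes at q = 0. A zero of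
  order at least 2 would make this form of weight 12 vanish identically, contradicting \<Delta>(i)
  \<noteq> 0.\<close>

lemma modular_Delta_q_expansion:
  obtains A where "A holomorphic_on ball 0 1" "A 0 \<noteq> 0"
    "\<And>\<tau>. \<tau> \<in> \<H> \<Longrightarrow> modular_Delta \<tau> = nome \<tau> * A (nome \<tau>)"
proof -
  obtain g4 where g4: "g4 holomorphic_on ball 0 1" "\<And>\<tau>. \<tau> \<in> \<H> \<Longrightarrow> eisenstein_E 4 \<tau> = g4 (nome \<tau>)" "g4 0 = 1"
    using eisenstein_E_q_expansion[of 4] by auto
  obtain g6 where g6: "g6 holomorphic_on ball 0 1" "\<And>\<tau>. \<tau> \<in> \<H> \<Longrightarrow> eisenstein_E 6 \<tau> = g6 (nome \<tau>)" "g6 0 = 1"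
    using eisenstein_E_q_expansion[of 6] by auto
  define D where "D q = (g4 q ^ 3 - g6 q ^ 2) / 1728" for q
  have "D holomorphic_on ball 0 1" unfolding D_def by (intro holomorphic_intros g4 g6) auto
  moreover have "D 0 = 0" by (simp add: D_def g4 g6)
  ultimately obtain A where A: "A holomorphic_on ball 0 1" "\<And>q. cmod q < 1 \<Longrightarrow> D q = q * A q"
    using Schwarz3 by metis
  have Delta: "modular_Delta \<tau> = nome \<tau> * A (nome \<tau>)" if "\<tau> \<in> \<H>" for \<tau>
    using A(2)[of "nome \<tau>"] nome_in_ball[OF that] g4(2)[OF that] g6(2)[OF that]
    by (simp add: modular_Delta_def D_def)
  moreover have "A 0 \<noteq> 0"
  proof
    assume "A 0 = 0"
    then obtain h where h: "h holomorphic_on ball 0 1" "\<And>q. cmod q < 1 \<Longrightarrow> A q = q * h q"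
      using Schwarz3[OF A(1)] by metis
    have "modular_Delta \<i> = 0"
    proof (rule modular_form_eq_0_if_high_order_at_cusp[of modular_Delta 6 h 2])
      show "modular_Delta (\<tau> + 1) = modular_Delta \<tau>" "modular_Delta (- 1 / \<tau>) = \<tau> ^ (2 * 6) * modular_Delta \<tau>"
        if "\<tau> \<in> \<H>" for \<tau>
        using modular_Delta_modular[of T_matrix \<tau>] modular_Delta_modular[of S_matrix \<tau>] that by simp_all
      show "modular_Delta \<tau> = nome \<tau> ^ 2 * h (nome \<tau>)" if "\<tau> \<in> \<H>" for \<tau>
        using Delta[OF that] h(2)[of "nome \<tau>"] nome_in_ball[OF that] by (simp add: power2_eq_square)
      show "real 6 < 2 * pi * real 2 * (4 / 5)" using pi_gt3 by simp
    qed (use h modular_Delta_holomorphic in \<open>auto simp: upper_half_plane_iff\<close>)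
    then show False using modular_Delta_i by simp
  qed
  ultimately show ?thesis using that A(1) by blast
qed

section \<open>Derivatives of modular forms and the differential equation of \<Delta>\<close>

lemma moebius_has_field_derivative:
  assumes "\<gamma> \<in> SL2Z" "\<tau> \<in> \<H>"
  shows "(moebius \<gamma> has_field_derivative 1 / cocycle \<gamma> \<tau> ^ 2) (at \<tau>)"
proof -
  have "complex_of_int (\<gamma>$1$1 * \<gamma>$2$2 - \<gamma>$1$2 * \<gamma>$2$1) = 1"
    using assms by (simp only: SL2Z_iff of_int_1)
  then have det: "complex_of_int (\<gamma>$1$1) * of_int (\<gamma>$2$2) - of_int (\<gamma>$1$2) * of_int (\<gamma>$2$1) = 1"
    by (simp only: of_int_mult of_int_diff)
  have J: "of_int (\<gamma>$2$1) * \<tau> + of_int (\<gamma>$2$2) \<noteq> (0::complex)"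
    using cocycle_SL2Z_nonzero[OF assms] by (simp add: cocycle_def)
  have num: "of_int (\<gamma>$1$1) * (of_int (\<gamma>$2$1) * \<tau> + of_int (\<gamma>$2$2)) -
    (of_int (\<gamma>$1$1) * \<tau> + of_int (\<gamma>$1$2)) * of_int (\<gamma>$2$1) = 1"
    using det by (simp add: algebra_simps)
  have "((\<lambda>\<tau>. (of_int (\<gamma>$1$1) * \<tau> + of_int (\<gamma>$1$2)) / (of_int (\<gamma>$2$1) * \<tau> + of_int (\<gamma>$2$2)))
     has_field_derivative (of_int (\<gamma>$1$1) * (of_int (\<gamma>$2$1) * \<tau> + of_int (\<gamma>$2$2)) -
    (of_int (\<gamma>$1$1) * \<tau> + of_int (\<gamma>$1$2)) * of_int (\<gamma>$2$1)) /
      ((of_int (\<gamma>$2$1) * \<tau> + of_int (\<gamma>$2$2)) * (of_int (\<gamma>$2$1) * \<tau> + of_int (\<gamma>$2$2)))) (at \<tau>)"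
    by (rule DERIV_divide) (use J in \<open>auto intro!: derivative_eq_intros\<close>)
  then show ?thesis
    unfolding num by (simp add: moebius_def [abs_def] cocycle_def power2_eq_square)
qed

lemma cocycle_has_field_derivative [derivative_intros]:
  "(cocycle \<gamma> has_field_derivative of_int (\<gamma>$2$1)) (at \<tau>)"
  unfolding cocycle_def [abs_def] by (auto intro!: derivative_eq_intros)

text \<open>This is the chain rule, as \<tau> \<mapsto> \<gamma>\<tau> has derivative J^(-2). The
  arbitrary right side \<open>R\<close> lets it be applied a second time, to the transformation law
  of the first derivative.\<close>

lemma deriv_moebius:
  assumes F: "F holomorphic_on \<H>" and FR: "\<And>\<tau>. \<tau> \<in> \<H> \<Longrightarrow> F (moebius \<gamma> \<tau>) = R \<tau>"
    and R: "(R has_field_derivative R') (at \<tau>)" and \<gamma>: "\<gamma> \<in> SL2Z" and \<tau>: "\<tau> \<in> \<H>"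
  shows "deriv F (moebius \<gamma> \<tau>) = cocycle \<gamma> \<tau> ^ 2 * R'"
proof -
  have "(F has_field_derivative deriv F (moebius \<gamma> \<tau>)) (at (moebius \<gamma> \<tau>))"
    using F by (intro holomorphic_derivI[of F \<H>] open_upper_half_plane moebius_upper_half_plane \<gamma> \<tau>)
  then have "((\<lambda>\<tau>. F (moebius \<gamma> \<tau>)) has_field_derivative deriv F (moebius \<gamma> \<tau>) * (1 / cocycle \<gamma> \<tau> ^ 2)) (at \<tau>)"
    using DERIV_chain2 moebius_has_field_derivative[OF \<gamma> \<tau>] by blast
  then have "(R has_field_derivative deriv F (moebius \<gamma> \<tau>) * (1 / cocycle \<gamma> \<tau> ^ 2)) (at \<tau>)"
    by (rule has_field_derivative_transform_within_open[OF _ open_upper_half_plane \<tau>]) (rule FR)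
  then have "R' = deriv F (moebius \<gamma> \<tau>) * (1 / cocycle \<gamma> \<tau> ^ 2)" using R DERIV_unique by blast
  then show ?thesis using cocycle_SL2Z_nonzero[OF \<gamma> \<tau>] by simp
qed

text \<open>Differentiating the factor J^k leaves an anomalous term with c. It is cancelled in the
  differential equation of \<Delta> and exploited in the frame.\<close>

lemma deriv_modular_form:
  assumes f: "f holomorphic_on \<H>"
    and mod: "\<And>\<tau>. \<tau> \<in> \<H> \<Longrightarrow> f (moebius \<gamma> \<tau>) = cocycle \<gamma> \<tau> ^ k * f \<tau>"
    and \<gamma>: "\<gamma> \<in> SL2Z" and \<tau>: "\<tau> \<in> \<H>"
  shows "deriv f (moebius \<gamma> \<tau>) = cocycle \<gamma> \<tau> ^ (k + 2) * deriv f \<tau>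
      + of_nat k * of_int (\<gamma>$2$1) * cocycle \<gamma> \<tau> ^ (k + 1) * f \<tau>"
proof -
  define J where "J = cocycle \<gamma> \<tau>"
  have "(f has_field_derivative deriv f \<tau>) (at \<tau>)"
    using f by (intro holomorphic_derivI[of f \<H>] open_upper_half_plane \<tau>)
  then have "((\<lambda>\<tau>. cocycle \<gamma> \<tau> ^ k * f \<tau>) has_field_derivative
      J ^ k * deriv f \<tau> + of_nat k * of_int (\<gamma>$2$1) * J ^ (k - 1) * f \<tau>) (at \<tau>)"
    by (auto intro!: derivative_eq_intros simp: J_def algebra_simps)
  \<comment> \<open>For \<open>k = 0\<close> the truncated exponent \<open>k - 1\<close> is
    harmless, because its factor \<open>of_nat k\<close> vanishes.\<close>
  from deriv_moebius[OF f mod this \<gamma> \<tau>] show ?thesis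
    by (cases k) (simp_all add: J_def algebra_simps power2_eq_square)
qed

lemma deriv2_modular_form:
  assumes f: "f holomorphic_on \<H>"
    and mod: "\<And>\<tau>. \<tau> \<in> \<H> \<Longrightarrow> f (moebius \<gamma> \<tau>) = cocycle \<gamma> \<tau> ^ k * f \<tau>"
    and \<gamma>: "\<gamma> \<in> SL2Z" and \<tau>: "\<tau> \<in> \<H>"
  shows "deriv (deriv f) (moebius \<gamma> \<tau>) = cocycle \<gamma> \<tau> ^ (k + 4) * deriv (deriv f) \<tau>
      + 2 * of_nat (k + 1) * of_int (\<gamma>$2$1) * cocycle \<gamma> \<tau> ^ (k + 3) * deriv f \<tau>
      + of_nat (k * (k + 1)) * of_int (\<gamma>$2$1) ^ 2 * cocycle \<gamma> \<tau> ^ (k + 2) * f \<tau>"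
proof -
  define J where "J = cocycle \<gamma> \<tau>"
  define c where "c = complex_of_int (\<gamma>$2$1)"
  have df: "deriv f holomorphic_on \<H>" by (intro holomorphic_deriv f open_upper_half_plane)
  have 1: "(f has_field_derivative deriv f \<tau>) (at \<tau>)"
    using f by (intro holomorphic_derivI[of f \<H>] open_upper_half_plane \<tau>)
  have 2: "(deriv f has_field_derivative deriv (deriv f) \<tau>) (at \<tau>)"
    using df by (intro holomorphic_derivI[of _ \<H>] open_upper_half_plane \<tau>)
  have pow1: "((\<lambda>\<tau>. cocycle \<gamma> \<tau> ^ (k + 1)) has_field_derivative of_nat (k + 1) * c * J ^ k) (at \<tau>)"
    by (rule DERIV_cong[OF DERIV_power[OF cocycle_has_field_derivative]]) (simp add: J_def c_def)
  have pow2: "((\<lambda>\<tau>. cocycle \<gamma> \<tau> ^ (k + 2)) has_field_derivative of_nat (k + 2) * c * J ^ (k + 1)) (at \<tau>)"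
    by (rule DERIV_cong[OF DERIV_power[OF cocycle_has_field_derivative]]) (simp add: J_def c_def)
  have "((\<lambda>\<tau>. cocycle \<gamma> \<tau> ^ (k + 2) * deriv f \<tau> + of_nat k * c * cocycle \<gamma> \<tau> ^ (k + 1) * f \<tau>)
      has_field_derivative
      J ^ (k + 2) * deriv (deriv f) \<tau> + of_nat (k + 2) * c * J ^ (k + 1) * deriv f \<tau>
      + of_nat k * c * (J ^ (k + 1) * deriv f \<tau> + of_nat (k + 1) * c * J ^ k * f \<tau>)) (at \<tau>)"
    by (rule DERIV_cong[OF DERIV_add[OF DERIV_mult[OF pow2 2]
          DERIV_cmult[OF DERIV_mult[OF pow1 1], of "of_nat k * c", folded mult.assoc]]])
      (simp add: J_def c_def algebra_simps)
  from deriv_moebius[OF df deriv_modular_form[OF f mod \<gamma>, folded c_def] this \<gamma> \<tau>] show ?thesis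
    by (simp add: J_def c_def algebra_simps power2_eq_square numeral_eq_Suc)
qed

text \<open>In the variable q, differentiation is 2 \<pi> i q d/dq. The factor
  \<open>nome \<tau>\<close> is kept in front so that the result applies again to the
  derivative.\<close>

lemma deriv_q_expansion:
  assumes A: "A holomorphic_on ball 0 1" and f: "\<And>\<tau>. \<tau> \<in> \<H> \<Longrightarrow> f \<tau> = nome \<tau> * A (nome \<tau>)"
  obtains B where "B holomorphic_on ball 0 1" "\<And>\<tau>. \<tau> \<in> \<H> \<Longrightarrow> deriv f \<tau> = nome \<tau> * B (nome \<tau>)"
    "B 0 = 2 * of_real pi * \<i> * A 0"
proof (rule that[of "\<lambda>q. 2 * of_real pi * \<i> * (A q + q * deriv A q)"])
  show "(\<lambda>q. 2 * of_real pi * \<i> * (A q + q * deriv A q)) holomorphic_on ball 0 1"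
    by (intro holomorphic_intros A holomorphic_deriv) auto
  show "deriv f \<tau> = nome \<tau> * (2 * of_real pi * \<i> * (A (nome \<tau>) + nome \<tau> * deriv A (nome \<tau>)))" if \<tau>: "\<tau> \<in> \<H>" for \<tau>
  proof (rule DERIV_imp_deriv)
    have n: "(nome has_field_derivative 2 * of_real pi * \<i> * nome \<tau>) (at \<tau>)"
      unfolding nome_def [abs_def] by (auto intro!: derivative_eq_intros)
    have "(A has_field_derivative deriv A (nome \<tau>)) (at (nome \<tau>))"
      using A by (intro holomorphic_derivI[of A "ball 0 1"] open_ball nome_in_ball \<tau>)
    then have "((\<lambda>\<tau>. A (nome \<tau>)) has_field_derivative deriv A (nome \<tau>) * (2 * of_real pi * \<i> * nome \<tau>)) (at \<tau>)"
      using DERIV_chain2 n by blast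
    then have "((\<lambda>\<tau>. nome \<tau> * A (nome \<tau>)) has_field_derivative
        nome \<tau> * (2 * of_real pi * \<i> * (A (nome \<tau>) + nome \<tau> * deriv A (nome \<tau>)))) (at \<tau>)"
      using n by (auto intro!: derivative_eq_intros simp: algebra_simps)
    then show "(f has_field_derivative
        nome \<tau> * (2 * of_real pi * \<i> * (A (nome \<tau>) + nome \<tau> * deriv A (nome \<tau>)))) (at \<tau>)"
      by (rule has_field_derivative_transform_within_open[OF _ open_upper_half_plane \<tau>]) (simp add: f)
  qed
qed simp

text \<open>For f of weight k, the anomalous terms cancel in k f f'' - (k + 1) f'^2, a multiple of
  the second Rankin-Cohen bracket of f with itself. For k = 12 its weight is 28, that of E_4
  \<Delta>^2. The difference of the two sides has order at least 3 at the cusp, hence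
  vanishes.\<close>

lemma modular_Delta_ode:
  assumes "\<tau> \<in> \<H>"
  shows "12 * modular_Delta \<tau> * deriv (deriv modular_Delta) \<tau> - 13 * (deriv modular_Delta \<tau>)\<^sup>2
    = 4 * (of_real pi)\<^sup>2 * eisenstein_E 4 \<tau> * (modular_Delta \<tau>)\<^sup>2"
proof -
  let ?\<Delta> = modular_Delta
  define X where "X \<tau> = 12 * ?\<Delta> \<tau> * deriv (deriv ?\<Delta>) \<tau> - 13 * (deriv ?\<Delta> \<tau>)\<^sup>2
    - 4 * (of_real pi)\<^sup>2 * eisenstein_E 4 \<tau> * (?\<Delta> \<tau>)\<^sup>2" for \<tau>
  have X_modular: "X (moebius \<gamma> \<tau>) = cocycle \<gamma> \<tau> ^ 28 * X \<tau>" if \<gamma>: "\<gamma> \<in> SL2Z" and \<tau>: "\<tau> \<in> \<H>" for \<gamma> \<tau>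
  proof -
    define J c where "J = cocycle \<gamma> \<tau>" and "c = complex_of_int (\<gamma>$2$1)"
    define d0 d1 d2 e where "d0 = ?\<Delta> \<tau>" and "d1 = deriv ?\<Delta> \<tau>" and "d2 = deriv (deriv ?\<Delta>) \<tau>"
      and "e = eisenstein_E 4 \<tau>"
    have "?\<Delta> (moebius \<gamma> \<tau>) = J ^ 12 * d0"
      by (simp add: modular_Delta_modular[OF \<gamma> \<tau>] J_def d0_def)
    moreover have "deriv ?\<Delta> (moebius \<gamma> \<tau>) = J ^ 14 * d1 + 12 * c * J ^ 13 * d0"
      using deriv_modular_form[OF modular_Delta_holomorphic modular_Delta_modular[OF \<gamma>] \<gamma> \<tau>]
      by (simp add: J_def c_def d0_def d1_def)
    moreover have "deriv (deriv ?\<Delta>) (moebius \<gamma> \<tau>) = J ^ 16 * d2 + 26 * c * J ^ 15 * d1 + 156 * c ^ 2 * J ^ 14 * d0"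
      using deriv2_modular_form[OF modular_Delta_holomorphic modular_Delta_modular[OF \<gamma>] \<gamma> \<tau>]
      by (simp add: J_def c_def d0_def d1_def d2_def)
    moreover have "eisenstein_E 4 (moebius \<gamma> \<tau>) = J ^ 4 * e"
      by (simp add: eisenstein_E_modular[OF \<gamma> \<tau>] J_def e_def)
    ultimately have "X (moebius \<gamma> \<tau>) = 12 * (J ^ 12 * d0) * (J ^ 16 * d2 + 26 * c * J ^ 15 * d1 + 156 * c ^ 2 * J ^ 14 * d0)
      - 13 * (J ^ 14 * d1 + 12 * c * J ^ 13 * d0)\<^sup>2 - 4 * (of_real pi)\<^sup>2 * (J ^ 4 * e) * (J ^ 12 * d0)\<^sup>2"
      by (simp add: X_def)
    also have "\<dots> = J ^ 28 * (12 * d0 * d2 - 13 * d1\<^sup>2 - 4 * (of_real pi)\<^sup>2 * e * d0\<^sup>2)"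
    proof -
      have J: "J ^ 13 = J ^ 12 * J" "J ^ 14 = J ^ 12 * (J * J)" "J ^ 15 = J ^ 12 * (J * J * J)"
        "J ^ 16 = J ^ 12 * (J * J * J * J)" "J ^ 28 = J ^ 12 * J ^ 12 * (J * J * J * J)" "J ^ 4 = J * J * J * J"
        by (simp_all add: eval_nat_numeral mult_ac)
      define w where "w = J ^ 12"
      show ?thesis unfolding J w_def [symmetric] by (simp add: power2_eq_square algebra_simps)
    qed
    finally show ?thesis by (simp add: X_def J_def d0_def d1_def d2_def e_def)
  qed
  obtain A where A: "A holomorphic_on ball 0 1" "A 0 \<noteq> 0" "\<And>\<tau>. \<tau> \<in> \<H> \<Longrightarrow> ?\<Delta> \<tau> = nome \<tau> * A (nome \<tau>)"
    using modular_Delta_q_expansion by blast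
  obtain B where B: "B holomorphic_on ball 0 1" "\<And>\<tau>. \<tau> \<in> \<H> \<Longrightarrow> deriv ?\<Delta> \<tau> = nome \<tau> * B (nome \<tau>)"
    "B 0 = 2 * of_real pi * \<i> * A 0"
    using deriv_q_expansion[OF A(1,3)] by blast
  obtain C where C: "C holomorphic_on ball 0 1" "\<And>\<tau>. \<tau> \<in> \<H> \<Longrightarrow> deriv (deriv ?\<Delta>) \<tau> = nome \<tau> * C (nome \<tau>)"
    "C 0 = 2 * of_real pi * \<i> * B 0"
    using deriv_q_expansion[OF B(1,2)] by blast
  obtain g4 where g4: "g4 holomorphic_on ball 0 1" "\<And>\<tau>. \<tau> \<in> \<H> \<Longrightarrow> eisenstein_E 4 \<tau> = g4 (nome \<tau>)" "g4 0 = 1"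
    using eisenstein_E_q_expansion[of 4] by auto
  define F where "F q = 12 * A q * C q - 13 * (B q)\<^sup>2 - 4 * (of_real pi)\<^sup>2 * g4 q * (A q)\<^sup>2" for q
  have "F holomorphic_on ball 0 1" unfolding F_def by (intro holomorphic_intros A B C g4)
  \<comment> \<open>The first two terms give (12 - 13) (2 \<pi> i)^2 A(0)^2 = 4 \<pi>^2 A(0)^2: this
    fixes the coefficient of E_4 \<Delta>^2.\<close>
  moreover have "F 0 = 0"
    by (simp add: F_def B(3) C(3) g4(3) power2_eq_square algebra_simps)
  ultimately obtain h where h: "h holomorphic_on ball 0 1" "\<And>q. cmod q < 1 \<Longrightarrow> F q = q * h q"
    using Schwarz3 by metis
  have "X \<tau> = 0"
  proof (rule modular_form_eq_0_if_high_order_at_cusp[of X 14 h 3])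
    show "X holomorphic_on \<H>"
      unfolding X_def
      by (intro holomorphic_intros holomorphic_deriv modular_Delta_holomorphic open_upper_half_plane
          eisenstein_E_holomorphic) auto
    show "X (\<tau> + 1) = X \<tau>" "X (- 1 / \<tau>) = \<tau> ^ (2 * 14) * X \<tau>" if "\<tau> \<in> \<H>" for \<tau>
      using X_modular[of T_matrix \<tau>] X_modular[of S_matrix \<tau>] that by simp_all
    show "X \<tau> = nome \<tau> ^ 3 * h (nome \<tau>)" if "\<tau> \<in> \<H>" for \<tau>
    proof -
      have "X \<tau> = nome \<tau> ^ 2 * F (nome \<tau>)"
        using that by (simp add: X_def F_def A B C g4 power2_eq_square algebra_simps)
      then show ?thesis using h(2)[of "nome \<tau>"] nome_in_ball[OF that] by (simp add: numeral_eq_Suc)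
    qed
    \<comment> \<open>The bound is about 15.08; order 2 would give only about 10.05.\<close>
    show "real 14 < 2 * pi * real 3 * (4 / 5)" using pi_gt3 by simp
  qed (use h assms in auto)
  then show ?thesis by (simp add: X_def)
qed

text \<open>At a zero of order \<open>n > 0\<close> the left side of the differential equation has order \<open>2n - 2\<close>, since its
  leading coefficient is a nonzero multiple of \<open>12n(n-1) - 13n\<^sup>2 = -n(n+12)\<close>, while the right side has
  order at least \<open>2n\<close>. In the proof the equation is multiplied by \<open>(w - z)\<^sup>2\<close> to keep exponents natural.\<close>

theorem modular_Delta_nonzero:
  assumes z: "z \<in> \<H>"
  shows "modular_Delta z \<noteq> 0"
proof
  assume zero: "modular_Delta z = 0"
  let ?\<Delta> = modular_Delta
  have "\<not> ?\<Delta> constant_on \<H>"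
  proof
    assume "?\<Delta> constant_on \<H>"
    then obtain c where "\<And>\<tau>. \<tau> \<in> \<H> \<Longrightarrow> ?\<Delta> \<tau> = c" unfolding constant_on_def by blast
    then have "?\<Delta> z = ?\<Delta> \<i>" using z by (simp add: upper_half_plane_iff)
    then show False using zero modular_Delta_i by simp
  qed
  then obtain g r n where n: "0 < n" and r: "0 < r" "ball z r \<subseteq> \<H>" and g: "g holomorphic_on ball z r"
    and Delta: "\<And>w. w \<in> ball z r \<Longrightarrow> ?\<Delta> w = (w - z) ^ n * g w" and g0: "\<And>w. w \<in> ball z r \<Longrightarrow> g w \<noteq> 0"
    using holomorphic_factor_zero_nonconstant[OF modular_Delta_holomorphic open_upper_half_plane
        convex_connected[OF convex_upper_half_plane] z zero] by metis
  have deriv_factor: "(w - z) * deriv F w = (w - z) ^ n * (of_nat n * u w + (w - z) * deriv u w)"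
    if u: "u holomorphic_on ball z r" and F: "\<And>w. w \<in> ball z r \<Longrightarrow> F w = (w - z) ^ n * u w"
      and w: "w \<in> ball z r" for F u w
  proof -
    have "(u has_field_derivative deriv u w) (at w)"
      using u by (intro holomorphic_derivI[of u "ball z r"] open_ball w)
    then have "((\<lambda>w. (w - z) ^ n * u w) has_field_derivative
        of_nat n * (w - z) ^ (n - 1) * u w + (w - z) ^ n * deriv u w) (at w)"
      by (auto intro!: derivative_eq_intros simp: algebra_simps)
    then have "(F has_field_derivative
        of_nat n * (w - z) ^ (n - 1) * u w + (w - z) ^ n * deriv u w) (at w)"
      by (rule has_field_derivative_transform_within_open[OF _ open_ball w]) (simp add: F)
    then have "deriv F w = of_nat n * (w - z) ^ (n - 1) * u w + (w - z) ^ n * deriv u w"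
      by (rule DERIV_imp_deriv)
    then have "(w - z) * deriv F w = of_nat n * ((w - z) ^ (n - 1) * (w - z)) * u w + (w - z) * (w - z) ^ n * deriv u w"
      by (simp only: distrib_left mult_ac)
    then show ?thesis unfolding power_minus_mult[OF n] by (simp only: distrib_left mult_ac)
  qed
  define p where "p w = of_nat n * g w + (w - z) * deriv g w" for w
  have p: "p holomorphic_on ball z r"
    unfolding p_def by (intro holomorphic_intros holomorphic_deriv g) auto
  \<comment> \<open>From (w - z)^2 \<Delta>'' = (w - z) ((w - z) \<Delta>')' - (w - z) \<Delta>',
    where the last term accounts for \<open>- p w\<close>.\<close>
  define s where "s w = of_nat n * p w + (w - z) * deriv p w - p w" for w
  have s: "s holomorphic_on ball z r"
    unfolding s_def by (intro holomorphic_intros holomorphic_deriv p) auto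
  have 1: "(w - z) * deriv ?\<Delta> w = (w - z) ^ n * p w" if "w \<in> ball z r" for w
    unfolding p_def by (rule deriv_factor[OF g Delta that])
  have 2: "(w - z)\<^sup>2 * deriv (deriv ?\<Delta>) w = (w - z) ^ n * s w" if w: "w \<in> ball z r" for w
  proof -
    have "(deriv ?\<Delta> has_field_derivative deriv (deriv ?\<Delta>) w) (at w)"
      using w r by (intro holomorphic_derivI[of _ \<H>] holomorphic_deriv modular_Delta_holomorphic open_upper_half_plane) auto
    then have "((\<lambda>w. (w - z) * deriv ?\<Delta> w) has_field_derivative
        (deriv ?\<Delta> w + (w - z) * deriv (deriv ?\<Delta>) w)) (at w)"
      by (auto intro!: derivative_eq_intros)
    then have "deriv (\<lambda>w. (w - z) * deriv ?\<Delta> w) w = deriv ?\<Delta> w + (w - z) * deriv (deriv ?\<Delta>) w"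
      by (rule DERIV_imp_deriv)
    then have "(w - z) * (deriv ?\<Delta> w + (w - z) * deriv (deriv ?\<Delta>) w)
        = (w - z) ^ n * (of_nat n * p w + (w - z) * deriv p w)"
      using deriv_factor[OF p 1 w] by simp
    then show ?thesis using 1[OF w] by (simp add: s_def power2_eq_square algebra_simps)
  qed
  \<comment> \<open>The cofactor of (w - z)^(2n) in the equation multiplied by (w - z)^2. At z the
    E_4 term drops out, p = n g and s = n (n - 1) g.\<close>
  define L where "L w = 12 * g w * s w - 13 * (p w)\<^sup>2 - 4 * (of_real pi)\<^sup>2 * eisenstein_E 4 w * ((w - z) * g w)\<^sup>2" for w
  have L: "L w = 0" if w: "w \<in> ball z r - {z}" for w
  proof -
    have wb: "w \<in> ball z r" using w by simp
    define t where "t = (w - z) ^ n"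
    have "t \<noteq> 0" using w by (simp add: t_def)
    have "t\<^sup>2 * L w = 12 * (t * g w) * (t * s w) - 13 * (t * p w)\<^sup>2
        - 4 * (of_real pi)\<^sup>2 * eisenstein_E 4 w * ((w - z) * (t * g w))\<^sup>2"
      by (simp add: L_def power2_eq_square algebra_simps)
    also have "\<dots> = (w - z)\<^sup>2 * (12 * ?\<Delta> w * deriv (deriv ?\<Delta>) w - 13 * (deriv ?\<Delta> w)\<^sup>2
        - 4 * (of_real pi)\<^sup>2 * eisenstein_E 4 w * (?\<Delta> w)\<^sup>2)"
      unfolding t_def 1[OF wb, symmetric] 2[OF wb, symmetric] Delta[OF wb, symmetric]
      by (simp add: power2_eq_square algebra_simps)
    also have "\<dots> = 0" using modular_Delta_ode[of w] r wb by auto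
    finally show ?thesis using \<open>t \<noteq> 0\<close> by simp
  qed
  have "L holomorphic_on ball z r"
    unfolding L_def using r
    by (intro holomorphic_intros g p s) (auto intro: holomorphic_on_subset[OF eisenstein_E_holomorphic])
  then have "continuous_on (ball z r) L" by (rule holomorphic_on_imp_continuous_on)
  then have "(L \<longlongrightarrow> L z) (at z)"
    using r by (simp add: continuous_on_eq_continuous_at isCont_def)
  moreover have "(L \<longlongrightarrow> 0) (at z)"
    by (rule Lim_transform_within_open[OF tendsto_const open_ball[of z r]]) (use L r in auto)
  ultimately have "L z = 0" by (rule LIM_unique)
  then have "(12 * (of_nat n * of_nat n - of_nat n) - 13 * (of_nat n * of_nat n)) * (g z)\<^sup>2 = 0"
    by (simp add: L_def p_def s_def power2_eq_square algebra_simps)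
  then have "12 * (of_nat n * of_nat n - of_nat n) - 13 * (of_nat n * of_nat n) = (0::complex)"
    using g0[of z] r by simp
  moreover have "12 * (of_nat n * of_nat n - of_nat n) - 13 * (of_nat n * of_nat n)
      = - complex_of_nat (n * n + 12 * n)" by (simp add: algebra_simps)
  ultimately have "complex_of_nat (n * n + 12 * n) = 0" by (metis neg_equal_0_iff_equal)
  then show False using n by (simp only: of_nat_eq_0_iff)
qed

section \<open>Weakly holomorphic forms of weights 0, 2 and -2\<close>

text \<open>One constant serves as height and as rate, so bounds for several functions merge by
  taking a maximum. The exponent uses \<open>cmod \<tau>\<close>, so that \<tau> itself qualifies.
  Only the cusp at infinity occurs; equivariance transfers the bound to the others.\<close>

definition cusp_growth :: "(complex \<Rightarrow> 'a::real_normed_vector) \<Rightarrow> bool" where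
  "cusp_growth f \<longleftrightarrow> (\<exists>K\<ge>1. \<forall>\<tau>. Im \<tau> > K \<longrightarrow> norm (f \<tau>) \<le> exp (K * cmod \<tau>))"

lemma cusp_growthI:
  assumes "\<And>\<tau>. Im \<tau> > B \<Longrightarrow> \<tau> \<in> \<H> \<Longrightarrow> norm (f \<tau>) \<le> C * exp (M * cmod \<tau>)"
  shows "cusp_growth f"
  unfolding cusp_growth_def
proof (intro exI conjI allI impI)
  \<comment> \<open>Heights above \<open>K\<close> force \<open>cmod \<tau> \<ge> 1\<close>, so the
    constant factor moves into the exponent: C \<le> exp |C| \<le> exp (|C| |\<tau>|).\<close>
  define K where "K = 1 + \<bar>B\<bar> + \<bar>C\<bar> + \<bar>M\<bar>"
  show "K \<ge> 1" by (simp add: K_def)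
  fix \<tau> assume \<tau>: "Im \<tau> > K"
  have n: "cmod \<tau> \<ge> 1" using \<tau> abs_Im_le_cmod[of \<tau>] by (simp add: K_def)
  have "Im \<tau> > B" "Im \<tau> > 0" using \<tau> by (auto simp: K_def)
  then have "norm (f \<tau>) \<le> C * exp (M * cmod \<tau>)" using assms by (simp add: upper_half_plane_iff)
  also have "\<dots> \<le> exp \<bar>C\<bar> * exp (M * cmod \<tau>)"
  proof (rule mult_right_mono)
    show "C \<le> exp \<bar>C\<bar>" using exp_ge_add_one_self[of "\<bar>C\<bar>"] abs_ge_self[of C] by linarith
  qed simp
  also have "\<dots> = exp (\<bar>C\<bar> * 1 + M * cmod \<tau>)" by (simp add: exp_add)
  also have "\<bar>C\<bar> * 1 + M * cmod \<tau> \<le> \<bar>C\<bar> * cmod \<tau> + \<bar>M\<bar> * cmod \<tau>"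
    using n by (intro add_mono mult_mono) auto
  also have "\<dots> = (\<bar>C\<bar> + \<bar>M\<bar>) * cmod \<tau>" by (simp add: algebra_simps)
  also have "\<dots> \<le> K * cmod \<tau>" by (intro mult_right_mono) (auto simp: K_def)
  finally show "norm (f \<tau>) \<le> exp (K * cmod \<tau>)" by simp
qed

text \<open>Every larger constant works too, so two functions can share one.\<close>

lemma cusp_growthE:
  assumes "cusp_growth f"
  obtains K where "K \<ge> 1" "\<And>L \<tau>. L \<ge> K \<Longrightarrow> Im \<tau> > L \<Longrightarrow> norm (f \<tau>) \<le> exp (L * cmod \<tau>)"
proof -
  obtain K where K: "K \<ge> 1" "\<And>\<tau>. Im \<tau> > K \<Longrightarrow> norm (f \<tau>) \<le> exp (K * cmod \<tau>)"
    using assms by (auto simp: cusp_growth_def)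
  have "norm (f \<tau>) \<le> exp (L * cmod \<tau>)" if "L \<ge> K" "Im \<tau> > L" for L \<tau>
    using K(2)[of \<tau>] that mult_right_mono[OF that(1), of "cmod \<tau>"] by (auto intro: order_trans)
  then show ?thesis using K that by blast
qed

named_theorems cusp_growth_intros

lemma cusp_growth_bounded:
  assumes "\<And>\<tau>. \<tau> \<in> \<H> \<Longrightarrow> Im \<tau> > B \<Longrightarrow> norm (f \<tau>) \<le> C"
  shows "cusp_growth f"
  by (rule cusp_growthI[of B _ C 0]) (use assms in simp)

lemma cusp_growth_const [cusp_growth_intros]: "cusp_growth (\<lambda>\<tau>. c)"
  by (rule cusp_growth_bounded) (rule order_refl)

lemma cusp_growth_ident [cusp_growth_intros]: "cusp_growth (\<lambda>\<tau>. \<tau>)"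
  by (rule cusp_growthI[of 0 _ 1 1]) (smt (verit) exp_ge_add_one_self mult_1)

lemma cusp_growth_add [cusp_growth_intros]:
  assumes "cusp_growth f" "cusp_growth g"
  shows "cusp_growth (\<lambda>\<tau>. f \<tau> + g \<tau>)"
proof -
  obtain K where K: "K \<ge> 1" "\<And>L \<tau>. L \<ge> K \<Longrightarrow> Im \<tau> > L \<Longrightarrow> norm (f \<tau>) \<le> exp (L * cmod \<tau>)"
    using cusp_growthE[OF assms(1)] by blast
  obtain K' where K': "K' \<ge> 1" "\<And>L \<tau>. L \<ge> K' \<Longrightarrow> Im \<tau> > L \<Longrightarrow> norm (g \<tau>) \<le> exp (L * cmod \<tau>)"
    using cusp_growthE[OF assms(2)] by blast
  define L where "L = max K K'"
  show ?thesis
  proof (rule cusp_growthI[of L _ 2 L])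
    fix \<tau> assume "Im \<tau> > L"
    then show "norm (f \<tau> + g \<tau>) \<le> 2 * exp (L * cmod \<tau>)"
      using K(2)[of L \<tau>] K'(2)[of L \<tau>] norm_triangle_ineq[of "f \<tau>" "g \<tau>"] by (simp add: L_def)
  qed
qed

lemma cusp_growth_mult [cusp_growth_intros]:
  fixes f g :: "complex \<Rightarrow> complex"
  assumes "cusp_growth f" "cusp_growth g"
  shows "cusp_growth (\<lambda>\<tau>. f \<tau> * g \<tau>)"
proof -
  obtain K where K: "K \<ge> 1" "\<And>L \<tau>. L \<ge> K \<Longrightarrow> Im \<tau> > L \<Longrightarrow> norm (f \<tau>) \<le> exp (L * cmod \<tau>)"
    using cusp_growthE[OF assms(1)] by blast
  obtain K' where K': "K' \<ge> 1" "\<And>L \<tau>. L \<ge> K' \<Longrightarrow> Im \<tau> > L \<Longrightarrow> norm (g \<tau>) \<le> exp (L * cmod \<tau>)"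
    using cusp_growthE[OF assms(2)] by blast
  define L where "L = max K K'"
  show ?thesis
  proof (rule cusp_growthI[of L _ 1 "L + L"])
    fix \<tau> assume "Im \<tau> > L"
    then have "norm (f \<tau> * g \<tau>) \<le> exp (L * cmod \<tau>) * exp (L * cmod \<tau>)"
      using K(2)[of L \<tau>] K'(2)[of L \<tau>] unfolding norm_mult by (intro mult_mono) (auto simp: L_def)
    then show "norm (f \<tau> * g \<tau>) \<le> 1 * exp ((L + L) * cmod \<tau>)"
      by (simp add: exp_add [symmetric] algebra_simps)
  qed
qed

lemma cusp_growth_power [cusp_growth_intros]:
  fixes f :: "complex \<Rightarrow> complex"
  shows "cusp_growth f \<Longrightarrow> cusp_growth (\<lambda>\<tau>. f \<tau> ^ n)"
  by (induction n) (auto intro!: cusp_growth_intros)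

lemma cusp_growth_minus [cusp_growth_intros]: "cusp_growth f \<Longrightarrow> cusp_growth (\<lambda>\<tau>. - f \<tau>)"
  by (simp add: cusp_growth_def)

lemma cusp_growth_diff [cusp_growth_intros]:
  "cusp_growth f \<Longrightarrow> cusp_growth g \<Longrightarrow> cusp_growth (\<lambda>\<tau>. f \<tau> - g \<tau>)"
  using cusp_growth_add[of f "\<lambda>\<tau>. - g \<tau>"] by (simp add: cusp_growth_minus)

lemma cusp_growth_q_expansion:
  assumes g: "g holomorphic_on ball 0 1" and f: "\<And>\<tau>. \<tau> \<in> \<H> \<Longrightarrow> f \<tau> = g (nome \<tau>)"
  shows "cusp_growth f"
proof -
  obtain B where B: "\<And>\<tau>. \<tau> \<in> \<H> \<Longrightarrow> Im \<tau> > B \<Longrightarrow> cmod (g (nome \<tau>) - g 0) < 1"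
    using tendsto_at_cusp[OF g, of 1] by auto
  show ?thesis
  proof (rule cusp_growth_bounded[of B _ "cmod (g 0) + 1"])
    fix \<tau> assume "\<tau> \<in> \<H>" "Im \<tau> > B"
    then show "cmod (f \<tau>) \<le> cmod (g 0) + 1"
      using B[of \<tau>] f[of \<tau>] norm_triangle_ineq2[of "g (nome \<tau>)" "g 0"] by simp
  qed
qed

lemma cusp_growth_eisenstein_E [cusp_growth_intros]:
  assumes "k \<ge> 4" "even k"
  shows "cusp_growth (eisenstein_E k)"
  using eisenstein_E_q_expansion[OF assms] cusp_growth_q_expansion by metis

lemma modular_Delta_q_expansion_nonzero:
  obtains A where "A holomorphic_on ball 0 1" "\<And>q. q \<in> ball 0 1 \<Longrightarrow> A q \<noteq> 0"
    "\<And>\<tau>. \<tau> \<in> \<H> \<Longrightarrow> modular_Delta \<tau> = nome \<tau> * A (nome \<tau>)"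
proof -
  obtain A where A: "A holomorphic_on ball 0 1" "A 0 \<noteq> 0" "\<And>\<tau>. \<tau> \<in> \<H> \<Longrightarrow> modular_Delta \<tau> = nome \<tau> * A (nome \<tau>)"
    using modular_Delta_q_expansion by blast
  have "A q \<noteq> 0" if q: "q \<in> ball 0 1" for q
  proof (cases "q = 0")
    case False
    then obtain \<tau> where "\<tau> \<in> \<H>" "nome \<tau> = q" using nome_surj[OF q] by blast
    then show ?thesis using A(3)[of \<tau>] modular_Delta_nonzero[of \<tau>] by auto
  qed (use A in simp)
  with A that show ?thesis by blast
qed

text \<open>The simple zero at the cusp accounts for the growth of 1/q; the quotient q / \<Delta> is
  holomorphic in q on the whole disc.\<close>

lemma cusp_growth_inverse_modular_Delta [cusp_growth_intros]: "cusp_growth (\<lambda>\<tau>. inverse (modular_Delta \<tau>))"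
proof -
  obtain A where A: "A holomorphic_on ball 0 1" "\<And>q. q \<in> ball 0 1 \<Longrightarrow> A q \<noteq> 0"
    "\<And>\<tau>. \<tau> \<in> \<H> \<Longrightarrow> modular_Delta \<tau> = nome \<tau> * A (nome \<tau>)"
    using modular_Delta_q_expansion_nonzero by blast
  have "cusp_growth (\<lambda>\<tau>. inverse (nome \<tau>))"
  proof (rule cusp_growthI[of 0 _ 1 "2 * pi"])
    fix \<tau>
    show "cmod (inverse (nome \<tau>)) \<le> 1 * exp (2 * pi * cmod \<tau>)"
      using abs_Im_le_cmod[of \<tau>] by (simp add: norm_inverse norm_nome exp_minus [symmetric])
  qed
  moreover have "(\<lambda>q. inverse (A q)) holomorphic_on ball 0 1"
    using A by (intro holomorphic_intros) auto
  then have "cusp_growth (\<lambda>\<tau>. nome \<tau> * inverse (modular_Delta \<tau>))"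
    by (rule cusp_growth_q_expansion) (use A nome_in_ball in \<open>auto simp: field_simps\<close>)
  ultimately have "cusp_growth (\<lambda>\<tau>. inverse (nome \<tau>) * (nome \<tau> * inverse (modular_Delta \<tau>)))"
    by (rule cusp_growth_mult)
  then show ?thesis by (simp add: mult.assoc [symmetric])
qed

section \<open>Klein's j-invariant and weight zero forms as polynomials in j\<close>

lemma klein_j_modular:
  assumes "\<gamma> \<in> SL2Z" "\<tau> \<in> \<H>"
  shows "klein_j (moebius \<gamma> \<tau>) = klein_j \<tau>"
  using cocycle_SL2Z_nonzero[OF assms]
  by (simp add: klein_j_def eisenstein_E_modular[OF assms] modular_Delta_modular[OF assms]
      power_mult_distrib power_mult [symmetric])

lemma klein_j_holomorphic: "klein_j holomorphic_on \<H>"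
  unfolding klein_j_def [abs_def] using modular_Delta_nonzero
  by (intro holomorphic_intros eisenstein_E_holomorphic modular_Delta_holomorphic) auto

lemma poly_klein_j_holomorphic: "(\<lambda>\<tau>. poly p (klein_j \<tau>)) holomorphic_on \<H>"
  by (induction p) (auto intro!: holomorphic_intros klein_j_holomorphic)

lemma cusp_growth_poly_klein_j [cusp_growth_intros]: "cusp_growth (\<lambda>\<tau>. poly p (klein_j \<tau>))"
proof -
  have "cusp_growth klein_j"
    unfolding klein_j_def [abs_def] divide_inverse by (intro cusp_growth_intros) auto
  then show ?thesis by (induction p) (auto intro!: cusp_growth_intros)
qed

lemma klein_j_rho: "klein_j rho = 0"
  by (simp add: klein_j_def eisenstein_E4_rho)

lemma klein_j_minus_1728:
  assumes "\<tau> \<in> \<H>"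
  shows "klein_j \<tau> - 1728 = eisenstein_E 6 \<tau> ^ 2 / modular_Delta \<tau>"
proof -
  have "1728 * modular_Delta \<tau> = eisenstein_E 4 \<tau> ^ 3 - eisenstein_E 6 \<tau> ^ 2"
    unfolding modular_Delta_def by simp
  then have "eisenstein_E 4 \<tau> ^ 3 - 1728 * modular_Delta \<tau> = eisenstein_E 6 \<tau> ^ 2" by simp
  then show ?thesis
    using modular_Delta_nonzero[OF assms] by (simp add: klein_j_def field_simps)
qed

lemma klein_j_i: "klein_j \<i> = 1728"
  using klein_j_minus_1728[of \<i>] by (simp add: eisenstein_E6_i upper_half_plane_iff)

lemma klein_j_q_expansion:
  obtains G where "G holomorphic_on ball 0 1" "G 0 \<noteq> 0" "\<And>\<tau>. \<tau> \<in> \<H> \<Longrightarrow> nome \<tau> * klein_j \<tau> = G (nome \<tau>)"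
proof -
  obtain A where A: "A holomorphic_on ball 0 1" "\<And>q. q \<in> ball 0 1 \<Longrightarrow> A q \<noteq> 0"
    "\<And>\<tau>. \<tau> \<in> \<H> \<Longrightarrow> modular_Delta \<tau> = nome \<tau> * A (nome \<tau>)"
    using modular_Delta_q_expansion_nonzero by blast
  obtain g4 where g4: "g4 holomorphic_on ball 0 1" "\<And>\<tau>. \<tau> \<in> \<H> \<Longrightarrow> eisenstein_E 4 \<tau> = g4 (nome \<tau>)" "g4 0 = 1"
    using eisenstein_E_q_expansion[of 4] by auto
  show ?thesis
  proof (rule that[of "\<lambda>q. g4 q ^ 3 / A q"])
    show "(\<lambda>q. g4 q ^ 3 / A q) holomorphic_on ball 0 1"
      using A by (intro holomorphic_intros g4) auto
    show "g4 0 ^ 3 / A 0 \<noteq> 0" using A(2)[of 0] g4 by simp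
    show "nome \<tau> * klein_j \<tau> = g4 (nome \<tau>) ^ 3 / A (nome \<tau>)" if "\<tau> \<in> \<H>" for \<tau>
      using A(2)[OF nome_in_ball[OF that]] by (simp add: klein_j_def A(3)[OF that] g4(2)[OF that])
  qed
qed

text \<open>Since j has a simple pole at the cusp, subtracting a multiple of j^N lowers a pole of
  order at most N. Without a pole, subtracting the value at the cusp leaves a form of weight 0
  vanishing there, which is zero.\<close>

lemma polynomial_in_klein_j_if_finite_order:
  assumes G: "G holomorphic_on ball 0 1" "G 0 \<noteq> 0" "\<And>\<tau>. \<tau> \<in> \<H> \<Longrightarrow> nome \<tau> * klein_j \<tau> = G (nome \<tau>)"
    and f: "f holomorphic_on \<H>"
    and mod: "\<And>\<gamma> \<tau>. \<gamma> \<in> SL2Z \<Longrightarrow> \<tau> \<in> \<H> \<Longrightarrow> f (moebius \<gamma> \<tau>) = f \<tau>"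
    and g: "g holomorphic_on ball 0 1" and fg: "\<And>\<tau>. \<tau> \<in> \<H> \<Longrightarrow> nome \<tau> ^ N * f \<tau> = g (nome \<tau>)"
  shows "\<exists>p. \<forall>\<tau>\<in>\<H>. f \<tau> = poly p (klein_j \<tau>)"
  using f mod g fg
proof (induction N arbitrary: f g)
  case 0
  have "(\<lambda>q. g q - g 0) holomorphic_on ball 0 1" using 0 by (intro holomorphic_intros)
  then obtain h where h: "h holomorphic_on ball 0 1" "\<And>q. cmod q < 1 \<Longrightarrow> g q - g 0 = q * h q"
    using Schwarz3[of "\<lambda>q. g q - g 0" 1] by auto
  have "f \<tau> - g 0 = 0" if \<tau>: "\<tau> \<in> \<H>" for \<tau>
  proof (rule modular_form_eq_0_if_high_order_at_cusp[of "\<lambda>\<tau>. f \<tau> - g 0" 0 h 1])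
    show "(\<lambda>\<tau>. f \<tau> - g 0) holomorphic_on \<H>" using 0 by (intro holomorphic_intros)
    show "f (\<tau> + 1) - g 0 = f \<tau> - g 0" "f (- 1 / \<tau>) - g 0 = \<tau> ^ (2 * 0) * (f \<tau> - g 0)" if "\<tau> \<in> \<H>" for \<tau>
      using 0(2)[of T_matrix \<tau>] 0(2)[of S_matrix \<tau>] that by simp_all
    show "f \<tau> - g 0 = nome \<tau> ^ 1 * h (nome \<tau>)" if "\<tau> \<in> \<H>" for \<tau>
      using 0(4)[OF that] h(2)[of "nome \<tau>"] nome_in_ball[OF that] by simp
  qed (use h \<tau> in auto)
  then show ?case by (intro exI[of _ "[:g 0:]"]) simp
next
  case (Suc N)
  \<comment> \<open>Chosen to cancel the coefficient of q^(-(N + 1)).\<close>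
  define a where "a = g 0 / G 0 ^ Suc N"
  define f1 where "f1 \<tau> = f \<tau> - a * klein_j \<tau> ^ Suc N" for \<tau>
  define g1 where "g1 q = g q - a * G q ^ Suc N" for q
  have "g1 holomorphic_on ball 0 1" unfolding g1_def by (intro holomorphic_intros Suc G)
  moreover have "g1 0 = 0" using G(2) by (simp add: g1_def a_def)
  ultimately obtain h where h: "h holomorphic_on ball 0 1" "\<And>q. cmod q < 1 \<Longrightarrow> g1 q = q * h q"
    using Schwarz3[of g1 1] by auto
  have "\<exists>p. \<forall>\<tau>\<in>\<H>. f1 \<tau> = poly p (klein_j \<tau>)"
  proof (rule Suc.IH[OF _ _ h(1)])
    show "f1 holomorphic_on \<H>" unfolding f1_def by (intro holomorphic_intros Suc klein_j_holomorphic)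
    show "f1 (moebius \<gamma> \<tau>) = f1 \<tau>" if "\<gamma> \<in> SL2Z" "\<tau> \<in> \<H>" for \<gamma> \<tau>
      using that by (simp add: f1_def Suc.prems(2) klein_j_modular)
    show "nome \<tau> ^ N * f1 \<tau> = h (nome \<tau>)" if "\<tau> \<in> \<H>" for \<tau>
    proof -
      have "nome \<tau> * (nome \<tau> ^ N * f1 \<tau>) = nome \<tau> ^ Suc N * f \<tau> - a * (nome \<tau> * klein_j \<tau>) ^ Suc N"
        by (simp add: f1_def power_mult_distrib algebra_simps)
      also have "\<dots> = g1 (nome \<tau>)" by (simp only: Suc.prems(4)[OF that] G(3)[OF that] g1_def)
      also have "\<dots> = nome \<tau> * h (nome \<tau>)" using h(2) nome_in_ball[OF that] by simp
      finally show ?thesis by simp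
    qed
  qed
  then obtain p where p: "\<And>\<tau>. \<tau> \<in> \<H> \<Longrightarrow> f1 \<tau> = poly p (klein_j \<tau>)" by blast
  have "\<forall>\<tau>\<in>\<H>. f \<tau> = poly (p + monom a (Suc N)) (klein_j \<tau>)"
    using p by (simp add: f1_def poly_monom diff_eq_eq del: power_Suc)
  then show ?case by blast
qed

text \<open>Exponential growth means a pole of finite order in q: multiplication by a high power of
  \<open>nome\<close> makes f bounded near the cusp, so the singularity is removable.\<close>

theorem polynomial_in_klein_j:
  assumes f: "f holomorphic_on \<H>"
    and mod: "\<And>\<gamma> \<tau>. \<gamma> \<in> SL2Z \<Longrightarrow> \<tau> \<in> \<H> \<Longrightarrow> f (moebius \<gamma> \<tau>) = f \<tau>"
    and growth: "cusp_growth f"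
  obtains p where "\<And>\<tau>. \<tau> \<in> \<H> \<Longrightarrow> f \<tau> = poly p (klein_j \<tau>)"
proof -
  have T: "f (\<tau> + 1) = f \<tau>" if "\<tau> \<in> \<H>" for \<tau>
    using mod[of T_matrix \<tau>] that by simp
  obtain K where K: "K \<ge> 1" "\<And>L \<tau>. L \<ge> K \<Longrightarrow> Im \<tau> > L \<Longrightarrow> norm (f \<tau>) \<le> exp (L * cmod \<tau>)"
    using cusp_growthE[OF growth] by blast
  \<comment> \<open>\<open>N \<ge> K\<close> yields \<open>K \<le> 2 * pi * N\<close>, so the decay
    of \<open>nome \<tau> ^ N\<close> absorbs growth at rate \<open>K\<close> in the height.\<close>
  define N where "N = nat \<lceil>K\<rceil>"
  have "real N \<ge> K" unfolding N_def using K(1) by linarith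
  then have N: "K \<le> 2 * pi * N"
    using mult_mono[of 1 "2 * pi" K "real N"] pi_gt3 K(1) by simp
  have "\<exists>g. g holomorphic_on ball 0 1 \<and> (\<forall>\<tau>\<in>\<H>. nome \<tau> ^ N * f \<tau> = g (nome \<tau>))"
  proof -
    have per: "nome (\<tau> + 1) ^ N * f (\<tau> + 1) = nome \<tau> ^ N * f \<tau>" if "\<tau> \<in> \<H>" for \<tau>
      using T[OF that] nome_add_of_int[of \<tau> 1] by simp
    have bound: "cmod (nome \<tau> ^ N * f \<tau>) \<le> exp K" if \<tau>: "\<tau> \<in> \<H>" "Im \<tau> > K" for \<tau>
    proof -
      \<comment> \<open>The bound on f is in |\<tau>| and useless for large real part. After
        translation, |\<sigma>| \<le> 1 + Im \<sigma>, and periodicity carries the result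
        back.\<close>
      define \<sigma> where "\<sigma> = \<tau> + of_int (- round (Re \<tau>))"
      have re: "\<bar>Re \<sigma>\<bar> \<le> 1"
        using of_int_round_abs_le[of "Re \<tau>"] by (simp add: \<sigma>_def abs_minus_commute)
      have im: "Im \<sigma> = Im \<tau>" by (simp add: \<sigma>_def)
      have "cmod \<sigma> \<le> 1 + Im \<sigma>"
        using cmod_le[of \<sigma>] re \<tau> im by (simp add: upper_half_plane_iff)
      then have "K * cmod \<sigma> \<le> K * (1 + Im \<sigma>)" using K(1) by (intro mult_left_mono) auto
      then have "cmod (f \<sigma>) \<le> exp (K * (1 + Im \<sigma>))"
        using K(2)[of K \<sigma>] \<tau> im by (auto intro: order_trans)
      moreover have "cmod (nome \<sigma>) ^ N = exp (- (2 * pi * N * Im \<sigma>))"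
        by (simp add: norm_nome exp_of_nat_mult [symmetric] mult_ac)
      ultimately have "cmod (nome \<sigma> ^ N * f \<sigma>) \<le> exp (- (2 * pi * N * Im \<sigma>)) * exp (K * (1 + Im \<sigma>))"
        unfolding norm_mult norm_power by (intro mult_mono) auto
      also have "\<dots> = exp (K * (1 + Im \<sigma>) - 2 * pi * N * Im \<sigma>)"
        by (simp add: exp_add [symmetric])
      also have "\<dots> \<le> exp K"
        using mult_right_mono[OF N, of "Im \<sigma>"] \<tau> im by (simp add: upper_half_plane_iff algebra_simps)
      also have "nome \<sigma> ^ N * f \<sigma> = nome \<tau> ^ N * f \<tau>"
        unfolding \<sigma>_def by (rule periodic_of_int[of "\<lambda>\<tau>. nome \<tau> ^ N * f \<tau>", OF per \<tau>(1)])
      finally show ?thesis .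
    qed
    have hol: "(\<lambda>\<tau>. nome \<tau> ^ N * f \<tau>) holomorphic_on \<H>" by (intro holomorphic_intros f)
    show ?thesis
      by (rule q_expansion_bounded[of "\<lambda>\<tau>. nome \<tau> ^ N * f \<tau>", OF hol per bound]) blast+
  qed
  then obtain g where g: "g holomorphic_on ball 0 1" "\<And>\<tau>. \<tau> \<in> \<H> \<Longrightarrow> nome \<tau> ^ N * f \<tau> = g (nome \<tau>)"
    by blast
  obtain G where G: "G holomorphic_on ball 0 1" "G 0 \<noteq> 0" "\<And>\<tau>. \<tau> \<in> \<H> \<Longrightarrow> nome \<tau> * klein_j \<tau> = G (nome \<tau>)"
    using klein_j_q_expansion by blast
  show ?thesis
    using polynomial_in_klein_j_if_finite_order[OF G f mod g] that by blast
qed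

section \<open>The generators in weights 2 and -2\<close>

definition weight2 :: "complex \<Rightarrow> complex" where
  "weight2 \<tau> = eisenstein_E 4 \<tau> ^ 2 * eisenstein_E 6 \<tau> * inverse (modular_Delta \<tau>)"

text \<open>The numerator is E_10, that of \<open>weight2\<close> is E_14, and
  \<open>weight2\<close> is dj/d\<tau> divided by -2 \<pi> i.\<close>

definition weight_neg2 :: "complex \<Rightarrow> complex" where
  "weight_neg2 \<tau> = eisenstein_E 4 \<tau> * eisenstein_E 6 \<tau> * inverse (modular_Delta \<tau>)"

lemma weight2_holomorphic: "weight2 holomorphic_on \<H>"
  unfolding weight2_def [abs_def] using modular_Delta_nonzero
  by (intro holomorphic_intros eisenstein_E_holomorphic modular_Delta_holomorphic) auto

lemma weight_neg2_holomorphic: "weight_neg2 holomorphic_on \<H>"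
  unfolding weight_neg2_def [abs_def] using modular_Delta_nonzero
  by (intro holomorphic_intros eisenstein_E_holomorphic modular_Delta_holomorphic) auto

lemma cusp_growth_weight2 [cusp_growth_intros]: "cusp_growth weight2"
  unfolding weight2_def [abs_def] by (intro cusp_growth_intros) auto

lemma cusp_growth_weight_neg2 [cusp_growth_intros]: "cusp_growth weight_neg2"
  unfolding weight_neg2_def [abs_def] by (intro cusp_growth_intros) auto

lemma weight2_modular:
  assumes "\<gamma> \<in> SL2Z" "\<tau> \<in> \<H>"
  shows "weight2 (moebius \<gamma> \<tau>) = cocycle \<gamma> \<tau> ^ 2 * weight2 \<tau>"
proof -
  define J where "J = cocycle \<gamma> \<tau>"
  have "J \<noteq> 0" using cocycle_SL2Z_nonzero[OF assms] by (simp add: J_def)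
  have "weight2 (moebius \<gamma> \<tau>) = (J ^ 4) ^ 2 * J ^ 6 * inverse (J ^ 12) * weight2 \<tau>"
    by (simp add: weight2_def eisenstein_E_modular[OF assms] modular_Delta_modular[OF assms] J_def
        power_mult_distrib)
  also have "(J ^ 4) ^ 2 * J ^ 6 * inverse (J ^ 12) = J ^ 2"
    using \<open>J \<noteq> 0\<close> by (simp add: field_simps flip: power_mult power_add)
  finally show ?thesis by (simp add: J_def)
qed

text \<open>The automorphy factor stands on the left so that weight -2 is expressed with a natural
  exponent.\<close>

lemma weight_neg2_modular:
  assumes "\<gamma> \<in> SL2Z" "\<tau> \<in> \<H>"
  shows "cocycle \<gamma> \<tau> ^ 2 * weight_neg2 (moebius \<gamma> \<tau>) = weight_neg2 \<tau>"
proof -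
  define J where "J = cocycle \<gamma> \<tau>"
  have "J \<noteq> 0" using cocycle_SL2Z_nonzero[OF assms] by (simp add: J_def)
  have "J ^ 2 * weight_neg2 (moebius \<gamma> \<tau>) = J ^ 2 * J ^ 4 * J ^ 6 * inverse (J ^ 12) * weight_neg2 \<tau>"
    by (simp add: weight_neg2_def eisenstein_E_modular[OF assms] modular_Delta_modular[OF assms] J_def)
  also have "J ^ 2 * J ^ 4 * J ^ 6 * inverse (J ^ 12) = 1"
    using \<open>J \<noteq> 0\<close> by (simp flip: power_add)
  finally show ?thesis by (simp add: J_def)
qed

lemma weight2_times_weight_neg2:
  assumes "\<tau> \<in> \<H>"
  shows "weight2 \<tau> * weight_neg2 \<tau> = klein_j \<tau> * (klein_j \<tau> - 1728)"
  unfolding klein_j_minus_1728[OF assms]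
  by (simp add: weight2_def weight_neg2_def klein_j_def field_simps eval_nat_numeral)

lemma weight2_rho_i: "weight2 rho = 0" "weight2 \<i> = 0"
  and weight_neg2_rho_i: "weight_neg2 rho = 0" "weight_neg2 \<i> = 0"
  by (simp_all add: weight2_def weight_neg2_def eisenstein_E4_rho eisenstein_E6_i)

lemma eisenstein_E_nonzero_near_cusp:
  assumes "k \<ge> 4" "even k"
  obtains B where "\<And>\<tau>. \<tau> \<in> \<H> \<Longrightarrow> Im \<tau> > B \<Longrightarrow> eisenstein_E k \<tau> \<noteq> 0"
proof -
  obtain g where g: "g holomorphic_on ball 0 1" "\<And>\<tau>. \<tau> \<in> \<H> \<Longrightarrow> eisenstein_E k \<tau> = g (nome \<tau>)" "g 0 = 1"
    using eisenstein_E_q_expansion[OF assms] by blast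
  obtain B where B: "\<And>\<tau>. \<tau> \<in> \<H> \<Longrightarrow> Im \<tau> > B \<Longrightarrow> cmod (g (nome \<tau>) - g 0) < 1"
    using tendsto_at_cusp[OF g(1), of 1] by auto
  show ?thesis
    by (rule that[of B]) (use B g in \<open>force\<close>)
qed

text \<open>E_4 and E_6 tend to 1 at the cusp, so a point high on the imaginary axis will do. It
  serves to cancel either generator by analytic continuation.\<close>

lemma weights_nonzero:
  obtains a where "a \<in> \<H>" "weight2 a \<noteq> 0" "weight_neg2 a \<noteq> 0"
proof -
  obtain B4 where B4: "\<And>\<tau>. \<tau> \<in> \<H> \<Longrightarrow> Im \<tau> > B4 \<Longrightarrow> eisenstein_E 4 \<tau> \<noteq> 0"
    using eisenstein_E_nonzero_near_cusp[of 4] by auto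
  obtain B6 where B6: "\<And>\<tau>. \<tau> \<in> \<H> \<Longrightarrow> Im \<tau> > B6 \<Longrightarrow> eisenstein_E 6 \<tau> \<noteq> 0"
    using eisenstein_E_nonzero_near_cusp[of 6] by auto
  define a where "a = Complex 0 (1 + \<bar>B4\<bar> + \<bar>B6\<bar>)"
  have "a \<in> \<H>" by (simp add: a_def upper_half_plane_iff)
  then show ?thesis
    using that[of a] B4[of a] B6[of a] modular_Delta_nonzero[of a]
    by (simp add: weight2_def weight_neg2_def a_def)
qed

text \<open>\<open>F G\<close> has weight zero and vanishes where \<open>j = 0\<close> and where \<open>j = 1728\<close>, so it is a multiple of
  \<open>j (j - 1728) = G G'\<close>, and \<open>G\<close> cancels. No information on the zeros of \<open>G\<close> is needed.\<close>

lemma weakly_holomorphic_multiple: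
  assumes F: "F holomorphic_on \<H>" "cusp_growth F"
    and G: "G holomorphic_on \<H>" "cusp_growth G" "G rho = 0" "G \<i> = 0" "a \<in> \<H>" "G a \<noteq> 0"
    and G': "G' holomorphic_on \<H>" "\<And>\<tau>. \<tau> \<in> \<H> \<Longrightarrow> G \<tau> * G' \<tau> = klein_j \<tau> * (klein_j \<tau> - 1728)"
    and mod: "\<And>\<gamma> \<tau>. \<gamma> \<in> SL2Z \<Longrightarrow> \<tau> \<in> \<H> \<Longrightarrow> F (moebius \<gamma> \<tau>) * G (moebius \<gamma> \<tau>) = F \<tau> * G \<tau>"
  obtains p where "\<And>\<tau>. \<tau> \<in> \<H> \<Longrightarrow> F \<tau> = poly p (klein_j \<tau>) * G' \<tau>"
proof -
  obtain P where P: "\<And>\<tau>. \<tau> \<in> \<H> \<Longrightarrow> F \<tau> * G \<tau> = poly P (klein_j \<tau>)"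
    using polynomial_in_klein_j[of "\<lambda>\<tau>. F \<tau> * G \<tau>", OF holomorphic_on_mult[OF F(1) G(1)] mod
        cusp_growth_mult[OF F(2) G(2)]] by blast
  have "poly P 0 = 0"
    using P[of rho] rho_upper_half_plane G by (simp add: klein_j_rho)
  then obtain R where R: "P = [:- 0, 1:] * R" unfolding poly_eq_0_iff_dvd by blast
  have "poly P 1728 = 0"
    using P[of \<i>] G by (simp add: klein_j_i upper_half_plane_iff)
  then have "poly R 1728 = 0" using R by simp
  then obtain Q where Q: "R = [:- 1728, 1:] * Q" unfolding poly_eq_0_iff_dvd by blast
  have "F \<tau> - poly Q (klein_j \<tau>) * G' \<tau> = 0" if "\<tau> \<in> \<H>" for \<tau>
  proof (rule eq_on_upper_half_plane[of G "\<lambda>\<tau>. F \<tau> - poly Q (klein_j \<tau>) * G' \<tau>"])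
    show "(\<lambda>\<tau>. F \<tau> - poly Q (klein_j \<tau>) * G' \<tau>) holomorphic_on \<H>"
      by (intro holomorphic_intros F G' poly_klein_j_holomorphic)
    show "G \<tau> * (F \<tau> - poly Q (klein_j \<tau>) * G' \<tau>) = 0" if "\<tau> \<in> \<H>" for \<tau>
    proof -
      have "G \<tau> * (F \<tau> - poly Q (klein_j \<tau>) * G' \<tau>) = F \<tau> * G \<tau> - poly Q (klein_j \<tau>) * (G \<tau> * G' \<tau>)"
        by (simp add: algebra_simps)
      also have "\<dots> = 0"
        unfolding P[OF that] G'(2)[OF that] R Q by (simp add: algebra_simps)
      finally show ?thesis .
    qed
  qed (use G that in auto)
  then show ?thesis by (intro that[of Q]) simp
qed

section \<open>The Lie algebra of equivariant maps\<close>

definition mat2 :: "'a \<Rightarrow> 'a \<Rightarrow> 'a \<Rightarrow> 'a \<Rightarrow> 'a::zero^2^2" where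
  "mat2 a b c d = vector [vector [a, b], vector [c, d]]"

lemma mat2_nth [simp]:
  "mat2 a b c d $ 1 $ 1 = a" "mat2 a b c d $ 1 $ 2 = b"
  "mat2 a b c d $ 2 $ 1 = c" "mat2 a b c d $ 2 $ 2 = d"
  by (simp_all add: mat2_def)

lemma matrix2_eqI:
  assumes "A$1$1 = B$1$1" "A$1$2 = B$1$2" "A$2$1 = B$2$1" "A$2$2 = (B::'a^2^2)$2$2"
  shows "A = B"
  using assms by (simp add: vec_eq_iff forall_2)

lemma matrix2_mult_nth: "((A::'a::semiring_1^2^2) ** B) $ i $ k = A$i$1 * B$1$k + A$i$2 * B$2$k"
  by (simp add: matrix_matrix_mult_def sum_2)

lemma mat2_mult:
  "mat2 a b c d ** mat2 a' b' c' d' =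
    mat2 (a * a' + b * c') (a * b' + b * d') (c * a' + d * c') (c * b' + d * (d'::'a::semiring_1))"
  by (rule matrix2_eqI) (simp_all add: matrix2_mult_nth)

lemma mat2_1: "mat 1 = mat2 1 0 0 1"
  by (rule matrix2_eqI) (simp_all add: mat_def)

lemma map_matrix_nth [simp]: "map_matrix f A $ i $ k = f (A $ i $ k)"
  by (simp add: map_matrix_def)

lemma matrix_diff_ldistrib: "A ** (B - C) = A ** B - A ** (C :: 'a::ring_1^'p^'n)"
  by (simp add: vec_eq_iff matrix_matrix_mult_def sum_subtractf right_diff_distrib)

lemma matrix_diff_rdistrib: "(A - B) ** C = A ** C - B ** (C :: 'a::ring_1^'p^'n)"
  by (simp add: vec_eq_iff matrix_matrix_mult_def sum_subtractf left_diff_distrib)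

lemma matrix_mult_map_times:
  "A ** map_matrix ((*) c) B = map_matrix ((*) c) (A ** (B :: complex^'n^'n))"
  "map_matrix ((*) c) A ** B = map_matrix ((*) c) (A ** (B :: complex^'n^'n))"
  by (simp_all add: vec_eq_iff matrix_matrix_mult_def sum_distrib_left mult_ac)

lemma matrix_add_rdistrib: "(A + B) ** C = A ** C + B ** (C :: 'a::semiring_1^'p^'n)"
  by (simp add: vec_eq_iff matrix_matrix_mult_def sum.distrib distrib_right)

section \<open>Commutators and the adjoint action\<close>

definition commutator :: "complex^'n^'n \<Rightarrow> complex^'n^'n \<Rightarrow> complex^'n^'n" where
  "commutator A B = A ** B - B ** A"

lemma commutator_bilinear:
  "commutator (A + B) C = commutator A C + commutator B C"
  "commutator A (B + C) = commutator A B + commutator A C"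
  "commutator (map_matrix ((*) c) A) B = map_matrix ((*) c) (commutator A B)"
  "commutator A (map_matrix ((*) c) B) = map_matrix ((*) c) (commutator A B)"
  unfolding commutator_def
  by (simp_all add: matrix_add_ldistrib matrix_add_rdistrib matrix_mult_map_times)
    (simp_all add: vec_eq_iff algebra_simps)

lemma commutator_self: "commutator A A = 0"
  by (simp add: commutator_def)

lemma commutator_jacobi:
  "commutator A (commutator B C) + commutator B (commutator C A) + commutator C (commutator A B) = 0"
  by (simp add: commutator_def matrix_diff_ldistrib matrix_diff_rdistrib matrix_mul_assoc)

lemma commutator_conj:
  assumes "Q ** P = mat 1"
  shows "commutator (P ** A ** Q) (P ** B ** Q) = P ** commutator A B ** Q"
proof -
  have "(P ** A ** Q) ** (P ** B ** Q) = P ** (A ** B) ** Q" for A B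
  proof -
    have "(P ** A ** Q) ** (P ** B ** Q) = P ** A ** (Q ** P) ** B ** Q"
      by (simp only: matrix_mul_assoc)
    then show ?thesis by (simp add: assms matrix_mul_assoc)
  qed
  then show ?thesis by (simp add: commutator_def matrix_diff_ldistrib matrix_diff_rdistrib)
qed

definition SL2Z_complex :: "int^2^2 \<Rightarrow> complex^2^2" where
  "SL2Z_complex \<gamma> = map_matrix of_int \<gamma>"

lemma SL2Z_complex_nth [simp]: "SL2Z_complex \<gamma> $ i $ k = of_int (\<gamma> $ i $ k)"
  by (simp add: SL2Z_complex_def)

lemma SL2Z_complex_det:
  assumes "\<gamma> \<in> SL2Z"
  shows "complex_of_int (\<gamma>$1$1) * of_int (\<gamma>$2$2) - of_int (\<gamma>$1$2) * of_int (\<gamma>$2$1) = 1"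
proof -
  have "complex_of_int (\<gamma>$1$1 * \<gamma>$2$2 - \<gamma>$1$2 * \<gamma>$2$1) = 1"
    using assms by (simp only: SL2Z_iff of_int_1)
  then show ?thesis by (simp only: of_int_mult of_int_diff)
qed

text \<open>\<open>matrix_inv\<close> chooses a two-sided inverse, so one has to be exhibited; in
  determinant 1 it is the adjugate.\<close>

lemma SL2Z_complex_inverse:
  assumes "\<gamma> \<in> SL2Z"
  shows "SL2Z_complex \<gamma> ** matrix_inv (SL2Z_complex \<gamma>) = mat 1"
    and "matrix_inv (SL2Z_complex \<gamma>) ** SL2Z_complex \<gamma> = mat 1"
proof -
  let ?G = "SL2Z_complex \<gamma>"
  let ?H = "mat2 (?G$2$2) (- ?G$1$2) (- ?G$2$1) (?G$1$1)"
  have "?G ** ?H = mat 1" "?H ** ?G = mat 1"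
    using SL2Z_complex_det[OF assms] unfolding mat2_1
    by (auto intro!: matrix2_eqI simp: matrix2_mult_nth algebra_simps)
  then have "?G ** matrix_inv ?G = mat 1 \<and> matrix_inv ?G ** ?G = mat 1"
    unfolding matrix_inv_def by (intro someI[of "\<lambda>A'. ?G ** A' = mat 1 \<and> A' ** ?G = mat 1"]) auto
  then show "SL2Z_complex \<gamma> ** matrix_inv (SL2Z_complex \<gamma>) = mat 1"
    and "matrix_inv (SL2Z_complex \<gamma>) ** SL2Z_complex \<gamma> = mat 1" by auto
qed

lemma adjoint_action_eq:
  "adjoint_action \<gamma> A = SL2Z_complex \<gamma> ** A ** matrix_inv (SL2Z_complex \<gamma>)"
  by (simp add: adjoint_action_def SL2Z_complex_def)

lemma adjoint_action_add: "adjoint_action \<gamma> (A + B) = adjoint_action \<gamma> A + adjoint_action \<gamma> B"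
  by (simp add: adjoint_action_eq matrix_add_ldistrib matrix_add_rdistrib)

lemma adjoint_action_smult: "adjoint_action \<gamma> (map_matrix ((*) c) A) = map_matrix ((*) c) (adjoint_action \<gamma> A)"
  by (simp add: adjoint_action_eq matrix_mult_map_times)

lemma adjoint_action_commutator:
  assumes "\<gamma> \<in> SL2Z"
  shows "adjoint_action \<gamma> (commutator A B) = commutator (adjoint_action \<gamma> A) (adjoint_action \<gamma> B)"
  unfolding adjoint_action_eq by (rule commutator_conj[symmetric, OF SL2Z_complex_inverse(2)[OF assms]])

section \<open>Growth of equivariant matrix-valued maps\<close>

lemma cusp_growth_le:
  assumes "cusp_growth g" "\<And>\<tau>. \<tau> \<in> \<H> \<Longrightarrow> norm (f \<tau>) \<le> norm (g \<tau>)"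
  shows "cusp_growth f"
proof -
  obtain K where K: "K \<ge> 1" "\<And>L \<tau>. L \<ge> K \<Longrightarrow> Im \<tau> > L \<Longrightarrow> norm (g \<tau>) \<le> exp (L * cmod \<tau>)"
    using cusp_growthE[OF assms(1)] by blast
  show ?thesis
    by (rule cusp_growthI[of K _ 1 K]) (use K(2)[of K] assms(2) in \<open>force intro: order_trans\<close>)
qed

lemma cusp_growth_cong:
  assumes "\<And>\<tau>. \<tau> \<in> \<H> \<Longrightarrow> f \<tau> = g \<tau>"
  shows "cusp_growth f \<longleftrightarrow> cusp_growth g"
proof
  assume "cusp_growth f"
  then show "cusp_growth g" by (rule cusp_growth_le) (simp add: assms)
next
  assume "cusp_growth g"
  then show "cusp_growth f" by (rule cusp_growth_le) (simp add: assms)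
qed

lemma cusp_growth_matrix_iff:
  "cusp_growth f \<longleftrightarrow> (\<forall>i k. cusp_growth (\<lambda>\<tau>. f \<tau> $ i $ k))" for f :: "complex \<Rightarrow> complex^2^2"
proof
  assume f: "cusp_growth f"
  show "\<forall>i k. cusp_growth (\<lambda>\<tau>. f \<tau> $ i $ k)"
    by (intro allI cusp_growth_le[OF f]) (rule order_trans[OF Finite_Cartesian_Product.norm_nth_le Finite_Cartesian_Product.norm_nth_le])
next
  assume *: "\<forall>i k. cusp_growth (\<lambda>\<tau>. f \<tau> $ i $ k)"
  have norm: "cusp_growth (\<lambda>\<tau>. cmod (f \<tau> $ i $ k))" for i k
    by (rule cusp_growth_le[OF *[rule_format, of i k]]) simp
  show "cusp_growth f"
  proof (rule cusp_growth_le)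
    show "cusp_growth (\<lambda>\<tau>. cmod (f \<tau> $ 1 $ 1) + cmod (f \<tau> $ 1 $ 2) + (cmod (f \<tau> $ 2 $ 1) + cmod (f \<tau> $ 2 $ 2)))"
      by (intro cusp_growth_intros norm)
    fix \<tau>
    have le: "norm (v::'a::real_normed_vector^2) \<le> norm (v$1) + norm (v$2)" for v
      using L2_set_le_sum[of UNIV "\<lambda>i. norm (v$i)"] by (simp add: norm_vec_def sum_2)
    have "norm (f \<tau>) \<le> norm (f \<tau> $ 1) + norm (f \<tau> $ 2)" by (rule le)
    also have "\<dots> \<le> cmod (f \<tau> $ 1 $ 1) + cmod (f \<tau> $ 1 $ 2) + (cmod (f \<tau> $ 2 $ 1) + cmod (f \<tau> $ 2 $ 2))"
      by (intro add_mono le)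
    finally show "norm (f \<tau>) \<le> norm (cmod (f \<tau> $ 1 $ 1) + cmod (f \<tau> $ 1 $ 2) + (cmod (f \<tau> $ 2 $ 1) + cmod (f \<tau> $ 2 $ 2)))"
      by simp
  qed
qed

text \<open>The condition is specialised to the cusp \<open>None\<close> and the identity
  matrix.\<close>

lemma exp_growth_at_cusps_imp_cusp_growth:
  assumes "exp_growth_at_cusps f"
  shows "cusp_growth f"
proof -
  have "int_matrix 1 0 0 1 \<in> SL2Z" by (simp add: SL2Z_iff)
  moreover have "moebius_cusp (int_matrix 1 0 0 1) None = None" by (simp add: moebius_cusp_def)
  moreover have "moebius (int_matrix 1 0 0 1) \<tau> = \<tau>" for \<tau> by (simp add: moebius_def)
  ultimately obtain C M B where "\<And>\<tau>. \<tau> \<in> \<H> \<Longrightarrow> Im \<tau> > B \<Longrightarrow> norm (f \<tau>) < C * exp (M * cmod \<tau>)"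
    using assms unfolding exp_growth_at_cusps_def by metis
  then show ?thesis by (intro cusp_growthI[of B f C M]) (simp add: less_imp_le)
qed

text \<open>By equivariance f(\<tau>) is the image of f(\<gamma>\<tau>) under the fixed linear map X
  \<mapsto> \<gamma>^(-1) X \<gamma>, which is bounded. So the estimate at infinity passes to each
  cusp moved there by \<gamma>, up to a constant factor.\<close>

lemma cusp_growth_imp_exp_growth_at_cusps:
  fixes f :: "complex \<Rightarrow> complex^2^2"
  assumes growth: "cusp_growth f"
    and equiv: "\<And>\<gamma> \<tau>. \<gamma> \<in> SL2Z \<Longrightarrow> \<tau> \<in> \<H> \<Longrightarrow> f (moebius \<gamma> \<tau>) = adjoint_action \<gamma> (f \<tau>)"
  shows "exp_growth_at_cusps f"
  unfolding exp_growth_at_cusps_def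
proof (intro allI ballI impI)
  fix \<gamma> assume \<gamma>: "\<gamma> \<in> SL2Z"
  let ?G = "SL2Z_complex \<gamma>"
  define L where "L X = matrix_inv ?G ** X ** ?G" for X :: "complex^2^2"
  have "linear L"
    by (intro linearI) (simp_all add: L_def vec_eq_iff forall_2 matrix2_mult_nth algebra_simps scaleR_right_distrib)
  then obtain K where K: "\<And>X. norm (L X) \<le> norm X * K"
    using linear_conv_bounded_linear bounded_linear.bounded by blast
  have f_eq: "f \<tau> = L (f (moebius \<gamma> \<tau>))" if "\<tau> \<in> \<H>" for \<tau>
  proof -
    have "L (f (moebius \<gamma> \<tau>)) = (matrix_inv ?G ** ?G) ** f \<tau> ** (matrix_inv ?G ** ?G)"
      unfolding L_def equiv[OF \<gamma> that] adjoint_action_eq by (simp only: matrix_mul_assoc)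
    then show ?thesis by (simp add: SL2Z_complex_inverse[OF \<gamma>])
  qed
  obtain k where k: "k \<ge> 1" "\<And>L \<tau>. L \<ge> k \<Longrightarrow> Im \<tau> > L \<Longrightarrow> norm (f \<tau>) \<le> exp (L * cmod \<tau>)"
    using cusp_growthE[OF growth] by blast
  \<comment> \<open>The summand 1 produces the strict inequality that
    \<open>exp_growth_at_cusps\<close> asks for.\<close>
  have "norm (f \<tau>) < (\<bar>K\<bar> + 1) * exp (k * cmod (moebius \<gamma> \<tau>))"
    if "\<tau> \<in> \<H>" "Im (moebius \<gamma> \<tau>) > k" for \<tau>
  proof -
    have "norm (f \<tau>) \<le> norm (f (moebius \<gamma> \<tau>)) * K" using f_eq[OF that(1)] K by metis
    also have "\<dots> \<le> norm (f (moebius \<gamma> \<tau>)) * \<bar>K\<bar>" by (intro mult_left_mono) auto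
    also have "\<dots> \<le> exp (k * cmod (moebius \<gamma> \<tau>)) * \<bar>K\<bar>" using k(2)[of k] that by (intro mult_right_mono) auto
    also have "\<dots> < exp (k * cmod (moebius \<gamma> \<tau>)) * (\<bar>K\<bar> + 1)" by simp
    finally show ?thesis by (simp only: mult.commute)
  qed
  then show "\<exists>C M B. \<forall>\<tau>\<in>\<H>. B < Im (moebius \<gamma> \<tau>) \<longrightarrow> norm (f \<tau>) < C * exp (M * cmod (moebius \<gamma> \<tau>))"
    by blast
qed

abbreviation sl2_forms :: "(complex, complex \<Rightarrow> complex^2^2) module" where
  "sl2_forms \<equiv> \<MM>\<^sub>0 sl2 SL2Z adjoint_action"

text \<open>It accepts an unrestricted \<open>f\<close> with growth stated entrywise at infinity.
  Since the action preserves \<H>, the restriction inherits equivariance.\<close>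

lemma sl2_formsI:
  assumes "\<And>\<tau>. \<tau> \<in> \<H> \<Longrightarrow> f \<tau> \<in> sl2"
    and "\<And>i k. (\<lambda>\<tau>. f \<tau> $ i $ k) holomorphic_on \<H>"
    and "\<And>\<gamma> \<tau>. \<gamma> \<in> SL2Z \<Longrightarrow> \<tau> \<in> \<H> \<Longrightarrow> f (moebius \<gamma> \<tau>) = adjoint_action \<gamma> (f \<tau>)"
    and "\<And>i k. cusp_growth (\<lambda>\<tau>. f \<tau> $ i $ k)"
  shows "restrict f \<H> \<in> carrier sl2_forms"
proof -
  have eq: "restrict f \<H> (moebius \<gamma> \<tau>) = adjoint_action \<gamma> (restrict f \<H> \<tau>)" if "\<gamma> \<in> SL2Z" "\<tau> \<in> \<H>" for \<gamma> \<tau>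
    using assms(3)[OF that] moebius_upper_half_plane[OF that] that by simp
  have "cusp_growth (restrict f \<H>)"
    using cusp_growth_cong[of f "restrict f \<H>"] assms(4) cusp_growth_matrix_iff[of f] by simp
  then have "exp_growth_at_cusps (restrict f \<H>)"
    by (rule cusp_growth_imp_exp_growth_at_cusps) (rule eq)
  moreover have "(\<lambda>\<tau>. restrict f \<H> \<tau> $ i $ k) holomorphic_on \<H>" for i k
    by (rule holomorphic_transform[OF assms(2)]) simp
  ultimately show ?thesis
    using assms(1) eq by (simp add: equivariant_lie_algebra_def)
qed

lemma sl2_formsD:
  assumes "f \<in> carrier sl2_forms"
  shows "f \<in> extensional \<H>" "\<And>\<tau>. \<tau> \<in> \<H> \<Longrightarrow> f \<tau> \<in> sl2"
    and "\<And>i k. (\<lambda>\<tau>. f \<tau> $ i $ k) holomorphic_on \<H>"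
    and "\<And>\<gamma> \<tau>. \<gamma> \<in> SL2Z \<Longrightarrow> \<tau> \<in> \<H> \<Longrightarrow> f (moebius \<gamma> \<tau>) = adjoint_action \<gamma> (f \<tau>)"
    and "\<And>i k. cusp_growth (\<lambda>\<tau>. f \<tau> $ i $ k)"
  using assms exp_growth_at_cusps_imp_cusp_growth[of f] cusp_growth_matrix_iff[of f]
  by (auto simp: equivariant_lie_algebra_def PiE_def)

lemma sl2_forms_simps:
  "x \<otimes>\<^bsub>sl2_forms\<^esub> y = (\<lambda>\<tau>\<in>\<H>. commutator (x \<tau>) (y \<tau>))"
  "\<zero>\<^bsub>sl2_forms\<^esub> = (\<lambda>\<tau>\<in>\<H>. 0)"
  "x \<oplus>\<^bsub>sl2_forms\<^esub> y = (\<lambda>\<tau>\<in>\<H>. x \<tau> + y \<tau>)"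
  "c \<odot>\<^bsub>sl2_forms\<^esub> x = (\<lambda>\<tau>\<in>\<H>. map_matrix ((*) c) (x \<tau>))"
  by (simp_all add: equivariant_lie_algebra_def commutator_def)

lemma trace_2: "trace (A :: 'a::semiring_1^2^2) = A$1$1 + A$2$2"
  by (simp add: trace_def sum_2)

lemma sl2_forms_closed:
  assumes x: "x \<in> carrier sl2_forms" and y: "y \<in> carrier sl2_forms"
  shows "x \<otimes>\<^bsub>sl2_forms\<^esub> y \<in> carrier sl2_forms"
    and "x \<oplus>\<^bsub>sl2_forms\<^esub> y \<in> carrier sl2_forms"
    and "c \<odot>\<^bsub>sl2_forms\<^esub> x \<in> carrier sl2_forms"
proof -
  note xD = sl2_formsD[OF x] and yD = sl2_formsD[OF y]
  show "x \<otimes>\<^bsub>sl2_forms\<^esub> y \<in> carrier sl2_forms" unfolding sl2_forms_simps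
  proof (rule sl2_formsI)
    show "commutator (x \<tau>) (y \<tau>) \<in> sl2" for \<tau>
      by (simp add: sl2_def commutator_def trace_2 matrix2_mult_nth)
    show "commutator (x (moebius \<gamma> \<tau>)) (y (moebius \<gamma> \<tau>)) = adjoint_action \<gamma> (commutator (x \<tau>) (y \<tau>))"
      if "\<gamma> \<in> SL2Z" "\<tau> \<in> \<H>" for \<gamma> \<tau>
      using that by (simp add: xD yD adjoint_action_commutator)
  qed (auto simp: commutator_def matrix2_mult_nth intro!: holomorphic_intros cusp_growth_intros xD yD)
  show "x \<oplus>\<^bsub>sl2_forms\<^esub> y \<in> carrier sl2_forms" unfolding sl2_forms_simps
  proof (rule sl2_formsI)
    show "x \<tau> + y \<tau> \<in> sl2" if "\<tau> \<in> \<H>" for \<tau>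
      using xD(2)[OF that] yD(2)[OF that] by (simp add: sl2_def trace_2 algebra_simps)
  qed (auto simp: xD(4) yD(4) adjoint_action_add intro!: holomorphic_intros cusp_growth_intros xD yD)
  show "c \<odot>\<^bsub>sl2_forms\<^esub> x \<in> carrier sl2_forms" unfolding sl2_forms_simps
  proof (rule sl2_formsI)
    show "map_matrix ((*) c) (x \<tau>) \<in> sl2" if "\<tau> \<in> \<H>" for \<tau>
      using xD(2)[OF that] by (simp add: sl2_def trace_2 flip: distrib_left)
  qed (auto simp: xD(4) adjoint_action_smult intro!: holomorphic_intros cusp_growth_intros xD)
qed

lemma complex_ring_cring: "cring complex_ring"
proof (rule cringI)
  show "abelian_group complex_ring"
    by (rule abelian_groupI) (auto simp: complex_ring_def intro: exI[of _ "- _"] simp: add.left_inverse)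
  show "comm_monoid complex_ring"
    by (rule comm_monoidI) (auto simp: complex_ring_def)
qed (auto simp: complex_ring_def distrib_right)

lemma sl2_forms_lie_algebra: "complex_lie_algebra sl2_forms"
proof -
  \<comment> \<open>Equality in the algebra is equality of functions on all of \<complex>, so the
    laws 0 + x = x and 1 x = x rest on extensionality.\<close>
  have ext: "(\<lambda>\<tau>\<in>\<H>. x \<tau>) = x" if "x \<in> carrier sl2_forms" for x
    using sl2_formsD(1)[OF that] by (rule extensional_restrict)
  have group: "abelian_group sl2_forms"
  proof (rule abelian_groupI)
    fix x assume x: "x \<in> carrier sl2_forms"
    have "(- 1) \<odot>\<^bsub>sl2_forms\<^esub> x \<oplus>\<^bsub>sl2_forms\<^esub> x = \<zero>\<^bsub>sl2_forms\<^esub>"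
      unfolding sl2_forms_simps by (rule restrict_ext) (simp add: vec_eq_iff)
    then show "\<exists>y\<in>carrier sl2_forms. y \<oplus>\<^bsub>sl2_forms\<^esub> x = \<zero>\<^bsub>sl2_forms\<^esub>"
      using sl2_forms_closed(3)[OF x x] by blast
    show "\<zero>\<^bsub>sl2_forms\<^esub> \<oplus>\<^bsub>sl2_forms\<^esub> x = x"
      unfolding sl2_forms_simps by (subst (2) ext[OF x, symmetric]) (rule restrict_ext, simp)
  next
    show "\<zero>\<^bsub>sl2_forms\<^esub> \<in> carrier sl2_forms" unfolding sl2_forms_simps
    proof (rule sl2_formsI)
      show "0 = adjoint_action \<gamma> 0" for \<gamma>
        by (rule matrix2_eqI) (simp_all add: adjoint_action_eq matrix2_mult_nth)
    qed (auto simp: sl2_def trace_2 intro!: cusp_growth_intros)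
  qed (use sl2_forms_closed in \<open>auto simp: sl2_forms_simps add_ac intro!: restrict_ext\<close>)
  have "Module.module complex_ring sl2_forms"
  proof (rule moduleI[OF complex_ring_cring group])
    show "\<one>\<^bsub>complex_ring\<^esub> \<odot>\<^bsub>sl2_forms\<^esub> x = x" if "x \<in> carrier sl2_forms" for x
      unfolding sl2_forms_simps complex_ring_def
      by (subst (2) ext[OF that, symmetric]) (rule restrict_ext, simp add: vec_eq_iff)
  qed (use sl2_forms_closed in \<open>auto simp: sl2_forms_simps complex_ring_def vec_eq_iff algebra_simps intro!: restrict_ext\<close>)
  then show ?thesis
    unfolding complex_lie_algebra_def complex_lie_algebra_axioms_def
    by (auto simp: sl2_forms_closed)
      (auto simp: sl2_forms_simps commutator_bilinear commutator_self commutator_jacobi intro!: restrict_ext)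
qed

section \<open>An equivariant frame\<close>

text \<open>This is \<pi> i / 6 times the quasimodular Eisenstein series E_2. Division by the weight
  12 normalises the anomaly under \<gamma> to exactly c J.\<close>

definition log_deriv_Delta :: "complex \<Rightarrow> complex" where
  "log_deriv_Delta \<tau> = deriv modular_Delta \<tau> / (12 * modular_Delta \<tau>)"

lemma log_deriv_Delta_holomorphic: "log_deriv_Delta holomorphic_on \<H>"
  unfolding log_deriv_Delta_def [abs_def] using modular_Delta_nonzero
  by (intro holomorphic_intros holomorphic_deriv modular_Delta_holomorphic open_upper_half_plane) auto

lemma cusp_growth_log_deriv_Delta [cusp_growth_intros]: "cusp_growth log_deriv_Delta"
proof -
  obtain A where A: "A holomorphic_on ball 0 1" "\<And>q. q \<in> ball 0 1 \<Longrightarrow> A q \<noteq> 0"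
    "\<And>\<tau>. \<tau> \<in> \<H> \<Longrightarrow> modular_Delta \<tau> = nome \<tau> * A (nome \<tau>)"
    using modular_Delta_q_expansion_nonzero by blast
  obtain B where B: "B holomorphic_on ball 0 1" "\<And>\<tau>. \<tau> \<in> \<H> \<Longrightarrow> deriv modular_Delta \<tau> = nome \<tau> * B (nome \<tau>)"
    using deriv_q_expansion[OF A(1,3)] by blast
  have "(\<lambda>q. B q / (12 * A q)) holomorphic_on ball 0 1"
    using A by (intro holomorphic_intros B) auto
  then show ?thesis
    by (rule cusp_growth_q_expansion) (simp add: log_deriv_Delta_def A(3) B(2))
qed

lemma log_deriv_Delta_modular:
  assumes "\<gamma> \<in> SL2Z" "\<tau> \<in> \<H>"
  shows "log_deriv_Delta (moebius \<gamma> \<tau>) =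
    cocycle \<gamma> \<tau> ^ 2 * log_deriv_Delta \<tau> + of_int (\<gamma>$2$1) * cocycle \<gamma> \<tau>"
proof -
  define J where "J = cocycle \<gamma> \<tau>"
  define c where "c = complex_of_int (\<gamma>$2$1)"
  have J: "J \<noteq> 0" using cocycle_SL2Z_nonzero[OF assms] by (simp add: J_def)
  have D: "modular_Delta \<tau> \<noteq> 0" by (rule modular_Delta_nonzero[OF assms(2)])
  have "deriv modular_Delta (moebius \<gamma> \<tau>) = J ^ 12 * (J ^ 2 * deriv modular_Delta \<tau> + 12 * c * J * modular_Delta \<tau>)"
    using deriv_modular_form[OF modular_Delta_holomorphic modular_Delta_modular[OF assms(1)] assms]
    by (simp add: J_def c_def distrib_left eval_nat_numeral mult_ac)
  then have "log_deriv_Delta (moebius \<gamma> \<tau>) =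
      (J ^ 2 * deriv modular_Delta \<tau> + 12 * c * J * modular_Delta \<tau>) / (12 * modular_Delta \<tau>)"
    using J by (simp add: log_deriv_Delta_def modular_Delta_modular[OF assms] J_def)
  also have "\<dots> = J ^ 2 * log_deriv_Delta \<tau> + c * J"
    using D by (simp add: log_deriv_Delta_def add_divide_distrib)
  finally show ?thesis by (simp add: J_def c_def)
qed

text \<open>The columns of the frame are \<open>u = (\<tau>, 1)\<close> and \<open>u' + (\<Delta>'/12\<Delta>) u\<close>. They satisfy
  \<open>\<gamma> u(\<tau>) = J u(\<gamma>\<tau>)\<close> and, because \<open>\<Delta>'/12\<Delta>\<close> is quasimodular of weight 2, \<open>\<gamma> v(\<tau>) = J\<^sup>-\<^sup>1 v(\<gamma>\<tau>)\<close>.\<close>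

definition frame :: "complex \<Rightarrow> complex^2^2" where
  "frame \<tau> = mat2 \<tau> (1 + \<tau> * log_deriv_Delta \<tau>) 1 (log_deriv_Delta \<tau>)"

definition coframe :: "complex \<Rightarrow> complex^2^2" where
  "coframe \<tau> = mat2 (- log_deriv_Delta \<tau>) (1 + \<tau> * log_deriv_Delta \<tau>) 1 (- \<tau>)"

lemma frame_coframe: "frame \<tau> ** coframe \<tau> = mat 1" "coframe \<tau> ** frame \<tau> = mat 1"
  by (simp_all add: frame_def coframe_def mat2_mult mat2_1 algebra_simps)

definition weights_matrix :: "complex \<Rightarrow> complex^2^2" where
  "weights_matrix J = mat2 J 0 0 (inverse J)"

lemma weights_matrix_inverse:
  "J \<noteq> 0 \<Longrightarrow> weights_matrix J ** weights_matrix (inverse J) = mat 1"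
  by (simp add: weights_matrix_def mat2_mult mat2_1)

lemma frame_equivariant:
  assumes "\<gamma> \<in> SL2Z" "\<tau> \<in> \<H>"
  shows "SL2Z_complex \<gamma> ** frame \<tau> = frame (moebius \<gamma> \<tau>) ** weights_matrix (cocycle \<gamma> \<tau>)"
proof -
  define a b c d where "a = complex_of_int (\<gamma>$1$1)" and "b = complex_of_int (\<gamma>$1$2)"
    and "c = complex_of_int (\<gamma>$2$1)" and "d = complex_of_int (\<gamma>$2$2)"
  define J L where "J = c * \<tau> + d" and "L = log_deriv_Delta \<tau>"
  have J: "J \<noteq> 0" "cocycle \<gamma> \<tau> = J"
    using cocycle_SL2Z_nonzero[OF assms] by (simp_all add: J_def cocycle_def c_def d_def)
  have det: "a * d = 1 + b * c" using SL2Z_complex_det[OF assms(1)] by (simp add: a_def b_def c_def d_def algebra_simps)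
  have G: "SL2Z_complex \<gamma> = mat2 a b c d"
    by (rule matrix2_eqI) (simp_all add: a_def b_def c_def d_def)
  have m: "moebius \<gamma> \<tau> * J = a * \<tau> + b" "moebius \<gamma> \<tau> = (a * \<tau> + b) / J"
    using J by (simp_all add: moebius_eq a_def b_def)
  have L': "log_deriv_Delta (moebius \<gamma> \<tau>) = J ^ 2 * L + c * J"
    using log_deriv_Delta_modular[OF assms] by (simp add: J(2) L_def c_def)
  \<comment> \<open>The determinant condition in the form that makes the upper right entries agree:
    a J = a c \<tau> + a d with a d = 1 + b c.\<close>
  have aJ: "a * J = 1 + c * (a * \<tau> + b)"
    using det by (simp add: J_def algebra_simps)
  have "(1 + moebius \<gamma> \<tau> * (J ^ 2 * L + c * J)) * inverse J = (1 + (moebius \<gamma> \<tau> * J) * (J * L + c)) * inverse J"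
    by (simp add: power2_eq_square algebra_simps)
  also have "\<dots> = ((a * J) + (a * \<tau> + b) * (J * L)) * inverse J"
    unfolding m(1) aJ by (simp add: algebra_simps)
  also have "\<dots> = a + (a * \<tau> + b) * L" using J by (simp add: field_simps)
  finally have e12: "a * (1 + \<tau> * L) + b * L = (1 + moebius \<gamma> \<tau> * (J ^ 2 * L + c * J)) * inverse J"
    by (simp add: algebra_simps)
  have e22: "c * (1 + \<tau> * L) + d * L = (J ^ 2 * L + c * J) * inverse J"
    using J by (simp add: field_simps power2_eq_square) (simp add: J_def algebra_simps)
  show ?thesis
    unfolding G frame_def weights_matrix_def mat2_mult J(2) L' L_def [symmetric]
    using e12 e22 m(1) by (simp add: J_def)
qed

text \<open>The inverse of the relation for the frame, obtained by inserting the identity in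
  factored form at \<gamma>\<tau>.\<close>

lemma coframe_equivariant:
  assumes "\<gamma> \<in> SL2Z" "\<tau> \<in> \<H>"
  shows "coframe \<tau> ** matrix_inv (SL2Z_complex \<gamma>) =
    weights_matrix (inverse (cocycle \<gamma> \<tau>)) ** coframe (moebius \<gamma> \<tau>)"
proof -
  let ?G = "SL2Z_complex \<gamma>" and ?D = "weights_matrix (cocycle \<gamma> \<tau>)"
    and ?D' = "weights_matrix (inverse (cocycle \<gamma> \<tau>))"
  have DD: "?D ** ?D' = mat 1"
    by (rule weights_matrix_inverse[OF cocycle_SL2Z_nonzero[OF assms]])
  have "coframe \<tau> ** matrix_inv ?G = coframe \<tau> ** matrix_inv ?G ** (frame (moebius \<gamma> \<tau>) ** (?D ** ?D') ** coframe (moebius \<gamma> \<tau>))"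
    by (simp add: DD frame_coframe)
  also have "\<dots> = coframe \<tau> ** matrix_inv ?G ** (frame (moebius \<gamma> \<tau>) ** ?D) ** (?D' ** coframe (moebius \<gamma> \<tau>))"
    by (simp only: matrix_mul_assoc)
  also have "\<dots> = coframe \<tau> ** (matrix_inv ?G ** ?G) ** frame \<tau> ** (?D' ** coframe (moebius \<gamma> \<tau>))"
    unfolding frame_equivariant[OF assms, symmetric] by (simp only: matrix_mul_assoc)
  also have "\<dots> = ?D' ** coframe (moebius \<gamma> \<tau>)"
    by (simp add: SL2Z_complex_inverse[OF assms(1)] frame_coframe)
  finally show ?thesis .
qed

lemma adjoint_action_frame:
  assumes "\<gamma> \<in> SL2Z" "\<tau> \<in> \<H>"
  shows "adjoint_action \<gamma> (frame \<tau> ** A ** coframe \<tau>) = frame (moebius \<gamma> \<tau>) **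
    (weights_matrix (cocycle \<gamma> \<tau>) ** A ** weights_matrix (inverse (cocycle \<gamma> \<tau>))) ** coframe (moebius \<gamma> \<tau>)"
proof -
  have "adjoint_action \<gamma> (frame \<tau> ** A ** coframe \<tau>) =
      (SL2Z_complex \<gamma> ** frame \<tau>) ** A ** (coframe \<tau> ** matrix_inv (SL2Z_complex \<gamma>))"
    unfolding adjoint_action_eq by (simp only: matrix_mul_assoc)
  then show ?thesis
    unfolding frame_equivariant[OF assms] coframe_equivariant[OF assms] by (simp only: matrix_mul_assoc)
qed

lemma conj_weights_matrix:
  "J \<noteq> 0 \<Longrightarrow> weights_matrix J ** A ** weights_matrix (inverse J)
    = mat2 (A$1$1) (J ^ 2 * A$1$2) (inverse J ^ 2 * A$2$1) (A$2$2)"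
  by (rule matrix2_eqI) (simp_all add: weights_matrix_def matrix2_mult_nth power2_eq_square)

lemma frame_nth_holomorphic: "(\<lambda>\<tau>. frame \<tau> $ i $ k) holomorphic_on \<H>"
  using exhaust_2[of i] exhaust_2[of k]
  by (auto simp: frame_def intro!: holomorphic_intros log_deriv_Delta_holomorphic)

lemma coframe_nth_holomorphic: "(\<lambda>\<tau>. coframe \<tau> $ i $ k) holomorphic_on \<H>"
  using exhaust_2[of i] exhaust_2[of k]
  by (auto simp: coframe_def intro!: holomorphic_intros log_deriv_Delta_holomorphic)

lemma cusp_growth_frame_nth: "cusp_growth (\<lambda>\<tau>. frame \<tau> $ i $ k)"
  using exhaust_2[of i] exhaust_2[of k] by (auto simp: frame_def intro!: cusp_growth_intros)

lemma cusp_growth_coframe_nth: "cusp_growth (\<lambda>\<tau>. coframe \<tau> $ i $ k)"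
  using exhaust_2[of i] exhaust_2[of k] by (auto simp: coframe_def intro!: cusp_growth_intros)

section \<open>Coordinates of equivariant maps in the frame\<close>

definition frame_form :: "(complex \<Rightarrow> complex^2^2) \<Rightarrow> complex \<Rightarrow> complex^2^2" where
  "frame_form A = (\<lambda>\<tau>\<in>\<H>. frame \<tau> ** A \<tau> ** coframe \<tau>)"

lemma frame_form_in_sl2_forms:
  assumes sl2: "\<And>\<tau>. \<tau> \<in> \<H> \<Longrightarrow> A \<tau> $ 2 $ 2 = - A \<tau> $ 1 $ 1"
    and hol: "\<And>i k. (\<lambda>\<tau>. A \<tau> $ i $ k) holomorphic_on \<H>"
    and growth: "\<And>i k. cusp_growth (\<lambda>\<tau>. A \<tau> $ i $ k)"
    and mod: "\<And>\<gamma> \<tau>. \<gamma> \<in> SL2Z \<Longrightarrow> \<tau> \<in> \<H> \<Longrightarrow> A (moebius \<gamma> \<tau>) $ 1 $ 1 = A \<tau> $ 1 $ 1"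
      "\<And>\<gamma> \<tau>. \<gamma> \<in> SL2Z \<Longrightarrow> \<tau> \<in> \<H> \<Longrightarrow> A (moebius \<gamma> \<tau>) $ 1 $ 2 = cocycle \<gamma> \<tau> ^ 2 * A \<tau> $ 1 $ 2"
      "\<And>\<gamma> \<tau>. \<gamma> \<in> SL2Z \<Longrightarrow> \<tau> \<in> \<H> \<Longrightarrow> cocycle \<gamma> \<tau> ^ 2 * A (moebius \<gamma> \<tau>) $ 2 $ 1 = A \<tau> $ 2 $ 1"
  shows "frame_form A \<in> carrier sl2_forms"
  unfolding frame_form_def
proof (rule sl2_formsI)
  show "frame \<tau> ** A \<tau> ** coframe \<tau> \<in> sl2" if "\<tau> \<in> \<H>" for \<tau>
  proof -
    have "trace (frame \<tau> ** A \<tau> ** coframe \<tau>) = trace (coframe \<tau> ** (frame \<tau> ** A \<tau>))"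
      by (rule trace_mul_sym)
    also have "\<dots> = 0" by (simp add: matrix_mul_assoc frame_coframe trace_2 sl2[OF that])
    finally show ?thesis by (simp add: sl2_def)
  qed
  show "frame (moebius \<gamma> \<tau>) ** A (moebius \<gamma> \<tau>) ** coframe (moebius \<gamma> \<tau>) =
      adjoint_action \<gamma> (frame \<tau> ** A \<tau> ** coframe \<tau>)" if "\<gamma> \<in> SL2Z" "\<tau> \<in> \<H>" for \<gamma> \<tau>
  proof -
    have J: "cocycle \<gamma> \<tau> \<noteq> 0" by (rule cocycle_SL2Z_nonzero[OF that])
    have "weights_matrix (cocycle \<gamma> \<tau>) ** A \<tau> ** weights_matrix (inverse (cocycle \<gamma> \<tau>)) = A (moebius \<gamma> \<tau>)"
      unfolding conj_weights_matrix[OF J]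
    proof (rule matrix2_eqI)
      have "A \<tau> $ 2 $ 1 = cocycle \<gamma> \<tau> ^ 2 * A (moebius \<gamma> \<tau>) $ 2 $ 1" using mod(3)[OF that] by simp
      then show "mat2 (A \<tau>$1$1) (cocycle \<gamma> \<tau> ^ 2 * A \<tau>$1$2) (inverse (cocycle \<gamma> \<tau>) ^ 2 * A \<tau>$2$1) (A \<tau>$2$2) $ 2 $ 1
          = A (moebius \<gamma> \<tau>) $ 2 $ 1"
        using J by (simp add: field_simps)
    qed (simp_all add: mod(1,2)[OF that] sl2 that moebius_upper_half_plane)
    then show ?thesis unfolding adjoint_action_frame[OF that] by simp
  qed
qed (auto simp: matrix2_mult_nth intro!: holomorphic_intros cusp_growth_intros hol growth
    frame_nth_holomorphic coframe_nth_holomorphic cusp_growth_frame_nth cusp_growth_coframe_nth)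

text \<open>The coordinates are \<open>coframe \<tau> ** f \<tau> ** frame \<tau>\<close>. All
  entries of both frames, including \<tau> itself, are holomorphic with \<open>cusp_growth\<close>,
  so regularity passes to the coordinates, while equivariance becomes conjugation by
  \<open>weights_matrix\<close>.\<close>

lemma sl2_forms_frame_coordinates:
  assumes f: "f \<in> carrier sl2_forms"
  obtains A where "f = frame_form A" "\<And>\<tau>. \<tau> \<in> \<H> \<Longrightarrow> A \<tau> $ 2 $ 2 = - A \<tau> $ 1 $ 1"
    "\<And>i k. (\<lambda>\<tau>. A \<tau> $ i $ k) holomorphic_on \<H>" "\<And>i k. cusp_growth (\<lambda>\<tau>. A \<tau> $ i $ k)"
    "\<And>\<gamma> \<tau>. \<gamma> \<in> SL2Z \<Longrightarrow> \<tau> \<in> \<H> \<Longrightarrow> A (moebius \<gamma> \<tau>) $ 1 $ 1 = A \<tau> $ 1 $ 1"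
    "\<And>\<gamma> \<tau>. \<gamma> \<in> SL2Z \<Longrightarrow> \<tau> \<in> \<H> \<Longrightarrow> A (moebius \<gamma> \<tau>) $ 1 $ 2 = cocycle \<gamma> \<tau> ^ 2 * A \<tau> $ 1 $ 2"
    "\<And>\<gamma> \<tau>. \<gamma> \<in> SL2Z \<Longrightarrow> \<tau> \<in> \<H> \<Longrightarrow> cocycle \<gamma> \<tau> ^ 2 * A (moebius \<gamma> \<tau>) $ 2 $ 1 = A \<tau> $ 2 $ 1"
proof -
  note fD = sl2_formsD[OF f]
  define A where "A \<tau> = coframe \<tau> ** f \<tau> ** frame \<tau>" for \<tau>
  have f_eq: "f \<tau> = frame \<tau> ** A \<tau> ** coframe \<tau>" for \<tau>
  proof -
    have "frame \<tau> ** A \<tau> ** coframe \<tau> = (frame \<tau> ** coframe \<tau>) ** f \<tau> ** (frame \<tau> ** coframe \<tau>)"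
      unfolding A_def by (simp only: matrix_mul_assoc)
    then show ?thesis by (simp add: frame_coframe)
  qed
  have A_moebius: "A (moebius \<gamma> \<tau>) = mat2 (A \<tau> $1$1) (cocycle \<gamma> \<tau> ^ 2 * A \<tau> $1$2)
      (inverse (cocycle \<gamma> \<tau>) ^ 2 * A \<tau> $2$1) (A \<tau> $2$2)" if "\<gamma> \<in> SL2Z" "\<tau> \<in> \<H>" for \<gamma> \<tau>
  proof -
    let ?m = "moebius \<gamma> \<tau>" and ?B = "weights_matrix (cocycle \<gamma> \<tau>) ** A \<tau> ** weights_matrix (inverse (cocycle \<gamma> \<tau>))"
    have "A ?m = coframe ?m ** (frame ?m ** ?B ** coframe ?m) ** frame ?m"
      unfolding A_def[of ?m] fD(4)[OF that] f_eq[of \<tau>] adjoint_action_frame[OF that] by (rule refl)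
    also have "\<dots> = (coframe ?m ** frame ?m) ** ?B ** (coframe ?m ** frame ?m)"
      by (simp only: matrix_mul_assoc)
    finally show ?thesis
      by (simp add: frame_coframe conj_weights_matrix[OF cocycle_SL2Z_nonzero[OF that]])
  qed
  show ?thesis
  proof (rule that[of A])
    show "f = frame_form A"
    proof
      fix \<tau>
      show "f \<tau> = frame_form A \<tau>"
        using extensional_arb[OF fD(1), of \<tau>] f_eq[of \<tau>] by (simp add: frame_form_def)
    qed
    show "A \<tau> $ 2 $ 2 = - A \<tau> $ 1 $ 1" if "\<tau> \<in> \<H>" for \<tau>
    proof -
      have "trace (A \<tau>) = trace (frame \<tau> ** (coframe \<tau> ** f \<tau>))"
        unfolding A_def by (rule trace_mul_sym)
      also have "\<dots> = 0" using fD(2)[OF that] by (simp add: matrix_mul_assoc frame_coframe sl2_def)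
      finally show ?thesis by (simp add: trace_2 eq_neg_iff_add_eq_0 add.commute)
    qed
    show "(\<lambda>\<tau>. A \<tau> $ i $ k) holomorphic_on \<H>" for i k
      unfolding A_def matrix2_mult_nth
      by (intro holomorphic_intros fD frame_nth_holomorphic coframe_nth_holomorphic)
    show "cusp_growth (\<lambda>\<tau>. A \<tau> $ i $ k)" for i k
      unfolding A_def matrix2_mult_nth
      by (intro cusp_growth_intros fD cusp_growth_frame_nth cusp_growth_coframe_nth)
    show "A (moebius \<gamma> \<tau>) $ 1 $ 1 = A \<tau> $ 1 $ 1"
      "A (moebius \<gamma> \<tau>) $ 1 $ 2 = cocycle \<gamma> \<tau> ^ 2 * A \<tau> $ 1 $ 2"
      "cocycle \<gamma> \<tau> ^ 2 * A (moebius \<gamma> \<tau>) $ 2 $ 1 = A \<tau> $ 2 $ 1" if "\<gamma> \<in> SL2Z" "\<tau> \<in> \<H>" for \<gamma> \<tau>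
      unfolding A_moebius[OF that] using cocycle_SL2Z_nonzero[OF that]
      by (simp_all add: field_simps)
  qed
qed

lemma frame_form_inject:
  assumes "frame_form A = frame_form B" "\<tau> \<in> \<H>"
  shows "A \<tau> = B \<tau>"
proof -
  have "frame \<tau> ** A \<tau> ** coframe \<tau> = frame \<tau> ** B \<tau> ** coframe \<tau>"
    using fun_cong[OF assms(1), of \<tau>] assms(2) by (simp add: frame_form_def)
  then have "coframe \<tau> ** (frame \<tau> ** A \<tau> ** coframe \<tau>) ** frame \<tau> =
      coframe \<tau> ** (frame \<tau> ** B \<tau> ** coframe \<tau>) ** frame \<tau>" by simp
  moreover have "coframe \<tau> ** (frame \<tau> ** C ** coframe \<tau>) ** frame \<tau> = C" for C
  proof -
    have "coframe \<tau> ** (frame \<tau> ** C ** coframe \<tau>) ** frame \<tau> =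
        (coframe \<tau> ** frame \<tau>) ** C ** (coframe \<tau> ** frame \<tau>)" by (simp only: matrix_mul_assoc)
    then show ?thesis by (simp add: frame_coframe)
  qed
  ultimately show ?thesis by simp
qed

section \<open>The isomorphism\<close>

definition j_poly :: "complex poly \<Rightarrow> complex \<Rightarrow> complex" where
  "j_poly p = (\<lambda>\<tau>\<in>\<H>. poly p (klein_j \<tau>))"

lemma polys_in_j_eq: "\<complex>[j] = range j_poly"
  by (simp add: polys_in_j_def j_poly_def [abs_def])

lemma j_poly_ops:
  "(\<lambda>\<tau>\<in>\<H>. j_poly p \<tau> + j_poly q \<tau>) = j_poly (p + q)"
  "(\<lambda>\<tau>\<in>\<H>. c * j_poly p \<tau>) = j_poly (Polynomial.smult c p)"
  "(\<lambda>\<tau>\<in>\<H>. 0) = j_poly 0"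
  by (auto simp: j_poly_def fun_eq_iff)

lemma j_poly_holomorphic: "j_poly p holomorphic_on \<H>"
  by (rule holomorphic_transform[OF poly_klein_j_holomorphic]) (simp add: j_poly_def)

lemma cusp_growth_j_poly: "cusp_growth (j_poly p)"
  using cusp_growth_cong[of "j_poly p" "\<lambda>\<tau>. poly p (klein_j \<tau>)"] cusp_growth_poly_klein_j
  by (simp add: j_poly_def)

lemma j_poly_modular: "\<gamma> \<in> SL2Z \<Longrightarrow> \<tau> \<in> \<H> \<Longrightarrow> j_poly p (moebius \<gamma> \<tau>) = j_poly p \<tau>"
  by (simp add: j_poly_def klein_j_modular moebius_upper_half_plane)

lemma hef_carrier: "carrier hef_lie_algebra = {x. \<forall>a. x a \<in> range j_poly}"
  by (simp add: hef_lie_algebra_def polys_in_j_eq)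

lemma hef_carrierE:
  assumes "x \<in> carrier hef_lie_algebra"
  obtains p where "x = (\<lambda>a. j_poly (p a))"
  using assms that unfolding hef_carrier image_iff by (auto simp: fun_eq_iff) metis

lemma hef_carrierI: "(\<And>a. x a \<in> range j_poly) \<Longrightarrow> x \<in> carrier hef_lie_algebra"
  by (simp add: hef_carrier)

lemma hef_simps:
  "\<zero>\<^bsub>hef_lie_algebra\<^esub> = (\<lambda>k. \<lambda>\<tau>\<in>\<H>. 0)"
  "x \<oplus>\<^bsub>hef_lie_algebra\<^esub> y = (\<lambda>k. \<lambda>\<tau>\<in>\<H>. x k \<tau> + y k \<tau>)"
  "c \<odot>\<^bsub>hef_lie_algebra\<^esub> x = (\<lambda>k. \<lambda>\<tau>\<in>\<H>. c * x k \<tau>)"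
  by (simp_all add: hef_lie_algebra_def)

lemma hef_bracket:
  "(x \<otimes>\<^bsub>hef_lie_algebra\<^esub> y) Bas_h =
    (\<lambda>\<tau>\<in>\<H>. klein_j \<tau> * (klein_j \<tau> - 1728) * (x Bas_e \<tau> * y Bas_f \<tau> - x Bas_f \<tau> * y Bas_e \<tau>))"
  "(x \<otimes>\<^bsub>hef_lie_algebra\<^esub> y) Bas_e = (\<lambda>\<tau>\<in>\<H>. 2 * (x Bas_h \<tau> * y Bas_e \<tau> - x Bas_e \<tau> * y Bas_h \<tau>))"
  "(x \<otimes>\<^bsub>hef_lie_algebra\<^esub> y) Bas_f = (\<lambda>\<tau>\<in>\<H>. 2 * (x Bas_f \<tau> * y Bas_h \<tau> - x Bas_h \<tau> * y Bas_f \<tau>))"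
  by (simp_all add: hef_lie_algebra_def UNIV_hef basis_vec_def algebra_simps)

lemma hef_ext: "f Bas_h = g Bas_h \<Longrightarrow> f Bas_e = g Bas_e \<Longrightarrow> f Bas_f = g Bas_f \<Longrightarrow> f = g"
  by (rule ext, rule hef.induct) auto

lemma hef_closed:
  assumes x: "x \<in> carrier hef_lie_algebra" and y: "y \<in> carrier hef_lie_algebra"
  shows "x \<otimes>\<^bsub>hef_lie_algebra\<^esub> y \<in> carrier hef_lie_algebra"
    and "x \<oplus>\<^bsub>hef_lie_algebra\<^esub> y \<in> carrier hef_lie_algebra"
    and "c \<odot>\<^bsub>hef_lie_algebra\<^esub> x \<in> carrier hef_lie_algebra"
proof -
  obtain p where p: "x = (\<lambda>a. j_poly (p a))" using x by (rule hef_carrierE)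
  obtain q where q: "y = (\<lambda>a. j_poly (q a))" using y by (rule hef_carrierE)
  have "(x \<otimes>\<^bsub>hef_lie_algebra\<^esub> y) Bas_h =
      j_poly ([:0, 1:] * [:- 1728, 1:] * (p Bas_e * q Bas_f - p Bas_f * q Bas_e))"
    "(x \<otimes>\<^bsub>hef_lie_algebra\<^esub> y) Bas_e = j_poly (Polynomial.smult 2 (p Bas_h * q Bas_e - p Bas_e * q Bas_h))"
    "(x \<otimes>\<^bsub>hef_lie_algebra\<^esub> y) Bas_f = j_poly (Polynomial.smult 2 (p Bas_f * q Bas_h - p Bas_h * q Bas_f))"
    unfolding hef_bracket by (auto simp: p q j_poly_def fun_eq_iff algebra_simps)
  then have "(x \<otimes>\<^bsub>hef_lie_algebra\<^esub> y) a \<in> range j_poly" for a by (cases a) simp_all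
  then show "x \<otimes>\<^bsub>hef_lie_algebra\<^esub> y \<in> carrier hef_lie_algebra" by (rule hef_carrierI)
  show "x \<oplus>\<^bsub>hef_lie_algebra\<^esub> y \<in> carrier hef_lie_algebra"
    "c \<odot>\<^bsub>hef_lie_algebra\<^esub> x \<in> carrier hef_lie_algebra"
    unfolding hef_simps p q j_poly_ops by (intro hef_carrierI rangeI)+
qed

lemma hef_lie_algebra: "complex_lie_algebra hef_lie_algebra"
proof -
  \<comment> \<open>The coefficients are already restricted to \<H>, which gives the laws for zero
    and one as equalities of functions.\<close>
  have restr: "(\<lambda>\<tau>\<in>\<H>. x a \<tau>) = x a" if "x \<in> carrier hef_lie_algebra" for x a
    using that by (auto simp: j_poly_def elim!: hef_carrierE)
  have group: "abelian_group hef_lie_algebra"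
  proof (rule abelian_groupI)
    show "\<zero>\<^bsub>hef_lie_algebra\<^esub> \<in> carrier hef_lie_algebra"
      unfolding hef_simps j_poly_ops by (intro hef_carrierI rangeI)
    fix x assume x: "x \<in> carrier hef_lie_algebra"
    have "(- 1) \<odot>\<^bsub>hef_lie_algebra\<^esub> x \<oplus>\<^bsub>hef_lie_algebra\<^esub> x = \<zero>\<^bsub>hef_lie_algebra\<^esub>"
      unfolding hef_simps by (intro ext restrict_ext) simp
    then show "\<exists>y\<in>carrier hef_lie_algebra. y \<oplus>\<^bsub>hef_lie_algebra\<^esub> x = \<zero>\<^bsub>hef_lie_algebra\<^esub>"
      using hef_closed(3)[OF x x] by blast
    show "\<zero>\<^bsub>hef_lie_algebra\<^esub> \<oplus>\<^bsub>hef_lie_algebra\<^esub> x = x"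
      unfolding hef_simps by (simp add: restr[OF x] cong: restrict_cong)
  qed (use hef_closed in \<open>auto simp: hef_simps add_ac fun_eq_iff\<close>)
  have "Module.module complex_ring hef_lie_algebra"
  proof (rule moduleI[OF complex_ring_cring group])
    show "\<one>\<^bsub>complex_ring\<^esub> \<odot>\<^bsub>hef_lie_algebra\<^esub> x = x" if "x \<in> carrier hef_lie_algebra" for x
      unfolding hef_simps complex_ring_def by (simp add: restr[OF that])
  qed (use hef_closed in \<open>auto simp: hef_simps complex_ring_def algebra_simps fun_eq_iff\<close>)
  then show ?thesis
    unfolding complex_lie_algebra_def complex_lie_algebra_axioms_def
    by (auto simp: hef_closed)
      (auto simp: hef_simps hef_bracket algebra_simps intro!: hef_ext restrict_ext)
qed

text \<open>In the frame, h is diag(1, -1), and e, f are the elementary nilpotent matrices scaled by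
  the generators of weights 2 and -2. The brackets are those of sl_2 except [e, f], which picks up
  the product of the two scalings.\<close>

definition hef_matrix :: "(hef \<Rightarrow> complex \<Rightarrow> complex) \<Rightarrow> complex \<Rightarrow> complex^2^2" where
  "hef_matrix x \<tau> = mat2 (x Bas_h \<tau>) (x Bas_e \<tau> * weight2 \<tau>) (x Bas_f \<tau> * weight_neg2 \<tau>) (- x Bas_h \<tau>)"

lemma hef_matrix_hom:
  assumes "\<tau> \<in> \<H>"
  shows "hef_matrix (x \<oplus>\<^bsub>hef_lie_algebra\<^esub> y) \<tau> = hef_matrix x \<tau> + hef_matrix y \<tau>"
    and "hef_matrix (c \<odot>\<^bsub>hef_lie_algebra\<^esub> x) \<tau> = map_matrix ((*) c) (hef_matrix x \<tau>)"
    and "hef_matrix (x \<otimes>\<^bsub>hef_lie_algebra\<^esub> y) \<tau> = commutator (hef_matrix x \<tau>) (hef_matrix y \<tau>)"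
proof -
  show "hef_matrix (x \<oplus>\<^bsub>hef_lie_algebra\<^esub> y) \<tau> = hef_matrix x \<tau> + hef_matrix y \<tau>"
    and "hef_matrix (c \<odot>\<^bsub>hef_lie_algebra\<^esub> x) \<tau> = map_matrix ((*) c) (hef_matrix x \<tau>)"
    using assms by (auto intro!: matrix2_eqI simp: hef_matrix_def hef_simps algebra_simps)
  \<comment> \<open>Writing j (j - 1728) as the product of the generators turns each entry into a
    polynomial identity.\<close>
  show "hef_matrix (x \<otimes>\<^bsub>hef_lie_algebra\<^esub> y) \<tau> = commutator (hef_matrix x \<tau>) (hef_matrix y \<tau>)"
    by (intro matrix2_eqI)
      (simp_all add: hef_matrix_def hef_bracket commutator_def mat2_mult assms
        weight2_times_weight_neg2[OF assms, symmetric], simp_all add: algebra_simps)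
qed

lemma frame_form_cong: "(\<And>\<tau>. \<tau> \<in> \<H> \<Longrightarrow> A \<tau> = B \<tau>) \<Longrightarrow> frame_form A = frame_form B"
  unfolding frame_form_def by (rule restrict_ext) simp

lemma frame_form_hom:
  "frame_form (\<lambda>\<tau>. A \<tau> + B \<tau>) = frame_form A \<oplus>\<^bsub>sl2_forms\<^esub> frame_form B"
  "frame_form (\<lambda>\<tau>. map_matrix ((*) c) (A \<tau>)) = c \<odot>\<^bsub>sl2_forms\<^esub> frame_form A"
  "frame_form (\<lambda>\<tau>. commutator (A \<tau>) (B \<tau>)) = frame_form A \<otimes>\<^bsub>sl2_forms\<^esub> frame_form B"
  unfolding frame_form_def sl2_forms_simps
  by (rule restrict_ext; simp add: matrix_add_ldistrib matrix_add_rdistrib matrix_mult_map_times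
      commutator_conj[OF frame_coframe(2)])+

definition hef_form :: "(hef \<Rightarrow> complex \<Rightarrow> complex) \<Rightarrow> complex \<Rightarrow> complex^2^2" where
  "hef_form x = frame_form (hef_matrix x)"

lemma hef_form_hom:
  "hef_form (x \<oplus>\<^bsub>hef_lie_algebra\<^esub> y) = hef_form x \<oplus>\<^bsub>sl2_forms\<^esub> hef_form y"
  "hef_form (c \<odot>\<^bsub>hef_lie_algebra\<^esub> x) = c \<odot>\<^bsub>sl2_forms\<^esub> hef_form x"
  "hef_form (x \<otimes>\<^bsub>hef_lie_algebra\<^esub> y) = hef_form x \<otimes>\<^bsub>sl2_forms\<^esub> hef_form y"
  unfolding hef_form_def frame_form_hom [symmetric]
  by (rule frame_form_cong, erule hef_matrix_hom)+

lemma hef_form_in_sl2_forms: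
  assumes "x \<in> carrier hef_lie_algebra"
  shows "hef_form x \<in> carrier sl2_forms"
proof -
  obtain p where p: "x = (\<lambda>a. j_poly (p a))" using assms by (rule hef_carrierE)
  show ?thesis unfolding hef_form_def
  proof (rule frame_form_in_sl2_forms)
    fix i k :: 2
    show "(\<lambda>\<tau>. hef_matrix x \<tau> $ i $ k) holomorphic_on \<H>"
      using exhaust_2[of i] exhaust_2[of k]
      by (auto simp: hef_matrix_def p
          intro!: holomorphic_intros j_poly_holomorphic weight2_holomorphic weight_neg2_holomorphic)
    show "cusp_growth (\<lambda>\<tau>. hef_matrix x \<tau> $ i $ k)"
      using exhaust_2[of i] exhaust_2[of k]
      by (auto simp: hef_matrix_def p intro!: cusp_growth_intros cusp_growth_j_poly)
  next
    fix \<gamma> \<tau> assume "\<gamma> \<in> SL2Z" "\<tau> \<in> \<H>"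
    then show "cocycle \<gamma> \<tau> ^ 2 * hef_matrix x (moebius \<gamma> \<tau>) $ 2 $ 1 = hef_matrix x \<tau> $ 2 $ 1"
      by (simp add: hef_matrix_def p j_poly_modular weight_neg2_modular[symmetric])
  qed (simp_all add: hef_matrix_def p j_poly_modular weight2_modular)
qed

text \<open>The factor \<open>w\<close> may have zeros, as both generators do at \<open>rho\<close>
  and i, so it is cancelled by analytic continuation and not pointwise.\<close>

lemma j_poly_eq_if_product_eq:
  assumes w: "w holomorphic_on \<H>" "a \<in> \<H>" "w a \<noteq> 0"
    and eq: "\<And>\<tau>. \<tau> \<in> \<H> \<Longrightarrow> j_poly p \<tau> * w \<tau> = j_poly q \<tau> * w \<tau>"
  shows "j_poly p = j_poly q"
proof
  fix \<tau>
  show "j_poly p \<tau> = j_poly q \<tau>"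
  proof (cases "\<tau> \<in> \<H>")
    case True
    have "j_poly p \<tau> - j_poly q \<tau> = 0"
    proof (rule eq_on_upper_half_plane[of w "\<lambda>\<tau>. j_poly p \<tau> - j_poly q \<tau>", OF w(1) _ w(2,3)])
      show "(\<lambda>\<tau>. j_poly p \<tau> - j_poly q \<tau>) holomorphic_on \<H>"
        by (intro holomorphic_intros j_poly_holomorphic)
      show "w \<tau> * (j_poly p \<tau> - j_poly q \<tau>) = 0" if "\<tau> \<in> \<H>" for \<tau>
        using eq[OF that] by (simp add: algebra_simps)
    qed (rule True)
    then show ?thesis by simp
  qed (simp add: j_poly_def)
qed

text \<open>Injectivity: the coordinates determine the three coefficients once the generators are
  cancelled. Surjectivity: the diagonal coordinate is a polynomial in j, and each off-diagonal one
  is a polynomial in j times the generator of its weight.\<close>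

lemma hef_form_bij: "bij_betw hef_form (carrier hef_lie_algebra) (carrier sl2_forms)"
proof (rule bij_betwI')
  fix x y assume x: "x \<in> carrier hef_lie_algebra" and y: "y \<in> carrier hef_lie_algebra"
  obtain p where p: "x = (\<lambda>a. j_poly (p a))" using x by (rule hef_carrierE)
  obtain q where q: "y = (\<lambda>a. j_poly (q a))" using y by (rule hef_carrierE)
  obtain a where a: "a \<in> \<H>" "weight2 a \<noteq> 0" "weight_neg2 a \<noteq> 0" by (rule weights_nonzero)
  show "hef_form x = hef_form y \<longleftrightarrow> x = y"
  proof
    assume eq: "hef_form x = hef_form y"
    have m: "hef_matrix x \<tau> = hef_matrix y \<tau>" if "\<tau> \<in> \<H>" for \<tau>
      by (rule frame_form_inject[OF eq[unfolded hef_form_def] that])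
    have h: "x Bas_h \<tau> = y Bas_h \<tau>" if "\<tau> \<in> \<H>" for \<tau>
      using arg_cong[OF m[OF that], of "\<lambda>A. A $ 1 $ 1"] by (simp add: hef_matrix_def)
    have e: "x Bas_e \<tau> * weight2 \<tau> = y Bas_e \<tau> * weight2 \<tau>" if "\<tau> \<in> \<H>" for \<tau>
      using arg_cong[OF m[OF that], of "\<lambda>A. A $ 1 $ 2"] by (simp only: hef_matrix_def mat2_nth)
    have f: "x Bas_f \<tau> * weight_neg2 \<tau> = y Bas_f \<tau> * weight_neg2 \<tau>" if "\<tau> \<in> \<H>" for \<tau>
      using arg_cong[OF m[OF that], of "\<lambda>A. A $ 2 $ 1"] by (simp only: hef_matrix_def mat2_nth)
    show "x = y"
    proof (rule hef_ext)
      show "x Bas_h = y Bas_h"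
        unfolding p q by (rule j_poly_eq_if_product_eq[of "\<lambda>_. 1", OF _ a(1)]) (use h in \<open>auto simp: p q\<close>)
      show "x Bas_e = y Bas_e"
        unfolding p q by (rule j_poly_eq_if_product_eq[OF weight2_holomorphic a(1,2)]) (use e in \<open>simp add: p q\<close>)
      show "x Bas_f = y Bas_f"
        unfolding p q by (rule j_poly_eq_if_product_eq[OF weight_neg2_holomorphic a(1,3)]) (use f in \<open>simp add: p q\<close>)
    qed
  qed simp
next
  fix f assume "f \<in> carrier sl2_forms"
  then obtain A where A: "f = frame_form A" "\<And>\<tau>. \<tau> \<in> \<H> \<Longrightarrow> A \<tau> $ 2 $ 2 = - A \<tau> $ 1 $ 1"
    "\<And>i k. (\<lambda>\<tau>. A \<tau> $ i $ k) holomorphic_on \<H>" "\<And>i k. cusp_growth (\<lambda>\<tau>. A \<tau> $ i $ k)"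
    "\<And>\<gamma> \<tau>. \<gamma> \<in> SL2Z \<Longrightarrow> \<tau> \<in> \<H> \<Longrightarrow> A (moebius \<gamma> \<tau>) $ 1 $ 1 = A \<tau> $ 1 $ 1"
    "\<And>\<gamma> \<tau>. \<gamma> \<in> SL2Z \<Longrightarrow> \<tau> \<in> \<H> \<Longrightarrow> A (moebius \<gamma> \<tau>) $ 1 $ 2 = cocycle \<gamma> \<tau> ^ 2 * A \<tau> $ 1 $ 2"
    "\<And>\<gamma> \<tau>. \<gamma> \<in> SL2Z \<Longrightarrow> \<tau> \<in> \<H> \<Longrightarrow> cocycle \<gamma> \<tau> ^ 2 * A (moebius \<gamma> \<tau>) $ 2 $ 1 = A \<tau> $ 2 $ 1"
    by (rule sl2_forms_frame_coordinates) blast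
  obtain a where a: "a \<in> \<H>" "weight2 a \<noteq> 0" "weight_neg2 a \<noteq> 0" by (rule weights_nonzero)
  obtain ph where ph: "\<And>\<tau>. \<tau> \<in> \<H> \<Longrightarrow> A \<tau> $ 1 $ 1 = poly ph (klein_j \<tau>)"
    using polynomial_in_klein_j[OF A(3) A(5) A(4)] by blast
  \<comment> \<open>Each off-diagonal coordinate is paired with the generator of the opposite
    weight, so that the product has weight 0.\<close>
  have mod12: "A (moebius \<gamma> \<tau>) $ 1 $ 2 * weight_neg2 (moebius \<gamma> \<tau>) = A \<tau> $ 1 $ 2 * weight_neg2 \<tau>"
    if "\<gamma> \<in> SL2Z" "\<tau> \<in> \<H>" for \<gamma> \<tau>
    unfolding A(6)[OF that] weight_neg2_modular[OF that, symmetric] by (simp only: mult_ac)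
  have mod21: "A (moebius \<gamma> \<tau>) $ 2 $ 1 * weight2 (moebius \<gamma> \<tau>) = A \<tau> $ 2 $ 1 * weight2 \<tau>"
    if "\<gamma> \<in> SL2Z" "\<tau> \<in> \<H>" for \<gamma> \<tau>
    unfolding A(7)[OF that, symmetric] weight2_modular[OF that] by (simp only: mult_ac)
  have prod: "weight_neg2 \<tau> * weight2 \<tau> = klein_j \<tau> * (klein_j \<tau> - 1728)" if "\<tau> \<in> \<H>" for \<tau>
    using weight2_times_weight_neg2[OF that] by (simp only: mult.commute)
  obtain pe where pe: "\<And>\<tau>. \<tau> \<in> \<H> \<Longrightarrow> A \<tau> $ 1 $ 2 = poly pe (klein_j \<tau>) * weight2 \<tau>"
    using weakly_holomorphic_multiple[OF A(3) A(4) weight_neg2_holomorphic cusp_growth_weight_neg2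
        weight_neg2_rho_i a(1,3) weight2_holomorphic prod mod12] by blast
  obtain pf where pf: "\<And>\<tau>. \<tau> \<in> \<H> \<Longrightarrow> A \<tau> $ 2 $ 1 = poly pf (klein_j \<tau>) * weight_neg2 \<tau>"
    using weakly_holomorphic_multiple[OF A(3) A(4) weight2_holomorphic cusp_growth_weight2
        weight2_rho_i a(1,2) weight_neg2_holomorphic weight2_times_weight_neg2 mod21] by blast
  define x where "x = (\<lambda>k. j_poly (case k of Bas_h \<Rightarrow> ph | Bas_e \<Rightarrow> pe | Bas_f \<Rightarrow> pf))"
  have "x \<in> carrier hef_lie_algebra" unfolding x_def by (intro hef_carrierI rangeI)
  moreover have "f = hef_form x"
    unfolding A(1) hef_form_def
    by (intro frame_form_cong matrix2_eqI) (simp_all add: hef_matrix_def x_def j_poly_def ph pe pf A(2))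
  ultimately show "\<exists>x\<in>carrier hef_lie_algebra. f = hef_form x" by blast
qed (rule hef_form_in_sl2_forms)

text \<open>The isomorphism is constructed from the free module to the equivariant maps, where it
  has an explicit formula, whereas the theorem asks for the opposite direction. Closure of
  \<open>L\<close> under its operations places the candidate values of the inverse in
  \<open>carrier L\<close>.\<close>

lemma lie_iso_inv_into:
  assumes L: "complex_lie_algebra L" and \<phi>: "\<phi> \<in> lie_iso L M"
  shows "inv_into (carrier L) \<phi> \<in> lie_iso M L"
proof -
  interpret complex_lie_algebra L by (rule L)
  let ?\<psi> = "inv_into (carrier L) \<phi>"
  have bij: "bij_betw \<phi> (carrier L) (carrier M)"
    and add: "\<And>x y. x \<in> carrier L \<Longrightarrow> y \<in> carrier L \<Longrightarrow> \<phi> (x \<oplus>\<^bsub>L\<^esub> y) = \<phi> x \<oplus>\<^bsub>M\<^esub> \<phi> y"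
    and smult: "\<And>c x. x \<in> carrier L \<Longrightarrow> \<phi> (c \<odot>\<^bsub>L\<^esub> x) = c \<odot>\<^bsub>M\<^esub> \<phi> x"
    and bracket: "\<And>x y. x \<in> carrier L \<Longrightarrow> y \<in> carrier L \<Longrightarrow> \<phi> (x \<otimes>\<^bsub>L\<^esub> y) = \<phi> x \<otimes>\<^bsub>M\<^esub> \<phi> y"
    using \<phi> by (auto simp: lie_iso_def)
  have \<psi>: "?\<psi> u \<in> carrier L" "\<phi> (?\<psi> u) = u" if "u \<in> carrier M" for u
    using bij that by (auto simp: bij_betw_def inv_into_into f_inv_into_f)
  have eq: "?\<psi> (\<phi> x) = x" if "x \<in> carrier L" for x
    using bij that by (auto simp: bij_betw_def)
  have "?\<psi> (u \<oplus>\<^bsub>M\<^esub> v) = ?\<psi> u \<oplus>\<^bsub>L\<^esub> ?\<psi> v" if "u \<in> carrier M" "v \<in> carrier M" for u v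
    using eq[of "?\<psi> u \<oplus>\<^bsub>L\<^esub> ?\<psi> v"] \<psi> that by (simp add: add)
  moreover have "?\<psi> (c \<odot>\<^bsub>M\<^esub> u) = c \<odot>\<^bsub>L\<^esub> ?\<psi> u" if "u \<in> carrier M" for c u
    using eq[of "c \<odot>\<^bsub>L\<^esub> ?\<psi> u"] \<psi> that smult_closed[of c "?\<psi> u"] by (simp add: smult complex_ring_def)
  moreover have "?\<psi> (u \<otimes>\<^bsub>M\<^esub> v) = ?\<psi> u \<otimes>\<^bsub>L\<^esub> ?\<psi> v" if "u \<in> carrier M" "v \<in> carrier M" for u v
    using eq[of "?\<psi> u \<otimes>\<^bsub>L\<^esub> ?\<psi> v"] \<psi> that by (simp add: bracket bracket_closed)
  ultimately show ?thesis
    using bij_betw_inv_into[OF bij] by (simp add: lie_iso_def)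
qed

theorem theorem1p2:
  shows "\<MM>\<^sub>0 sl2 SL2Z adjoint_action \<cong>\<^sub>L hef_lie_algebra"
proof -
  have "hef_form \<in> lie_iso hef_lie_algebra sl2_forms"
    using hef_form_bij by (simp add: lie_iso_def hef_form_hom)
  then have "lie_iso sl2_forms hef_lie_algebra \<noteq> {}"
    using lie_iso_inv_into[OF hef_lie_algebra] by blast
  then show ?thesis
    by (simp add: lie_isomorphic_def sl2_forms_lie_algebra hef_lie_algebra)
qed

end
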